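(* Let $n\in\mathbb{N}$, $n\geq 1$, let $p(t,x,y)=\frac{1}{(4\pi t)^{n/2}}\exp\left[-\frac{|x-y|^2}{4t}\right]$, $t>0$, $x,y\in\mathbb{R}^n$, be the Gauss kernel, and let $(S_t)_{t\ge0}$ be a $\beta$-stable subordinator for some $\beta\in(0,1)$, with inverse $(S_t^{-1})_{t\ge0}$. Let $$p^S(t,x,y)=\int_0^\infty p(s,x,y)\,\mathrm{d}_s\mathbb{P}(S_t\le s),\qquad p^{S^{-1}}(t,x,y)=\int_0^\infty p(s,x,y)\,\mathrm{d}_s\mathbb{P}(S_t^{-1}\le s).$$ (a) As $|x-y|t^{-1/(2\beta)}\to\infty$, $$p^S(t,x,y)\sim\frac{\beta4^\beta\Gamma\left(\frac n2+\beta\right)}{\pi^{n/2}\Gamma(1-\beta)}\,|x-y|^{-n-2\beta}t.$$ (b) As $|x-y|t^{-1/(2\beta)}\to0$, $$p^S(t,x,y)\sim\frac{\Gamma\left(\frac{n+1}{2}\right)\Gamma\left(\frac{n}{2\beta}\right)}{2\beta\pi^{(n+1)/2}\Gamma(n)}\,t^{-n/(2\beta)}.$$ (c) As $|x-y|^{-2/\beta}t\to\infty$, $$p^{S^{-1}}(t,x,y)\sim\begin{cases}\displaystyle\frac{1}{2\Gamma\left(1-\frac\beta2\right)}\,t^{-\beta/2},&\text{if } n=1,\\[12pt]\displaystyle\frac{\beta}{4\pi\Gamma(1-\beta)}\,t^{-\beta}\log\left[|x-y|^{-2/\beta}t\right],&\text{if } n=2,\\[12pt]\displaystyle\frac{\Gamma\left(\frac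 n2-1\right)}{4\pi^{n/2}\Gamma(1-\beta)}\,|x-y|^{2-n}t^{-\beta},&\text{if } n\ge3.\end{cases}$$ (d) As $|x-y|^{-2/\beta}t\to0$, $$p^{S^{-1}}(t,x,y)\sim K_1|x-y|^{-\frac{n(1-\beta)}{2-\beta}}t^{-\frac{n\beta}{2(2-\beta)}}\exp\left[-K_2|x-y|^{\frac{2}{2-\beta}}t^{-\frac{\beta}{2-\beta}}\right]$$ with the constants $$K_1:=\frac{1}{\sqrt{\beta(2-\beta)}}\,\pi^{-\frac n2}2^{-\frac{n}{2-\beta}}\beta^{\frac{n\beta}{2(2-\beta)}}\quad\text{and}\quad K_2:=(2-\beta)2^{-\frac{2}{2-\beta}}\beta^{\frac{\beta}{2-\beta}}.$$
   Context: A $\beta$-stable subordinator ($0<\beta<1$) is a non-decreasing Lévy process $S=(S_t)_{t\ge0}$ on $[0,\infty)$ with $\mathbb{E}\,e^{-rS_t}=e^{-tr^\beta}$ for $r>0$, $t\ge0$. Its generalized right-continuous inverse is $S_t^{-1}=\inf\{s\ge0: S_s>t\}$, $t\ge0$. The notation $\mathrm{d}_s\mathbb{P}(Y\le s)$ means integration with respect to the law of $Y$. The functions $p^S$ and $p^{S^{-1}}$ are the transition densities of $X_{S_t}$ and $X_{S_t^{-1}}$, where $X$ is a Brownian motion in $\mathbb{R}^n$ with transition density $p$, independent of $S$. Asymptotics: "$f(t,x,y)\sim g(t,x,y)$ as $A(t,x,y)\to\ell$" means that the ratio $f/g$ tends to $1$ as the quantity $A(t,x,y)$, with $t>0$ and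 $x,y\in\mathbb{R}^n$ ($x\ne y$ where a negative power of $|x-y|$ appears), tends to $\ell$ (so the convergence depends on $(t,x,y)$ only through $A$). *)

theory Defs
  imports "HOL-Probability.Probability" "HOL-Library.Landau_Symbols"
begin

text \<open>
  Path properties are only required almost surely; the time set is the half-line of nonnegative
  reals, so the values of \<open>X\<close> at negative times are irrelevant.
\<close>

locale levy_process = prob_space M for M :: "'w measure" +
  fixes X :: "real \<Rightarrow> 'w \<Rightarrow> real"
  assumes random_variable_X: "\<And>t. t \<ge> 0 \<Longrightarrow> random_variable borel (X t)"
    and start_zero: "AE \<omega> in M. X 0 \<omega> = 0"
    and independent_increments:
      "\<And>(m::nat) \<tau>. 0 \<le> \<tau> 0 \<Longrightarrow> (\<And>i. i < m \<Longrightarrow> \<tau> i \<le> \<tau> (Suc i)) \<Longrightarrow>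
         indep_vars (\<lambda>_. borel) (\<lambda>i \<omega>. X (\<tau> (Suc i)) \<omega> - X (\<tau> i) \<omega>) {..<m}"
    and stationary_increments:
      "\<And>s h. 0 \<le> s \<Longrightarrow> 0 \<le> h \<Longrightarrow>
         distr M borel (\<lambda>\<omega>. X (s + h) \<omega> - X s \<omega>) = distr M borel (\<lambda>\<omega>. X h \<omega> - X 0 \<omega>)"
    and cadlag_paths:
      "AE \<omega> in M. (\<forall>t\<ge>0. ((\<lambda>s. X s \<omega>) \<longlongrightarrow> X t \<omega>) (at_right t)) \<and>
                   (\<forall>t>0. \<exists>l. ((\<lambda>s. X s \<omega>) \<longlongrightarrow> l) (at_left t))"

locale stable_subordinator = levy_process M S
  for M :: "'w measure" and S :: "real \<Rightarrow> 'w \<Rightarrow> real" +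
  fixes \<beta> :: real
  assumes stability_index: "0 < \<beta>" "\<beta> < 1"
    and nondecreasing_paths: "AE \<omega> in M. \<forall>s\<ge>0. \<forall>t\<ge>s. S s \<omega> \<le> S t \<omega>"
    and laplace_transform:
      "\<And>r t. r > 0 \<Longrightarrow> t \<ge> 0 \<Longrightarrow> expectation (\<lambda>\<omega>. exp (- r * S t \<omega>)) = exp (- t * r powr \<beta>)"

text \<open>
  The infimum is taken over a nonempty set for almost every \<open>\<omega>\<close>, because a stable
  subordinator is almost surely unbounded.
\<close>

definition generalized_inverse :: "(real \<Rightarrow> 'w \<Rightarrow> real) \<Rightarrow> real \<Rightarrow> 'w \<Rightarrow> real" where
  "generalized_inverse S t \<omega> = Inf {s. 0 \<le> s \<and> S s \<omega> > t}"

text \<open>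
  The completion is used because, with path properties holding only almost surely, the
  generalized inverse need only be measurable up to null sets. For variables that are
  measurable with respect to \<open>M\<close> this is the usual distribution.
\<close>

definition law :: "'w measure \<Rightarrow> ('w \<Rightarrow> real) \<Rightarrow> real measure" where
  "law M Y = distr (completion M) borel Y"

definition gauss_kernel :: "real \<Rightarrow> real ^ 'n \<Rightarrow> real ^ 'n \<Rightarrow> real" where
  "gauss_kernel t x y =
     1 / (4 * pi * t) powr (real CARD('n) / 2) * exp (- (norm (x - y))\<^sup>2 / (4 * t))"

text \<open>
  The integral extends over the open half-line, where the kernel is defined; for \<open>t > 0\<close>
  neither a stable subordinator nor its inverse charges the origin at time \<open>t\<close>.
\<close>

definition subordinated_kernel ::
    "'w measure \<Rightarrow> (real \<Rightarrow> 'w \<Rightarrow> real) \<Rightarrow> real \<Rightarrow> real ^ 'n \<Rightarrow> real ^ 'n \<Rightarrow> real" where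
  "subordinated_kernel M T t x y = (LINT s:{0<..}|law M (T t). gauss_kernel s x y)"

text \<open>
  The filter of a limit taken over points of \<open>D\<close>, in which only the quantity \<open>A\<close> is
  controlled: a property holds eventually iff, for some \<open>Q\<close> holding eventually along \<open>F\<close>, it
  holds at all points \<open>z\<close> of \<open>D\<close> with \<open>Q (A z)\<close>.
\<close>

definition when_tends :: "('z \<Rightarrow> real) \<Rightarrow> real filter \<Rightarrow> 'z set \<Rightarrow> 'z filter" where
  "when_tends A F D = inf (filtercomap A F) (principal D)"

end

theory Submission
  imports Defs "HOL-Complex_Analysis.Complex_Analysis" "HOL-Real_Asymp.Real_Asymp"
begin

text \<open>
  By scaling, \<open>S t\<close> is distributed as \<open>t powr (1 / \<beta>) * S 1\<close> and its inverse at time \<open>t\<close> as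
  \<open>(t / S 1) powr \<beta>\<close>, so both kernels are a power of \<open>t\<close> times a function of one variable, an expectation
  over \<open>S 1\<close>. The limits (a) and (c) are governed by the tail \<open>P (S 1 \<ge> x) \<sim> x powr (- \<beta>) / \<Gamma> (1 - \<beta>)\<close>,
  which follows from the Laplace transform by weak convergence of the exponentially damped tails; (b) and
  the one-dimensional case of (c) are convergence of moments. For (d) one tilts the law of \<open>S 1\<close> by
  \<open>S powr (- (\<beta> * p))\<close>, with \<open>p\<close> chosen so that the integrand is largest where the tilted law concentrates.
  The moments \<open>E (S powr (- (\<beta> * p))) = \<Gamma> (1 + p) / \<Gamma> (1 + p * \<beta>)\<close> and Stirling's formula show that
  \<open>ln S\<close> is asymptotically normal under the tilt. In the variable \<open>ln S\<close> the remaining integrand is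
  log-concave, hence bounded after normalisation, so weak convergence suffices for its expectation.
\<close>

section \<open>Convergence of moment generating functions\<close>

text \<open>No density of \<open>S 1\<close> is used: everything is drawn from its Laplace
  transform. The obstacle is that weak convergence is characterised by characteristic functions,
  while only exponential integrals at real exponents are computable; hence the passage to complex
  exponents by analytic continuation. For (d), put Y = -\<beta> ln S. The integrand S^(\<beta> a)
  exp(-q S^\<beta> / 4), divided by the tilting weight S^(-\<beta> p), is exp(-(a + p) Y - (q / 4)
  exp(-Y)). With the fixed a neglected against p it peaks where exp Y = q / (4 p). Equating this Y
  with the approximate mean \<open>centre p\<close> gives q = 4 p exp(centre p), which can be solved
  for p explicitly. Under the tilt, sqrt p (Y - centre p) tends to a centred normal variable Z of
  variance 1 - \<beta>, and the normalised integrand to exp(-Z^2 / 2), whose mean is 1 / sqrt(2 -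
  \<beta>). The other factor 1 / sqrt \<beta> of \<open>K1\<close> comes from the square roots in
  Stirling's formula for the two Gamma values.\<close>

lemma integrable_exp_complex:
  fixes \<mu> :: "real measure" and z :: complex
  assumes sets [measurable_cong]: "sets \<mu> = sets borel"
    and "integrable \<mu> (\<lambda>x. exp (a * x))" "integrable \<mu> (\<lambda>x. exp (b * x))"
    and z: "a \<le> Re z" "Re z \<le> b"
  shows "integrable \<mu> (\<lambda>x. exp (z * of_real x))"
    and "norm (\<integral>x. exp (z * of_real x) \<partial>\<mu>) \<le> (\<integral>x. exp (a * x) \<partial>\<mu>) + (\<integral>x. exp (b * x) \<partial>\<mu>)"
proof -
  have int: "integrable \<mu> (\<lambda>x. exp (a * x) + exp (b * x))"
    using assms by simp
  have bound: "norm (exp (z * of_real x)) \<le> exp (a * x) + exp (b * x)" for x :: real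
  proof -
    \<comment> \<open>For x >= 0 the edge b dominates, for x <= 0 the edge a; the sum of both
      exponentials bounds the integrand uniformly in the strip.\<close>
    have "Re z * x \<le> a * x \<or> Re z * x \<le> b * x"
      using z by (metis linear mult_right_mono mult_right_mono_neg)
    then have "exp (Re z * x) \<le> exp (a * x) \<or> exp (Re z * x) \<le> exp (b * x)"
      by simp
    then have "exp (Re z * x) \<le> exp (a * x) + exp (b * x)"
      by (smt (verit) exp_gt_zero)
    then show ?thesis
      by simp
  qed
  show "integrable \<mu> (\<lambda>x. exp (z * of_real x))"
    by (rule Bochner_Integration.integrable_bound[OF int]) (use bound in \<open>auto simp: abs_of_nonneg add_nonneg_nonneg\<close>)
  then have "norm (\<integral>x. exp (z * of_real x) \<partial>\<mu>) \<le> (\<integral>x. exp (a * x) + exp (b * x) \<partial>\<mu>)"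
    by (rule Bochner_Integration.integral_norm_bound_integral[OF _ int]) (rule bound)
  also have "\<dots> = (\<integral>x. exp (a * x) \<partial>\<mu>) + (\<integral>x. exp (b * x) \<partial>\<mu>)"
    using assms by simp
  finally show "norm (\<integral>x. exp (z * of_real x) \<partial>\<mu>) \<le> (\<integral>x. exp (a * x) \<partial>\<mu>) + (\<integral>x. exp (b * x) \<partial>\<mu>)" .
qed

text \<open>Differentiation under the integral. The derivative carries an extra factor x, so z must
  lie strictly inside the strip: the gap to the edges absorbs it.\<close>

lemma has_field_derivative_integral_exp:
  fixes \<mu> :: "real measure" and z :: complex
  assumes sets [measurable_cong]: "sets \<mu> = sets borel"
    and a: "integrable \<mu> (\<lambda>x. exp (a * x))" and b: "integrable \<mu> (\<lambda>x. exp (b * x))"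
    and z: "a < Re z" "Re z < b"
  shows "((\<lambda>z. \<integral>x. exp (z * of_real x) \<partial>\<mu>) has_field_derivative
           (\<integral>x. of_real x * exp (z * of_real x) \<partial>\<mu>)) (at z)"
proof -
  \<comment> \<open>Half the distance to the nearer edge, because the bound spends \<delta> |x|
    twice in the exponent: once on the Taylor remainder of exp(X i * x) and once on \<delta> |x| <=
    exp(\<delta> |x|).\<close>
  define \<delta> where "\<delta> = min (Re z - a) (b - Re z) / 2"
  have \<delta>: "\<delta> > 0" "a + 2 * \<delta> \<le> Re z" "Re z + 2 * \<delta> \<le> b"
    using z by (auto simp: \<delta>_def min_def field_simps)
  have "((\<lambda>h. ((\<integral>x. exp ((z + h) * of_real x) \<partial>\<mu>) - (\<integral>x. exp (z * of_real x) \<partial>\<mu>)) / h)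
          \<longlongrightarrow> (\<integral>x. of_real x * exp (z * of_real x) \<partial>\<mu>)) (at 0 within ball 0 \<delta>)"
    unfolding tendsto_at_iff_sequentially
  proof (intro allI impI)
    fix X :: "nat \<Rightarrow> complex" assume X: "\<forall>i. X i \<in> ball 0 \<delta> - {0}" and lim: "X \<longlonglongrightarrow> 0"
    have X0: "X i \<noteq> 0" and Xd: "norm (X i) < \<delta>" for i
      using X by (auto simp: dist_norm)
    have int: "integrable \<mu> (\<lambda>x. exp (w * of_real x))" if "dist z w < \<delta>" for w :: complex
    proof (rule integrable_exp_complex(1)[OF sets a b])
      have "\<bar>Re z - Re w\<bar> < \<delta>"
        using that abs_Re_le_cmod[of "z - w"] by (simp add: dist_norm)
      then show "a \<le> Re w" "Re w \<le> b"
        using \<delta> by auto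
    qed
    let ?q = "\<lambda>i x. (exp ((z + X i) * of_real x) - exp (z * of_real x)) / X i"
    have "(\<lambda>i. \<integral>x. ?q i x \<partial>\<mu>) \<longlonglongrightarrow> (\<integral>x. of_real x * exp (z * of_real x) \<partial>\<mu>)"
    proof (rule integral_dominated_convergence)
      show "integrable \<mu> (\<lambda>x. (exp (a * x) + exp (b * x)) / \<delta>)"
        using a b by simp
      show "AE x in \<mu>. (\<lambda>i. ?q i x) \<longlonglongrightarrow> of_real x * exp (z * of_real x)"
      proof (intro AE_I2)
        fix x
        have "((\<lambda>w. exp (w * of_real x)) has_field_derivative of_real x * exp (z * of_real x)) (at z)"
          by (auto intro!: derivative_eq_intros)
        then have "((\<lambda>h. (exp ((z + h) * of_real x) - exp (z * of_real x)) / h)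
            \<longlongrightarrow> of_real x * exp (z * of_real x)) (at 0)"
          by (simp add: DERIV_def)
        moreover have "filterlim X (at 0) sequentially"
          using lim X0 by (simp add: filterlim_at)
        ultimately show "(\<lambda>i. ?q i x) \<longlonglongrightarrow> of_real x * exp (z * of_real x)"
          by (rule filterlim_compose)
      qed
      fix i
      show "AE x in \<mu>. norm (?q i x) \<le> (exp (a * x) + exp (b * x)) / \<delta>"
      proof (intro AE_I2)
        fix x :: real
        have "?q i x = exp (z * of_real x) * (exp (X i * of_real x) - 1) / X i"
          by (simp add: exp_add ring_distribs)
        then have "norm (?q i x) = exp (Re z * x) * norm (exp (X i * of_real x) - 1) / norm (X i)"
          by (simp only: norm_mult norm_divide norm_exp_eq_Re) simp
        also have "\<dots> \<le> exp (Re z * x) * (exp (\<delta> * \<bar>x\<bar>) * (norm (X i) * \<bar>x\<bar>)) / norm (X i)"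
        proof (intro divide_right_mono mult_left_mono)
          have "norm (exp (X i * of_real x) - 1) \<le> exp \<bar>Re (X i * of_real x)\<bar> * norm (X i * of_real x)"
            using Taylor_exp[of "X i * of_real x" 0] by simp
          also have "\<dots> \<le> exp (\<delta> * \<bar>x\<bar>) * (norm (X i) * \<bar>x\<bar>)"
          proof (intro mult_mono)
            have "\<bar>Re (X i)\<bar> \<le> \<delta>"
              using abs_Re_le_cmod[of "X i"] Xd[of i] by linarith
            then show "exp \<bar>Re (X i * of_real x)\<bar> \<le> exp (\<delta> * \<bar>x\<bar>)"
              by (simp add: abs_mult mult_right_mono)
          qed (auto simp: norm_mult)
          finally show "norm (exp (X i * of_real x) - 1) \<le> exp (\<delta> * \<bar>x\<bar>) * (norm (X i) * \<bar>x\<bar>)" .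
        qed auto
        also have "\<dots> = exp (Re z * x) * exp (\<delta> * \<bar>x\<bar>) * (\<delta> * \<bar>x\<bar>) / \<delta>"
          using X0[of i] \<delta> by (simp add: field_simps)
        also have "\<dots> \<le> exp (Re z * x) * exp (\<delta> * \<bar>x\<bar>) * exp (\<delta> * \<bar>x\<bar>) / \<delta>"
          using exp_ge_add_one_self[of "\<delta> * \<bar>x\<bar>"] \<delta>(1)
          by (intro divide_right_mono mult_left_mono) (auto simp del: exp_ge_add_one_self)
        also have "\<dots> = exp (Re z * x + 2 * \<delta> * \<bar>x\<bar>) / \<delta>"
          by (simp add: exp_add[symmetric])
        also have "\<dots> \<le> (exp (a * x) + exp (b * x)) / \<delta>"
        proof (intro divide_right_mono)
          have "Re z * x + 2 * \<delta> * \<bar>x\<bar> \<le> a * x \<or> Re z * x + 2 * \<delta> * \<bar>x\<bar> \<le> b * x"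
          proof (cases "x \<ge> 0")
            case True
            then show ?thesis
              using mult_right_mono[OF \<delta>(3), of x] by (simp add: algebra_simps)
          next
            case False
            then show ?thesis
              using mult_right_mono_neg[OF \<delta>(2), of x] by (simp add: algebra_simps)
          qed
          then have "exp (Re z * x + 2 * \<delta> * \<bar>x\<bar>) \<le> exp (a * x) \<or> exp (Re z * x + 2 * \<delta> * \<bar>x\<bar>) \<le> exp (b * x)"
            by simp
          then show "exp (Re z * x + 2 * \<delta> * \<bar>x\<bar>) \<le> exp (a * x) + exp (b * x)"
            by (smt (verit) exp_gt_zero)
        qed (use \<delta> in auto)
        finally show "norm (?q i x) \<le> (exp (a * x) + exp (b * x)) / \<delta>" .
      qed
    qed measurable
    moreover have "(\<integral>x. ?q i x \<partial>\<mu>) = ((\<integral>x. exp ((z + X i) * of_real x) \<partial>\<mu>) - (\<integral>x. exp (z * of_real x) \<partial>\<mu>)) / X i" for i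
    proof -
      have "integrable \<mu> (\<lambda>x. exp ((z + X i) * of_real x))" "integrable \<mu> (\<lambda>x. exp (z * of_real x))"
        using Xd[of i] \<delta> by (auto intro!: int simp: dist_norm)
      then show ?thesis
        by simp
    qed
    ultimately show "((\<lambda>h. ((\<integral>x. exp ((z + h) * of_real x) \<partial>\<mu>) - (\<integral>x. exp (z * of_real x) \<partial>\<mu>)) / h) \<circ> X)
        \<longlonglongrightarrow> (\<integral>x. of_real x * exp (z * of_real x) \<partial>\<mu>)"
      by (simp only: comp_def)
  qed
  then show ?thesis
    using at_within_open[of 0 "ball (0::complex) \<delta>"] \<delta>(1) by (simp add: DERIV_def)
qed

section \<open>Passage from real to complex exponents\<close>

lemma tendsto_if_subseq_tendsto:
  fixes X :: "nat \<Rightarrow> 'a :: topological_space"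
  assumes "\<And>r. strict_mono r \<Longrightarrow> \<exists>s. strict_mono (s :: nat \<Rightarrow> nat) \<and> (\<lambda>n. X (r (s n))) \<longlonglongrightarrow> L"
  shows "X \<longlonglongrightarrow> L"
proof (rule ccontr)
  assume "\<not> X \<longlonglongrightarrow> L"
  then obtain U where U: "open U" "L \<in> U" and "\<not> eventually (\<lambda>n. X n \<in> U) sequentially"
    by (auto simp: tendsto_def)
  then have inf: "infinite {n. X n \<notin> U}"
    unfolding cofinite_eq_sequentially[symmetric] eventually_cofinite by simp
  \<comment> \<open>Enumerates the indices at which X lies outside U, so no further subsequence can
    enter U.\<close>
  define r where "r = enumerate {n. X n \<notin> U}"
  have "strict_mono r"
    unfolding r_def using inf by (rule strict_mono_enumerate)
  then obtain s where "(\<lambda>n. X (r (s n))) \<longlonglongrightarrow> L"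
    using assms by blast
  then have "eventually (\<lambda>n. X (r (s n)) \<in> U) sequentially"
    using U by (auto simp: tendsto_def)
  moreover have "X (r n) \<notin> U" for n
    using enumerate_in_set[OF inf, of n] by (simp add: r_def)
  ultimately show False
    by simp
qed

text \<open>
  A form of Vitali's theorem: by Montel's theorem every subsequence has a locally uniformly
  convergent subsequence, whose limit is determined by its values on the real interval.
\<close>

lemma holomorphic_tendsto_from_reals:
  fixes f :: "nat \<Rightarrow> complex \<Rightarrow> complex" and a b :: real
  assumes \<Omega>: "open \<Omega>" "connected \<Omega>"
    and f: "\<And>k. f k holomorphic_on \<Omega>" and F: "F holomorphic_on \<Omega>"
    and bounded: "\<And>K. compact K \<Longrightarrow> K \<subseteq> \<Omega> \<Longrightarrow> \<exists>B. \<forall>k. \<forall>z\<in>K. norm (f k z) \<le> B"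
    and "a < b" and in\<Omega>: "\<And>r. a < r \<Longrightarrow> r < b \<Longrightarrow> of_real r \<in> \<Omega>"
    and lim: "\<And>r. a < r \<Longrightarrow> r < b \<Longrightarrow> (\<lambda>k. f k (of_real r)) \<longlonglongrightarrow> F (of_real r)"
    and "z \<in> \<Omega>"
  shows "(\<lambda>k. f k z) \<longlonglongrightarrow> F z"
proof (rule tendsto_if_subseq_tendsto)
  fix r :: "nat \<Rightarrow> nat" assume r: "strict_mono r"
  obtain g s where g: "g holomorphic_on \<Omega>" and s: "strict_mono (s :: nat \<Rightarrow> nat)"
    and lim_g: "\<And>x. x \<in> \<Omega> \<Longrightarrow> ((\<lambda>n. (f \<circ> r) (s n) x) \<longlongrightarrow> g x) sequentially"
    by (rule Montel[OF \<Omega>(1), of "range f" "f \<circ> r"]) (use f bounded in auto)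
  let ?I = "of_real ` {a<..<b} :: complex set"
  let ?c = "(a + b) / 2"
  have "F w - g w = 0" if "w \<in> \<Omega>" for w
  proof (rule analytic_continuation[of "\<lambda>w. F w - g w" \<Omega> ?I "of_real ?c"])
    show "(\<lambda>w. F w - g w) holomorphic_on \<Omega>"
      using F g by (intro holomorphic_intros)
    show "complex_of_real ?c \<in> \<Omega>"
      by (rule in\<Omega>) (use \<open>a < b\<close> in auto)
    show "complex_of_real ?c islimpt ?I"
    proof (rule islimpt_isCont_image)
      show "?c islimpt {a<..<b}"
        using \<open>a < b\<close> by (intro interior_limit_point) (simp add: interior_open)
      show "\<forall>\<^sub>F y in at ?c. complex_of_real y \<noteq> complex_of_real ?c"
        by (simp add: eventually_at_filter del: of_real_add of_real_divide)
    qed auto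
    fix u assume "u \<in> ?I"
    then obtain \<rho> where \<rho>: "u = of_real \<rho>" "a < \<rho>" "\<rho> < b"
      by auto
    have "(\<lambda>n. f (r (s n)) u) \<longlonglongrightarrow> g u"
      using lim_g[of u] in\<Omega> \<rho> by simp
    moreover have "(\<lambda>n. f (r (s n)) u) \<longlonglongrightarrow> F u"
      using LIMSEQ_subseq_LIMSEQ[OF LIMSEQ_subseq_LIMSEQ[OF lim[OF \<rho>(2,3)] r] s] \<rho> by (simp add: comp_def)
    ultimately show "F u - g u = 0"
      using LIMSEQ_unique by fastforce
  qed (use \<Omega> in\<Omega> that in auto)
  then show "\<exists>s. strict_mono s \<and> (\<lambda>n. f (r (s n)) z) \<longlonglongrightarrow> F z"
    using lim_g[OF \<open>z \<in> \<Omega>\<close>] s \<open>z \<in> \<Omega>\<close> by (auto simp: comp_def)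
qed

text \<open>Both hypotheses of the Vitali argument come from the real axis: integrability at real
  exponents gives holomorphy in the strip, and the modulus at z is controlled by exponential
  integrals at real exponents, which converge and are hence bounded.\<close>

lemma integral_exp_tendsto:
  fixes M :: "nat \<Rightarrow> real measure" and \<mu> :: "real measure"
  assumes sets: "\<And>k. sets (M k) = sets borel" "sets \<mu> = sets borel"
    and int: "\<And>k r. a < r \<Longrightarrow> r < b \<Longrightarrow> integrable (M k) (\<lambda>x. exp (r * x))"
      "\<And>r. a < r \<Longrightarrow> r < b \<Longrightarrow> integrable \<mu> (\<lambda>x. exp (r * x))"
    and lim: "\<And>r. a < r \<Longrightarrow> r < b \<Longrightarrow> (\<lambda>k. \<integral>x. exp (r * x) \<partial>M k) \<longlonglongrightarrow> (\<integral>x. exp (r * x) \<partial>\<mu>)"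
    and z: "a < Re z" "Re z < b"
  shows "(\<lambda>k. \<integral>x. exp (z * of_real x) \<partial>M k) \<longlonglongrightarrow> (\<integral>x. exp (z * of_real x) \<partial>\<mu>)"
proof -
  let ?\<Omega> = "{z. a < Re z} \<inter> {z. Re z < b}"
  let ?F = "\<lambda>M z. \<integral>x. exp (z * complex_of_real x) \<partial>(M :: real measure)"
  have hol: "?F M holomorphic_on ?\<Omega>"
    if M: "sets M = sets borel" "\<And>r. a < r \<Longrightarrow> r < b \<Longrightarrow> integrable M (\<lambda>x. exp (r * x))" for M
  proof (rule holomorphic_onI)
    fix z assume "z \<in> ?\<Omega>"
    then obtain a' b' where "a < a'" "a' < Re z" "Re z < b'" "b' < b"
      using dense by (metis IntE mem_Collect_eq)
    then show "?F M field_differentiable at z within ?\<Omega>"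
      using has_field_derivative_integral_exp[OF M(1), of a' b' z] M(2)[of a'] M(2)[of b']
      by (auto simp: field_differentiable_def intro: DERIV_subset)
  qed
  show ?thesis
  proof (rule holomorphic_tendsto_from_reals[of ?\<Omega> "\<lambda>k. ?F (M k)" "?F \<mu>" a b])
    show "connected ?\<Omega>"
      by (intro convex_connected convex_Int convex_halfspace_Re_gt convex_halfspace_Re_lt)
    show "\<exists>B. \<forall>k. \<forall>z\<in>K. norm (?F (M k) z) \<le> B" if K: "compact K" "K \<subseteq> ?\<Omega>" for K
    proof (cases "K = {}")
      case False
      have cont: "continuous_on K Re"
        by (intro continuous_intros)
      \<comment> \<open>The compact set lies between the vertical lines through its leftmost point u
        and its rightmost point v, so the bounded sequences at \<open>Re u\<close> and
        \<open>Re v\<close> bound the family on all of K.\<close>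
      obtain u where u: "u \<in> K" "\<And>z. z \<in> K \<Longrightarrow> Re u \<le> Re z"
        using continuous_attains_inf[OF K(1) False cont] by blast
      obtain v where v: "v \<in> K" "\<And>z. z \<in> K \<Longrightarrow> Re z \<le> Re v"
        using continuous_attains_sup[OF K(1) False cont] by blast
      have uv: "a < Re u" "Re u < b" "a < Re v" "Re v < b"
        using u v K by auto
      have "Bseq (\<lambda>k. (\<integral>x. exp (Re u * x) \<partial>M k) + (\<integral>x. exp (Re v * x) \<partial>M k))"
        by (rule convergent_imp_Bseq, rule convergentI, rule tendsto_add[OF lim[OF uv(1,2)] lim[OF uv(3,4)]])
      then obtain B where B: "\<And>k. norm ((\<integral>x. exp (Re u * x) \<partial>M k) + (\<integral>x. exp (Re v * x) \<partial>M k)) \<le> B"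
        by (auto simp: Bseq_def)
      have "norm (?F (M k) z) \<le> B" if "z \<in> K" for k z
        using integrable_exp_complex(2)[OF sets(1) int(1) int(1), of "Re u" "Re v" z k] uv u(2) v(2) that B[of k]
        by force
      then show ?thesis
        by blast
    qed auto
    have "a < b"
      using z by simp
    then show "a < b" .
    have of_real: "?F M (of_real r) = of_real (\<integral>x. exp (r * x) \<partial>M)" for M r
      by (simp only: integral_complex_of_real[symmetric] exp_of_real[symmetric] of_real_mult)
    show "(\<lambda>k. ?F (M k) (of_real r)) \<longlonglongrightarrow> ?F \<mu> (of_real r)" if "a < r" "r < b" for r
      unfolding of_real by (intro tendsto_of_real lim that)
  qed (use z sets int in \<open>auto intro!: hol open_Int open_halfspace_Re_gt open_halfspace_Re_lt\<close>)
qed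

text \<open>The real exponents fill an interval around 0, so the imaginary axis lies inside the
  strip of convergence and the characteristic functions converge.\<close>

lemma weak_conv_m_if_mgf_tendsto:
  fixes M :: "nat \<Rightarrow> real measure" and \<mu> :: "real measure"
  assumes M: "\<And>k. real_distribution (M k)" and \<mu>: "real_distribution \<mu>" and "b > 0"
    and int: "\<And>k r. \<bar>r\<bar> < b \<Longrightarrow> integrable (M k) (\<lambda>x. exp (r * x))"
      "\<And>r. \<bar>r\<bar> < b \<Longrightarrow> integrable \<mu> (\<lambda>x. exp (r * x))"
    and lim: "\<And>r. \<bar>r\<bar> < b \<Longrightarrow> (\<lambda>k. \<integral>x. exp (r * x) \<partial>M k) \<longlonglongrightarrow> (\<integral>x. exp (r * x) \<partial>\<mu>)"
  shows "weak_conv_m M \<mu>"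
proof (rule levy_continuity[OF M \<mu>])
  fix t :: real
  have sets: "sets (M k) = sets borel" "sets \<mu> = sets borel" for k
    using M[of k] \<mu> by (simp_all add: real_distribution.events_eq_borel)
  have "(\<lambda>k. \<integral>x. exp ((\<i> * of_real t) * of_real x) \<partial>M k) \<longlonglongrightarrow> (\<integral>x. exp ((\<i> * of_real t) * of_real x) \<partial>\<mu>)"
    by (rule integral_exp_tendsto[of M \<mu> "-b" b]) (use sets int lim \<open>b > 0\<close> in auto)
  then show "(\<lambda>k. char (M k) t) \<longlonglongrightarrow> char \<mu> t"
    by (simp add: char_def mult.assoc)
qed

text \<open>Measures on the half-line may lack positive exponential moments, so the imaginary axis
  is only the boundary of the half-plane of holomorphy. Equality is obtained in the open half-plane
  and carried to the boundary by dominated convergence.\<close>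

lemma Laplace_transform_uniqueness:
  fixes \<mu> \<nu> :: "real measure"
  assumes \<mu>: "real_distribution \<mu>" "AE x in \<mu>. x \<ge> 0" and \<nu>: "real_distribution \<nu>" "AE x in \<nu>. x \<ge> 0"
    and eq: "\<And>r. r > 0 \<Longrightarrow> (\<integral>x. exp (- r * x) \<partial>\<mu>) = (\<integral>x. exp (- r * x) \<partial>\<nu>)"
  shows "\<mu> = \<nu>"
proof (rule Levy_uniqueness[OF \<mu>(1) \<nu>(1)], rule ext)
  fix t :: real
  have sets: "sets \<mu> = sets borel" "sets \<nu> = sets borel"
    using \<mu> \<nu> by (simp_all add: real_distribution.events_eq_borel)
  have int: "integrable M (\<lambda>x. exp (r * x))"
    if "real_distribution M" "AE x in M. x \<ge> 0" "r < 0" for r and M :: "real measure"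
  proof -
    interpret M: real_distribution M
      by fact
    show ?thesis
    proof (rule M.integrable_const_bound[where B = 1])
      show "AE x in M. norm (exp (r * x)) \<le> 1"
        using that(2) by eventually_elim (use that(3) in \<open>auto simp: mult_nonpos_nonneg\<close>)
    qed auto
  qed
  \<comment> \<open>Points approaching i t from the left; their real parts lie in [-1, 0), inside
    the strip from -2 to 0 used below.\<close>
  let ?z = "\<lambda>k. Complex (- (1 / real (Suc k))) t"
  have lim: "(\<lambda>k. \<integral>x. exp (?z k * of_real x) \<partial>M) \<longlonglongrightarrow> char M t"
    if "real_distribution M" "AE x in M. x \<ge> 0" for M :: "real measure"
  proof -
    interpret M: real_distribution M
      by fact
    have "(\<lambda>k. \<integral>x. exp (?z k * of_real x) \<partial>M) \<longlonglongrightarrow> (\<integral>x. exp (Complex 0 t * of_real x) \<partial>M)"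
    proof (rule integral_dominated_convergence[where w = "\<lambda>_. 1"])
      have "?z \<longlonglongrightarrow> Complex 0 t"
        by (rule tendsto_Complex) real_asymp+
      then have "(\<lambda>k. exp (?z k * of_real x)) \<longlonglongrightarrow> exp (Complex 0 t * of_real x)" for x
        by (intro tendsto_exp tendsto_mult tendsto_const)
      then show "AE x in M. (\<lambda>k. exp (?z k * of_real x)) \<longlonglongrightarrow> exp (Complex 0 t * of_real x)"
        by simp
      show "AE x in M. norm (exp (?z k * of_real x)) \<le> 1" for k
        using that(2) by eventually_elim auto
    qed auto
    then show ?thesis
      by (simp add: char_def Complex_eq mult.assoc)
  qed
  have "(\<integral>x. exp (?z k * of_real x) \<partial>\<mu>) = (\<integral>x. exp (?z k * of_real x) \<partial>\<nu>)" for k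
  proof -
    \<comment> \<open>A constant sequence of measures turns the convergence theorem into an identity
      theorem: agreement at real exponents propagates to complex ones.\<close>
    have "(\<lambda>_::nat. \<integral>x. exp (?z k * of_real x) \<partial>\<mu>) \<longlonglongrightarrow> (\<integral>x. exp (?z k * of_real x) \<partial>\<nu>)"
    proof (rule integral_exp_tendsto[of _ _ "-2" 0])
      show "(\<lambda>_::nat. \<integral>x. exp (r * x) \<partial>\<mu>) \<longlonglongrightarrow> (\<integral>x. exp (r * x) \<partial>\<nu>)" if "r < 0" for r
        using eq[of "-r"] that by simp
      have "1 / real (Suc k) \<le> 1"
        by simp
      then have "1 / real (Suc k) < 2"
        by linarith
      then show "-2 < Re (?z k)"
        by (simp del: of_nat_Suc)
    qed (use sets int \<mu> \<nu> in auto)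
    then show ?thesis
      by (simp add: LIMSEQ_const_iff)
  qed
  then show "char \<mu> t = char \<nu> t"
    using lim[OF \<mu>] lim[OF \<nu>] LIMSEQ_unique by simp
qed

section \<open>Moments of a stable variable\<close>

lemma has_bochner_integral_AE_eq:
  assumes "has_bochner_integral M f x" "AE y in M. f y = g y" "g \<in> borel_measurable M"
  shows "has_bochner_integral M g x"
  using assms has_bochner_integral_cong_AE[of f M g x]
  by (auto simp: has_bochner_integral_iff)

text \<open>For a nonnegative integrand, finiteness of one iterated integral yields the
  integrability of \<open>h\<close> as well as its value. Moments of \<open>S\<close> are obtained
  in this way without knowing in advance that they exist.\<close>

lemma has_bochner_integral_Fubini_nonneg:
  fixes f :: "'a \<Rightarrow> 'b \<Rightarrow> real"
  assumes "pair_sigma_finite M N"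
    and [measurable]: "(\<lambda>(x, y). f x y) \<in> borel_measurable (M \<Otimes>\<^sub>M N)" "h \<in> borel_measurable M"
    and nonneg: "\<And>x y. f x y \<ge> 0"
    and g: "AE y in N. has_bochner_integral M (\<lambda>x. f x y) (g y)" "has_bochner_integral N g c"
    and h: "AE x in M. has_bochner_integral N (f x) (h x)"
  shows "has_bochner_integral M h c"
proof -
  interpret pair_sigma_finite M N
    by fact
  have nn: "(\<integral>\<^sup>+x. ennreal (u x) \<partial>L) = ennreal C" "0 \<le> C"
    if "has_bochner_integral L u C" "AE x in L. 0 \<le> u x" for L :: "'c measure" and u C
    using that nn_integral_eq_integral[of L u]
    by (auto simp: has_bochner_integral_iff integral_nonneg_AE)
  have g0: "AE y in N. 0 \<le> g y"
    using g(1) by eventually_elim (metis has_bochner_integral_integral_eq Bochner_Integration.integral_nonneg nonneg)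
  have h0: "AE x in M. 0 \<le> h x"
    using h by eventually_elim (metis has_bochner_integral_integral_eq Bochner_Integration.integral_nonneg nonneg)
  have "(\<integral>\<^sup>+x. ennreal (h x) \<partial>M) = (\<integral>\<^sup>+x. (\<integral>\<^sup>+y. ennreal (f x y) \<partial>N) \<partial>M)"
  proof (rule nn_integral_cong_AE)
    show "AE x in M. ennreal (h x) = (\<integral>\<^sup>+y. ennreal (f x y) \<partial>N)"
      using h by eventually_elim (rule nn(1)[symmetric], auto simp: nonneg)
  qed
  also have "\<dots> = (\<integral>\<^sup>+y. (\<integral>\<^sup>+x. ennreal (f x y) \<partial>M) \<partial>N)"
    by (rule Fubini'[symmetric]) measurable
  also have "\<dots> = (\<integral>\<^sup>+y. ennreal (g y) \<partial>N)"
  proof (rule nn_integral_cong_AE)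
    show "AE y in N. (\<integral>\<^sup>+x. ennreal (f x y) \<partial>M) = ennreal (g y)"
      using g(1) by eventually_elim (rule nn(1), auto simp: nonneg)
  qed
  also have "\<dots> = ennreal c"
    by (rule nn(1)) (use g g0 in auto)
  finally show ?thesis
    using nn(2)[OF g(2) g0] h0 by (intro has_bochner_integral_nn_integral) auto
qed

lemma Gamma_real_plus1: "Gamma (x + 1) = x * Gamma x" if "x > 0" for x :: real
  using that Gamma_plus1[of x] nonpos_Ints_nonpos[of x] by auto

lemma has_bochner_integral_Gamma:
  fixes a s :: real
  assumes "a > 0" "s > 0"
  shows "has_bochner_integral lborel (\<lambda>t. if t > 0 then t powr (a - 1) * exp (- (s * t)) else 0)
           (Gamma a * s powr (- a))"
proof -
  let ?f = "\<lambda>t. if t > 0 then t powr (a - 1) * exp (- t) else 0 :: real"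
  have "((\<lambda>t. t powr (a - 1) / exp t) has_integral Gamma a) {0..}"
    by (rule Gamma_integral_real) fact
  then have "(?f has_integral Gamma a) {0..}"
    by (rule has_integral_spike[of "{0}", rotated 2]) (auto simp: exp_minus divide_inverse)
  then have "((\<lambda>t. if t \<in> {0..} then ?f t else 0) has_integral Gamma a) UNIV"
    by (subst has_integral_restrict_UNIV)
  moreover have "(\<lambda>t. if t \<in> {0..} then ?f t else 0) = ?f"
    by auto
  ultimately have f: "(?f has_integral Gamma a) UNIV"
    by simp
  then have "?f absolutely_integrable_on UNIV"
    by (intro nonnegative_absolutely_integrable_1) (auto simp: has_integral_iff)
  then have int: "integrable lebesgue ?f"
    by (simp add: set_integrable_def)
  then have "has_bochner_integral lborel ?f (Gamma a)"
    using f integral_lebesgue[OF int]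
    by (simp add: has_bochner_integral_iff integrable_completion integral_completion has_integral_iff)
  then have "has_bochner_integral lborel (\<lambda>t. ?f (0 + s * t)) (Gamma a /\<^sub>R \<bar>s\<bar>)"
    using assms by (subst (asm) lborel_has_bochner_integral_real_affine_iff[where c = s and t = 0]) auto
  then have *: "has_bochner_integral lborel (\<lambda>t. s powr (1 - a) * ?f (0 + s * t)) (s powr (1 - a) * (Gamma a /\<^sub>R \<bar>s\<bar>))"
    by (intro has_bochner_integral_mult_right) auto
  have eq1: "s powr (1 - a) * (Gamma a /\<^sub>R \<bar>s\<bar>) = Gamma a * s powr (- a)"
    using assms by (simp add: powr_diff powr_minus field_simps)
  have eq2: "(\<lambda>t. s powr (1 - a) * ?f (0 + s * t)) = (\<lambda>t. if t > 0 then t powr (a - 1) * exp (- (s * t)) else 0)"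
    using assms by (auto simp: fun_eq_iff powr_mult zero_less_mult_iff powr_diff field_simps)
  from * show ?thesis
    unfolding eq1 eq2 .
qed

text \<open>Serves as the majorant in the logarithmic limit and in Laplace's method; glued from a
  Gamma integral and its reflection.\<close>

lemma integrable_exp_neg_abs: "integrable lborel (\<lambda>v::real. exp (- \<bar>v\<bar>))"
proof -
  let ?e = "\<lambda>t::real. if t > 0 then t powr (1 - 1) * exp (- (1 * t)) else 0"
  have e: "integrable lborel ?e"
    using has_bochner_integral_Gamma[of 1 1] by (simp add: has_bochner_integral_iff)
  then have "integrable lborel (\<lambda>t. ?e (0 + - 1 * t))"
    by (subst lborel_integrable_real_affine_iff) auto
  with e have "integrable lborel (\<lambda>t. ?e t + ?e (0 + - 1 * t))"
    by (rule Bochner_Integration.integrable_add)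
  then show ?thesis
    by (rule integrable_cong_AE_imp) (auto intro!: AE_mp[OF AE_lborel_singleton[of 0] AE_I2])
qed

text \<open>
  In the variable \<open>w = ln x\<close> all substitutions \<open>x \<mapsto> s * x powr b\<close> become affine.
\<close>

lemma has_bochner_integral_Gamma_exp:
  fixes a :: real
  assumes "a > 0"
  shows "has_bochner_integral lborel (\<lambda>w. exp (a * w - exp w)) (Gamma a)"
proof -
  let ?f = "\<lambda>t. if t > 0 then t powr (a - 1) * exp (- t) else 0 :: real"
  have "has_bochner_integral lborel ?f (Gamma a)"
    using has_bochner_integral_Gamma[OF assms, of 1] by (simp cong: if_cong)
  then have int: "integrable lebesgue ?f" "integral\<^sup>L lebesgue ?f = Gamma a"
    by (simp_all add: has_bochner_integral_iff integrable_completion integral_completion)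
  have f: "?f absolutely_integrable_on {0<..}" "integral {0<..} ?f = Gamma a"
  proof -
    have "(?f has_integral Gamma a) UNIV"
      using has_integral_integral_lebesgue[OF int(1)] int(2) by simp
    then have "((\<lambda>t. if t \<in> {0<..} then ?f t else 0) has_integral Gamma a) UNIV"
      by (rule has_integral_eq[rotated]) auto
    then have "(?f has_integral Gamma a) {0<..}"
      by (subst (asm) has_integral_restrict_UNIV)
    then show "?f absolutely_integrable_on {0<..}" "integral {0<..} ?f = Gamma a"
      by (auto intro!: nonnegative_absolutely_integrable_1 simp: has_integral_iff)
  qed
  have "range (exp :: real \<Rightarrow> real) = {0<..}"
    by (auto simp: image_iff) (metis exp_ln)
  then have "(\<lambda>w. \<bar>exp w\<bar> * ?f (exp w)) absolutely_integrable_on UNIV \<and>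
      integral UNIV (\<lambda>w. \<bar>exp w\<bar> * ?f (exp w)) = Gamma a"
    using f by (subst has_absolute_integral_change_of_variables_1'[of UNIV exp exp])
      (auto simp: inj_on_def intro!: derivative_eq_intros)
  moreover have "\<bar>exp w\<bar> * ?f (exp w) = exp (a * w - exp w)" for w :: real
    by (simp add: powr_def exp_diff exp_minus divide_inverse left_diff_distrib)
  ultimately have *: "(\<lambda>w. exp (a * w - exp w)) absolutely_integrable_on UNIV"
      "integral UNIV (\<lambda>w. exp (a * w - exp w)) = Gamma a"
    by simp_all
  have int: "integrable lebesgue (\<lambda>w. exp (a * w - exp w))"
    using *(1) by (simp add: set_integrable_def)
  then show ?thesis
    using *(2) integral_lebesgue[OF int]
    by (simp add: has_bochner_integral_iff integrable_completion integral_completion)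
qed

lemma has_bochner_integral_Gamma_exp_affine:
  fixes a b s :: real
  assumes "b \<noteq> 0" "a / b > 0" "s > 0"
  shows "has_bochner_integral lborel (\<lambda>w. exp (a * w - s * exp (b * w)))
           (Gamma (a / b) * s powr (- (a / b)) / \<bar>b\<bar>)"
proof -
  have "has_bochner_integral lborel (\<lambda>w. exp (a / b * (ln s + b * w) - exp (ln s + b * w)))
      (Gamma (a / b) /\<^sub>R \<bar>b\<bar>)"
    using has_bochner_integral_Gamma_exp[OF assms(2)] assms(1)
    by (subst (asm) lborel_has_bochner_integral_real_affine_iff[where c = b and t = "ln s"]) auto
  then have "has_bochner_integral lborel
      (\<lambda>w. s powr (- (a / b)) * exp (a / b * (ln s + b * w) - exp (ln s + b * w)))
      (s powr (- (a / b)) * (Gamma (a / b) /\<^sub>R \<bar>b\<bar>))"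
    by (intro has_bochner_integral_mult_right) auto
  moreover have "s powr (- (a / b)) * exp (a / b * (ln s + b * w) - exp (ln s + b * w))
      = exp (a * w - s * exp (b * w))" for w
    using assms by (simp add: powr_def exp_add distrib_left flip: exp_add) (simp add: exp_add)
  ultimately show ?thesis
    by (simp add: field_simps)
qed

text \<open>By the fundamental theorem of calculus K(L) is the integral of k over w <= L; exchanging
  it with the expectation produces the tail of L. In the applications k changes sign, so the
  exchange rests on integrability of |k|, the tail being at most 1.\<close>

lemma (in prob_space) layer_cake:
  fixes K k :: "real \<Rightarrow> real"
  assumes [measurable]: "random_variable borel L"
    and deriv: "\<And>w. (K has_real_derivative k w) (at w)" and cont: "continuous_on UNIV k"
    and lim: "(K \<longlongrightarrow> 0) at_bot" and int: "integrable lborel k"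
  shows "expectation (\<lambda>\<omega>. K (L \<omega>)) = (\<integral>w. k w * prob {\<omega> \<in> space M. w \<le> L \<omega>} \<partial>lborel)"
proof -
  interpret pair_sigma_finite M lborel ..
  have [measurable]: "k \<in> borel_measurable borel"
    using cont by (rule borel_measurable_continuous_onI)
  have FTC: "(\<integral>w. indicator {w. w \<le> l} w * k w \<partial>lborel) = K l" for l
  proof -
    have "(LBINT w=-\<infinity>..ereal l. k w) = K l - 0"
    proof (rule interval_integral_FTC_integrable)
      show "set_integrable lborel (einterval (-\<infinity>) (ereal l)) k"
        using int by (intro integrable_mult_indicator[folded set_integrable_def]) auto
      show "((K \<circ> real_of_ereal) \<longlongrightarrow> K l) (at_left (ereal l))"
        using DERIV_isCont[OF deriv] by (simp add: ereal_tendsto_simps1 isCont_def filterlim_at_split)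
      show "((K \<circ> real_of_ereal) \<longlongrightarrow> 0) (at_right (-\<infinity>))"
        using lim by (simp add: ereal_tendsto_simps1)
    qed (use deriv cont in \<open>auto simp: has_real_derivative_iff_has_vector_derivative continuous_on_eq_continuous_at\<close>)
    moreover have "(LBINT w=-\<infinity>..ereal l. k w) = (\<integral>w. indicator {..<l} w * k w \<partial>lborel)"
      by (simp add: interval_lebesgue_integral_def set_lebesgue_integral_def einterval_def lessThan_def)
    moreover have "\<dots> = (\<integral>w. indicator {w. w \<le> l} w * k w \<partial>lborel)"
      by (intro integral_cong_AE AE_mp[OF AE_lborel_singleton[of l] AE_I2]) (auto simp: indicator_def)
    ultimately show ?thesis
      by simp
  qed
  have P: "(\<integral>\<omega>. indicator {w. w \<le> L \<omega>} w * c \<partial>M) = c * prob {\<omega> \<in> space M. w \<le> L \<omega>}" for w c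
  proof -
    have "(\<integral>\<omega>. indicator {w. w \<le> L \<omega>} w * c \<partial>M) = (\<integral>\<omega>. indicator {\<omega> \<in> space M. w \<le> L \<omega>} \<omega> * c \<partial>M)"
      by (intro Bochner_Integration.integral_cong) (auto simp: indicator_def)
    then show ?thesis
      by simp
  qed
  have "integrable (lborel \<Otimes>\<^sub>M M) (\<lambda>(w, \<omega>). indicator {w. w \<le> L \<omega>} w * k w)"
  proof (rule pair_sigma_finite.Fubini_integrable)
    show "pair_sigma_finite lborel M" ..
    show "integrable lborel (\<lambda>w. \<integral>\<omega>. norm (case (w, \<omega>) of (w, \<omega>) \<Rightarrow> indicator {w. w \<le> L \<omega>} w * k w) \<partial>M)"
    proof -
      have "integrable lborel (\<lambda>w. norm (k w * prob {\<omega> \<in> space M. w \<le> L \<omega>}))"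
        by (rule Bochner_Integration.integrable_bound[OF int]) (auto simp: abs_mult mult_left_le)
      then show ?thesis
        using P[of _ 1] by (simp add: abs_mult mult.commute)
    qed
    show "AE w in lborel. integrable M (\<lambda>\<omega>. case (w, \<omega>) of (w, \<omega>) \<Rightarrow> indicator {w. w \<le> L \<omega>} w * k w)"
    proof (intro AE_I2)
      fix w
      show "integrable M (\<lambda>\<omega>. case (w, \<omega>) of (w, \<omega>) \<Rightarrow> indicator {w. w \<le> L \<omega>} w * k w)"
        by (rule integrable_const_bound[of _ "\<bar>k w\<bar>"]) (auto simp: indicator_def)
    qed
  qed (measurable)
  then have "(\<integral>\<omega>. (\<integral>w. indicator {w. w \<le> L \<omega>} w * k w \<partial>lborel) \<partial>M) =
      (\<integral>w. (\<integral>\<omega>. indicator {w. w \<le> L \<omega>} w * k w \<partial>M) \<partial>lborel)"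
    by (rule pair_sigma_finite.Fubini_integral[rotated]) unfold_locales
  then show ?thesis
    using P[of _ 1] FTC by (simp add: mult.commute)
qed

text \<open>The asymptotics depend only on the law of the subordinator at time 1. Almost sure
  positivity makes \<open>ln S\<close> meaningful; for the subordinator it is derived from the
  Laplace transform.\<close>

locale stable_variable = prob_space M for M :: "'w measure" +
  fixes S :: "'w \<Rightarrow> real" and \<beta> :: real
  assumes random_variable_S [measurable]: "random_variable borel S"
    and \<beta>: "0 < \<beta>" "\<beta> < 1"
    and S_pos: "AE \<omega> in M. S \<omega> > 0"
    and Laplace: "\<And>r. r > 0 \<Longrightarrow> expectation (\<lambda>\<omega>. exp (- r * S \<omega>)) = exp (- (r powr \<beta>))"
begin

lemma has_bochner_integral_Laplace:
  assumes "r > 0"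
  shows "has_bochner_integral M (\<lambda>\<omega>. exp (- (r * S \<omega>))) (exp (- (r powr \<beta>)))"
proof -
  have "integrable M (\<lambda>\<omega>. exp (- (r * S \<omega>)))"
  proof (rule integrable_const_bound[where B = 1])
    show "AE \<omega> in M. norm (exp (- (r * S \<omega>))) \<le> 1"
      using S_pos by eventually_elim (use assms in simp)
  qed auto
  then show ?thesis
    using Laplace[OF assms] by (simp add: has_bochner_integral_iff)
qed

text \<open>The integral of exp(p w - S e^w) over w is Gamma(p) S^(-p). Taking the expectation
  inside replaces exp(-S e^w) by exp(-e^(\<beta> w)), which gives another Gamma integral.\<close>

lemma has_bochner_integral_neg_moment:
  assumes p: "p > 0"
  shows "has_bochner_integral M (\<lambda>\<omega>. S \<omega> powr (- p)) (Gamma (1 + p / \<beta>) / Gamma (1 + p))"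
proof -
  have "has_bochner_integral M (\<lambda>\<omega>. if S \<omega> > 0 then Gamma p * S \<omega> powr (- p) else 0) (Gamma (p / \<beta>) / \<beta>)"
  proof (rule has_bochner_integral_Fubini_nonneg
      [where N = lborel and f = "\<lambda>\<omega> w. exp (p * w - S \<omega> * exp w)" and g = "\<lambda>w. exp (p * w - exp (\<beta> * w))"])
    show "pair_sigma_finite M (lborel :: real measure)" ..
    show "AE w in lborel. has_bochner_integral M (\<lambda>\<omega>. exp (p * w - S \<omega> * exp w)) (exp (p * w - exp (\<beta> * w)))"
    proof (intro AE_I2)
      fix w :: real
      show "has_bochner_integral M (\<lambda>\<omega>. exp (p * w - S \<omega> * exp w)) (exp (p * w - exp (\<beta> * w)))"
        using has_bochner_integral_mult_right[OF has_bochner_integral_Laplace[of "exp w"], of "exp (p * w)"]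
        by (simp add: exp_diff exp_minus divide_inverse powr_def mult.commute)
    qed
    show "has_bochner_integral lborel (\<lambda>w. exp (p * w - exp (\<beta> * w))) (Gamma (p / \<beta>) / \<beta>)"
      using has_bochner_integral_Gamma_exp_affine[of \<beta> p 1] p \<beta> by simp
    show "AE \<omega> in M. has_bochner_integral lborel (\<lambda>w. exp (p * w - S \<omega> * exp w))
        (if S \<omega> > 0 then Gamma p * S \<omega> powr (- p) else 0)"
      using S_pos by eventually_elim (use has_bochner_integral_Gamma_exp_affine[of 1 p] p in auto)
  qed auto
  then have "has_bochner_integral M (\<lambda>\<omega>. (if S \<omega> > 0 then Gamma p * S \<omega> powr (- p) else 0) / Gamma p)
      (Gamma (p / \<beta>) / \<beta> / Gamma p)"
    by (rule has_bochner_integral_divide)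
  moreover have "Gamma (p / \<beta>) / \<beta> / Gamma p = Gamma (1 + p / \<beta>) / Gamma (1 + p)"
    using p \<beta> Gamma_real_plus1[of "p / \<beta>"] Gamma_real_plus1[of p] by (simp add: add.commute)
  ultimately have "has_bochner_integral M (\<lambda>\<omega>. (if S \<omega> > 0 then Gamma p * S \<omega> powr (- p) else 0) / Gamma p)
      (Gamma (1 + p / \<beta>) / Gamma (1 + p))"
    by simp
  then show ?thesis
  proof (rule has_bochner_integral_AE_eq)
    show "AE \<omega> in M. (if S \<omega> > 0 then Gamma p * S \<omega> powr (- p) else 0) / Gamma p = S \<omega> powr (- p)"
      using S_pos by eventually_elim (use Gamma_real_pos[OF p] in simp)
  qed measurable
qed

text \<open>Minus the derivative of the Laplace transform in r. Positive moments rest on it: a Gamma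
  integral of exp(-S e^w) yields only negative powers of S, and the extra factor S leaves the
  admissible exponent 1 - p > 0.\<close>

lemma has_bochner_integral_size_biased:
  assumes r: "r > 0"
  shows "has_bochner_integral M (\<lambda>\<omega>. S \<omega> * exp (- (r * S \<omega>))) (\<beta> * r powr (\<beta> - 1) * exp (- (r powr \<beta>)))"
proof -
  let ?\<mu> = "distr M borel S" and ?F = "\<lambda>z. \<integral>x. exp (z * complex_of_real x) \<partial>distr M borel S"
  let ?D = "\<integral>x. of_real x * exp (of_real (- r) * complex_of_real x) \<partial>distr M borel S"
  have int: "integrable ?\<mu> (\<lambda>x. exp (- u * x))" if "u > 0" for u
    using has_bochner_integral_Laplace[OF that] by (simp add: integrable_distr_eq has_bochner_integral_iff)
  have F: "?F (of_real (- u)) = of_real (exp (- (u powr \<beta>)))" if "u > 0" for u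
  proof -
    have "?F (of_real (- u)) = (\<integral>x. of_real (exp (- u * x)) \<partial>?\<mu>)"
      by (simp only: exp_of_real[symmetric] of_real_mult)
    also have "\<dots> = of_real (expectation (\<lambda>\<omega>. exp (- u * S \<omega>)))"
      by (simp add: integral_distr)
    finally show ?thesis
      using Laplace[OF that] by simp
  qed
  have int_D: "integrable M (\<lambda>\<omega>. S \<omega> * exp (- (r * S \<omega>)))"
  proof (rule integrable_const_bound[where B = "1 / r"])
    show "AE \<omega> in M. norm (S \<omega> * exp (- (r * S \<omega>))) \<le> 1 / r"
    proof (use S_pos in eventually_elim)
      fix \<omega> assume "S \<omega> > 0"
      moreover have "r * S \<omega> \<le> exp (r * S \<omega>)"
        using exp_ge_add_one_self[of "r * S \<omega>"] by linarith
      ultimately show "norm (S \<omega> * exp (- (r * S \<omega>))) \<le> 1 / r"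
        using r by (simp add: exp_minus field_simps abs_mult)
    qed
  qed auto
  have D: "?D = of_real (expectation (\<lambda>\<omega>. S \<omega> * exp (- (r * S \<omega>))))"
  proof -
    have "?D = (\<integral>x. of_real (x * exp (- r * x)) \<partial>?\<mu>)"
      by (simp only: exp_of_real[symmetric] of_real_mult)
    also have "\<dots> = of_real (expectation (\<lambda>\<omega>. S \<omega> * exp (- (r * S \<omega>))))"
      by (subst integral_distr) (simp_all flip: of_real_mult)
    finally show ?thesis .
  qed
  have "(?F has_field_derivative ?D) (at (of_real (- r)))"
    by (rule has_field_derivative_integral_exp[of _ "- (2 * r)" "- (r / 2)"])
      (use int[of "2 * r"] int[of "r / 2"] r in auto)
  then have "((\<lambda>u. ?F (of_real u)) has_vector_derivative ?D) (at (- r))"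
    by (rule has_vector_derivative_real_field)
  then have "((\<lambda>u. Re (?F (of_real u))) has_vector_derivative Re ?D) (at (- r))"
    by (rule bounded_linear.has_vector_derivative[OF bounded_linear_Re])
  then have "((\<lambda>u. Re (?F (of_real u))) has_real_derivative Re ?D) (at (- r))"
    by (simp only: has_real_derivative_iff_has_vector_derivative)
  note D0 = this
  have D1: "((\<lambda>u. exp (- ((- u) powr \<beta>))) has_real_derivative \<beta> * r powr (\<beta> - 1) * exp (- (r powr \<beta>))) (at (- r))"
    using r by (auto intro!: derivative_eq_intros)
  have ev: "eventually (\<lambda>u. exp (- ((- u) powr \<beta>)) = Re (?F (of_real u))) (nhds (- r))"
  proof (rule eventually_mono)
    show "eventually (\<lambda>u. u \<in> {..<0}) (nhds (- r))"
      using r by (intro eventually_nhds_in_open) auto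
    show "exp (- ((- u) powr \<beta>)) = Re (?F (of_real u))" if "u \<in> {..<0}" for u
      using F[of "- u"] that by simp
  qed
  have "((\<lambda>u. Re (?F (of_real u))) has_real_derivative \<beta> * r powr (\<beta> - 1) * exp (- (r powr \<beta>))) (at (- r))"
    by (rule DERIV_cong_ev[THEN iffD1, OF refl ev refl D1])
  with D0 have "Re ?D = \<beta> * r powr (\<beta> - 1) * exp (- (r powr \<beta>))"
    by (rule DERIV_unique)
  then show ?thesis
    using D int_D by (simp add: has_bochner_integral_iff)
qed

text \<open>Write S^p as S times S^(p - 1), the latter a Gamma integral of exponent 1 - p. The
  size-biased expectation turns the integrand into \<beta> exp((\<beta> - p) w - e^(\<beta> w)),
  which is integrable at minus infinity exactly when p < \<beta>.\<close>

lemma has_bochner_integral_pos_moment: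
  assumes p: "0 < p" "p < \<beta>"
  shows "has_bochner_integral M (\<lambda>\<omega>. S \<omega> powr p) (Gamma (1 - p / \<beta>) / Gamma (1 - p))"
proof -
  have "has_bochner_integral M (\<lambda>\<omega>. if S \<omega> > 0 then Gamma (1 - p) * S \<omega> powr p else 0) (Gamma (1 - p / \<beta>))"
  \<comment> \<open>The absolute value makes the integrand nonnegative everywhere, as the Fubini
    rule demands; almost surely it changes nothing.\<close>
  proof (rule has_bochner_integral_Fubini_nonneg
      [where N = lborel and f = "\<lambda>\<omega> w. \<bar>S \<omega>\<bar> * exp ((1 - p) * w - S \<omega> * exp w)"
        and g = "\<lambda>w. \<beta> * exp ((\<beta> - p) * w - exp (\<beta> * w))"])
    show "pair_sigma_finite M (lborel :: real measure)" ..
    show "AE w in lborel. has_bochner_integral M (\<lambda>\<omega>. \<bar>S \<omega>\<bar> * exp ((1 - p) * w - S \<omega> * exp w))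
        (\<beta> * exp ((\<beta> - p) * w - exp (\<beta> * w)))"
    proof (intro AE_I2)
      fix w :: real
      have *: "has_bochner_integral M (\<lambda>\<omega>. exp ((1 - p) * w) * (S \<omega> * exp (- (exp w * S \<omega>))))
          (exp ((1 - p) * w) * (\<beta> * exp w powr (\<beta> - 1) * exp (- (exp w powr \<beta>))))"
        by (rule has_bochner_integral_mult_right[OF has_bochner_integral_size_biased]) simp
      have "exp ((1 - p) * w) * (\<beta> * exp w powr (\<beta> - 1) * exp (- (exp w powr \<beta>))) =
          \<beta> * exp ((\<beta> - p) * w - exp (\<beta> * w))"
        by (simp add: powr_def left_diff_distrib right_diff_distrib mult.commute flip: exp_add)
      with * have "has_bochner_integral M (\<lambda>\<omega>. exp ((1 - p) * w) * (S \<omega> * exp (- (exp w * S \<omega>))))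
          (\<beta> * exp ((\<beta> - p) * w - exp (\<beta> * w)))"
        by simp
      then show "has_bochner_integral M (\<lambda>\<omega>. \<bar>S \<omega>\<bar> * exp ((1 - p) * w - S \<omega> * exp w))
        (\<beta> * exp ((\<beta> - p) * w - exp (\<beta> * w)))"
      proof (rule has_bochner_integral_AE_eq)
        show "AE \<omega> in M. exp ((1 - p) * w) * (S \<omega> * exp (- (exp w * S \<omega>))) =
            \<bar>S \<omega>\<bar> * exp ((1 - p) * w - S \<omega> * exp w)"
          using S_pos by eventually_elim (simp add: exp_diff exp_minus divide_inverse mult_ac)
      qed measurable
    qed
    have "0 < (\<beta> - p) / \<beta>" "(\<beta> - p) / \<beta> = 1 - p / \<beta>"
      using p \<beta> by (auto simp: field_simps)
    then show "has_bochner_integral lborel (\<lambda>w. \<beta> * exp ((\<beta> - p) * w - exp (\<beta> * w))) (Gamma (1 - p / \<beta>))"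
      using has_bochner_integral_mult_right[OF has_bochner_integral_Gamma_exp_affine[of \<beta> "\<beta> - p" 1], of \<beta>] \<beta> by simp
    show "AE \<omega> in M. has_bochner_integral lborel (\<lambda>w. \<bar>S \<omega>\<bar> * exp ((1 - p) * w - S \<omega> * exp w))
        (if S \<omega> > 0 then Gamma (1 - p) * S \<omega> powr p else 0)"
      using S_pos
    proof eventually_elim
      case (elim \<omega>)
      have "S \<omega> * S \<omega> powr (p - 1) = S \<omega> powr p"
        using elim powr_mult_base[of "S \<omega>" "p - 1"] by simp
      then have eq: "S \<omega> * (Gamma (1 - p) * S \<omega> powr (p - 1)) = Gamma (1 - p) * S \<omega> powr p"
        by (subst mult.left_commute) (simp only:)
      have "has_bochner_integral lborel (\<lambda>w. S \<omega> * exp ((1 - p) * w - S \<omega> * exp (1 * w)))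
          (S \<omega> * (Gamma ((1 - p) / 1) * S \<omega> powr (- ((1 - p) / 1)) / \<bar>1\<bar>))"
        by (rule has_bochner_integral_mult_right[OF has_bochner_integral_Gamma_exp_affine]) (use elim p \<beta> in auto)
      then have "has_bochner_integral lborel (\<lambda>w. S \<omega> * exp ((1 - p) * w - S \<omega> * exp w)) (Gamma (1 - p) * S \<omega> powr p)"
        unfolding mult_1 div_by_1 minus_diff_eq abs_one eq .
      then show ?case
        using elim by simp
    qed
  qed auto
  then have "has_bochner_integral M (\<lambda>\<omega>. (if S \<omega> > 0 then Gamma (1 - p) * S \<omega> powr p else 0) / Gamma (1 - p))
      (Gamma (1 - p / \<beta>) / Gamma (1 - p))"
    by (rule has_bochner_integral_divide)
  then show ?thesis
  proof (rule has_bochner_integral_AE_eq)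
    show "AE \<omega> in M. (if S \<omega> > 0 then Gamma (1 - p) * S \<omega> powr p else 0) / Gamma (1 - p) = S \<omega> powr p"
    proof -
      have "Gamma (1 - p) > 0"
        using p \<beta> by (intro Gamma_real_pos) simp
      then show ?thesis
        using S_pos by (auto elim: eventually_mono)
    qed
  qed measurable
qed

end

section \<open>The tail of a stable variable\<close>

text \<open>Weak convergence is stated for sequences, and the lemmas applied along them ask for all
  terms to exceed a threshold c; replacing X by its maximum with c + 1 changes only finitely many
  terms.\<close>

lemma tendsto_at_top_if_sequentially:
  fixes f :: "real \<Rightarrow> real"
  assumes "\<And>X :: nat \<Rightarrow> real. filterlim X at_top sequentially \<Longrightarrow> (\<And>k. X k > c) \<Longrightarrow> (\<lambda>k. f (X k)) \<longlonglongrightarrow> l"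
  shows "(f \<longlongrightarrow> l) at_top"
proof (rule tendsto_at_topI_sequentially)
  fix X :: "nat \<Rightarrow> real" assume X: "filterlim X at_top sequentially"
  then have "\<forall>\<^sub>F k in sequentially. X k \<ge> c + 1"
    by (simp add: filterlim_at_top)
  then have ev: "\<forall>\<^sub>F k in sequentially. max (c + 1) (X k) = X k"
    by eventually_elim simp
  then have "filterlim (\<lambda>k. max (c + 1) (X k)) at_top sequentially"
    using X by (simp add: filterlim_cong)
  then have "(\<lambda>k. f (max (c + 1) (X k))) \<longlonglongrightarrow> l"
    by (rule assms) (simp add: less_max_iff_disj)
  moreover have "\<forall>\<^sub>F k in sequentially. f (max (c + 1) (X k)) = f (X k)"
    using ev by eventually_elim simp
  ultimately show "(\<lambda>k. f (X k)) \<longlonglongrightarrow> l"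
    by (rule Lim_transform_eventually)
qed

lemma eventually_at_right_0_witness:
  assumes "\<forall>\<^sub>F \<delta>::real in at_right 0. P \<delta>"
  obtains \<delta> where "P \<delta>" "0 < \<delta>" "\<delta> < 1"
proof -
  have "\<forall>\<^sub>F \<delta>::real in at_right 0. \<delta> \<in> {0<..<1}"
    by (rule eventually_at_right_real) simp
  with assms have "\<forall>\<^sub>F \<delta> in at_right 0. P \<delta> \<and> \<delta> \<in> {0<..<1}"
    by (rule eventually_conj)
  then show ?thesis
    using that eventually_happens[of _ "at_right (0::real)"] by auto
qed

section \<open>Probability densities and masses of intervals\<close>

abbreviation lborel_density :: "(real \<Rightarrow> real) \<Rightarrow> real measure" where
  "lborel_density g \<equiv> density lborel (\<lambda>x. ennreal (g x))"

lemma real_distribution_density: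
  assumes "has_bochner_integral lborel g 1" "\<And>x::real. g x \<ge> 0"
  shows "real_distribution (lborel_density g)"
proof -
  have [measurable]: "g \<in> borel_measurable borel"
    using assms(1) by (auto simp: has_bochner_integral_iff dest: borel_measurable_integrable)
  have "prob_space (lborel_density g)"
  proof (rule prob_spaceI)
    have "(\<integral>\<^sup>+x. ennreal (g x) \<partial>lborel) = 1"
      using assms nn_integral_eq_integral[of lborel g] by (simp add: has_bochner_integral_iff)
    then show "emeasure (lborel_density g) (space (lborel_density g)) = 1"
      by (simp add: emeasure_density)
  qed
  then show ?thesis
    by (simp add: real_distribution_def real_distribution_axioms_def)
qed

lemma measure_density_Ioc_bounds:
  assumes g: "has_bochner_integral lborel g 1" "\<And>x::real. g x \<ge> 0" and "a \<le> b"
    and bounds: "\<And>x. a < x \<Longrightarrow> x \<le> b \<Longrightarrow> l \<le> g x" "\<And>x. a < x \<Longrightarrow> x \<le> b \<Longrightarrow> g x \<le> u"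
  shows "l * (b - a) \<le> measure (lborel_density g) {a<..b}"
    and "measure (lborel_density g) {a<..b} \<le> u * (b - a)"
proof -
  interpret real_distribution "lborel_density g"
    by (rule real_distribution_density) fact+
  have [measurable]: "g \<in> borel_measurable borel" and int_g: "integrable lborel g"
    using g(1) by (auto simp: has_bochner_integral_iff dest: borel_measurable_integrable)
  have "measure (lborel_density g) {a<..b} =
      (\<integral>x. indicator {a<..b} x \<partial>lborel_density g)"
    by simp
  also have "\<dots> = (\<integral>x. g x * indicator {a<..b} x \<partial>lborel)"
    by (subst integral_density) (use g in auto)
  finally have eq: "measure (lborel_density g) {a<..b} = (\<integral>x. g x * indicator {a<..b} x \<partial>lborel)" .
  have int: "integrable lborel (\<lambda>x. g x * indicator {a<..b} x)"
    using int_g by (intro integrable_real_mult_indicator) auto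
  have const: "integrable lborel (\<lambda>x. c * indicator {a<..b} x)" "(\<integral>x. c * indicator {a<..b} x \<partial>lborel) = c * (b - a)" for c :: real
    using \<open>a \<le> b\<close> by auto
  show "l * (b - a) \<le> measure (lborel_density g) {a<..b}"
    unfolding eq const(2)[symmetric]
    by (rule integral_mono[OF const(1) int]) (use bounds in \<open>auto simp: indicator_def\<close>)
  show "measure (lborel_density g) {a<..b} \<le> u * (b - a)"
    unfolding eq const(2)[symmetric]
    by (rule integral_mono[OF int const(1)]) (use bounds in \<open>auto simp: indicator_def\<close>)
qed

text \<open>The limit law has a density, so its distribution function is continuous at every point
  and weak convergence gives the masses of all intervals.\<close>

lemma weak_conv_m_density_Ioc:
  fixes g :: "nat \<Rightarrow> real \<Rightarrow> real"
  assumes "weak_conv_m (\<lambda>k. lborel_density (g k)) (lborel_density h)"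
    and g: "\<And>k. has_bochner_integral lborel (g k) 1" "\<And>k x. g k x \<ge> 0"
    and h: "has_bochner_integral lborel h 1" "\<And>x. h x \<ge> 0" and "a < b"
  shows "(\<lambda>k. measure (lborel_density (g k)) {a<..b}) \<longlonglongrightarrow>
           measure (lborel_density h) {a<..b}"
proof -
  interpret G: real_distribution "lborel_density (g k)" for k
    by (rule real_distribution_density) fact+
  interpret H: real_distribution "lborel_density h"
    by (rule real_distribution_density) fact+
  have [measurable]: "h \<in> borel_measurable borel"
    using h(1) by (auto simp: has_bochner_integral_iff dest: borel_measurable_integrable)
  have "isCont (cdf (lborel_density h)) x" for x
  proof -
    have "emeasure (lborel_density h) {x} = 0"
      by (subst emeasure_density) (auto intro: nn_integral_0_iff_AE[THEN iffD2] AE_mp[OF AE_lborel_singleton[of x]])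
    then show ?thesis
      by (simp add: H.isCont_cdf measure_def)
  qed
  then have "(\<lambda>k. cdf (lborel_density (g k)) x) \<longlonglongrightarrow> cdf (lborel_density h) x" for x
    using assms(1) by (simp add: weak_conv_m_def weak_conv_def)
  from tendsto_diff[OF this[of b] this[of a]] show ?thesis
    using \<open>a < b\<close> by (simp add: G.cdf_diff_eq H.cdf_diff_eq)
qed

context stable_variable
begin

abbreviation tail :: "real \<Rightarrow> real" where
  "tail x \<equiv> prob {\<omega> \<in> space M. x \<le> S \<omega>}"

lemma tail_measurable [measurable]: "tail \<in> borel_measurable borel"
  by measurable

text \<open>On S >= x the variable 1 - exp(-S / x) is at least 1 - 1/e, and its mean 1 -
  exp(-x^(-\<beta>)) is at most x^(-\<beta>). Valid for all x > 0, the bound supplies the majorants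
  in the later limits.\<close>

lemma tail_le:
  assumes "x > 0"
  shows "tail x \<le> 1 / (1 - exp (- 1)) * x powr (- \<beta>)"
proof -
  have Lap: "has_bochner_integral M (\<lambda>\<omega>. 1 - exp (- (1 / x * S \<omega>))) (1 - exp (- ((1 / x) powr \<beta>)))"
    using has_bochner_integral_diff[OF _ has_bochner_integral_Laplace[of "1 / x"], of "\<lambda>_. 1" 1] assms
    by (simp add: has_bochner_integral_iff prob_space)
  have "(1 - exp (- 1)) * tail x =
      (\<integral>\<omega>. (1 - exp (- 1)) * indicator {\<omega> \<in> space M. x \<le> S \<omega>} \<omega> \<partial>M)"
    by simp
  also have "\<dots> \<le> (\<integral>\<omega>. 1 - exp (- (1 / x * S \<omega>)) \<partial>M)"
  proof (rule integral_mono_AE)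
    show "AE \<omega> in M. (1 - exp (- 1)) * indicator {\<omega> \<in> space M. x \<le> S \<omega>} \<omega> \<le> 1 - exp (- (1 / x * S \<omega>))"
      using S_pos by eventually_elim (use assms in \<open>auto simp: indicator_def field_simps\<close>)
    show "integrable M (\<lambda>\<omega>. (1 - exp (- 1)) * indicator {\<omega> \<in> space M. x \<le> S \<omega>} \<omega> :: real)"
      by (intro integrable_mult_right integrable_real_indicator) (auto simp: less_top[symmetric])
  qed (use Lap in \<open>auto simp: has_bochner_integral_iff\<close>)
  also have "\<dots> = 1 - exp (- ((1 / x) powr \<beta>))"
    using Lap by (simp add: has_bochner_integral_iff)
  also have "\<dots> \<le> (1 / x) powr \<beta>"
    using exp_ge_add_one_self[of "- ((1 / x) powr \<beta>)"] by linarith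
  also have "\<dots> = x powr (- \<beta>)"
    using assms by (simp add: powr_minus_divide powr_divide)
  finally show ?thesis
    by (simp add: field_simps)
qed

text \<open>Tonelli, since (1 - exp(-r S)) / r is the integral of exp(-r x) over 0 < x <= S.\<close>

lemma has_bochner_integral_tail_Laplace:
  assumes r: "r > 0"
  shows "has_bochner_integral lborel (\<lambda>x. if x > 0 then exp (- (r * x)) * tail x else 0)
           ((1 - exp (- (r powr \<beta>))) / r)"
proof (rule has_bochner_integral_Fubini_nonneg[where N = M
      and f = "\<lambda>x \<omega>. if 0 < x \<and> x \<le> S \<omega> then exp (- (r * x)) else 0"
      and g = "\<lambda>\<omega>. (1 - exp (- (r * S \<omega>))) / r"])
  show "pair_sigma_finite (lborel :: real measure) M" ..
  show "AE \<omega> in M. has_bochner_integral lborel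
      (\<lambda>x. if 0 < x \<and> x \<le> S \<omega> then exp (- (r * x)) else 0) ((1 - exp (- (r * S \<omega>))) / r)"
    using S_pos
  proof eventually_elim
    case (elim \<omega>)
    have "has_bochner_integral lborel (\<lambda>x. exp (- (r * x)) * indicator {0..S \<omega>} x)
        (- exp (- (r * S \<omega>)) / r - (- exp (- (r * 0)) / r))"
      by (rule has_bochner_integral_FTC_Icc_real)
        (use elim r in \<open>auto intro!: derivative_eq_intros continuous_intros\<close>)
    then have "has_bochner_integral lborel (\<lambda>x. exp (- (r * x)) * indicator {0..S \<omega>} x)
        ((1 - exp (- (r * S \<omega>))) / r)"
      by (simp add: diff_divide_distrib)
    then show ?case
      by (rule has_bochner_integral_AE_eq)
        (auto intro!: AE_mp[OF AE_lborel_singleton[of 0] AE_I2] simp: indicator_def)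
  qed
  show "has_bochner_integral M (\<lambda>\<omega>. (1 - exp (- (r * S \<omega>))) / r) ((1 - exp (- (r powr \<beta>))) / r)"
    using has_bochner_integral_diff[OF _ has_bochner_integral_Laplace[OF r], of "\<lambda>_. 1" 1]
    by (intro has_bochner_integral_divide) (simp add: has_bochner_integral_iff prob_space)
  show "AE x in lborel. has_bochner_integral M (\<lambda>\<omega>. if 0 < x \<and> x \<le> S \<omega> then exp (- (r * x)) else 0)
      (if x > 0 then exp (- (r * x)) * tail x else 0)"
  proof (intro AE_I2)
    fix x :: real
    have "has_bochner_integral M (\<lambda>\<omega>. exp (- (r * x)) * indicator {\<omega> \<in> space M. x \<le> S \<omega>} \<omega>)
        (exp (- (r * x)) * tail x)"
      by (intro has_bochner_integral_mult_right has_bochner_integral_real_indicator) (auto simp: less_top[symmetric])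
    then have "has_bochner_integral M (\<lambda>\<omega>. if x \<le> S \<omega> then exp (- (r * x)) else 0)
        (exp (- (r * x)) * tail x)"
      by (rule has_bochner_integral_AE_eq) (auto simp: indicator_def)
    then show "has_bochner_integral M (\<lambda>\<omega>. if 0 < x \<and> x \<le> S \<omega> then exp (- (r * x)) else 0)
        (if x > 0 then exp (- (r * x)) * tail x else 0)"
      by (auto simp: has_bochner_integral_zero)
  qed
qed auto

text \<open>A Tauberian argument. The weak limit of the damped tails is the Gamma law of shape 1 -
  \<beta>, but it gives interval masses only; monotonicity of the tail turns the masses of short
  intervals on either side of x = 1 into bounds for \<open>tail (X k)\<close>.\<close>

lemma tail_tendsto_sequentially:
  fixes X :: "nat \<Rightarrow> real"
  assumes X: "filterlim X at_top sequentially" "\<And>k. X k > 0"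
  shows "(\<lambda>k. X k powr \<beta> * tail (X k)) \<longlonglongrightarrow> 1 / Gamma (1 - \<beta>)"
proof -
  \<comment> \<open>The total mass of X^\<beta> exp(-x) tail(X x) over x > 0, obtained from the
    Laplace transform of the tail at r = 1 / X.\<close>
  define c where "c k = X k powr \<beta> * (1 - exp (- (X k powr (- \<beta>))))" for k
  define g where "g k x = (if x > 0 then exp (- x) * (X k powr \<beta> * tail (X k * x) / c k) else 0)" for k x
  define h where "h x = (if x > 0 then exp (- x) * (x powr (- \<beta>) / Gamma (1 - \<beta>)) else 0)" for x
  have \<Gamma>: "Gamma (1 - \<beta>) > 0"
    using \<beta> by (intro Gamma_real_pos) simp
  have c_pos: "c k > 0" for k
    using X(2)[of k] by (simp add: c_def)
  have X0: "filterlim (\<lambda>k. X k powr (- \<beta>)) (at_right 0) sequentially"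
  proof -
    have "filterlim (\<lambda>x. x powr (- \<beta>)) (at_right 0) at_top"
      using \<beta> by real_asymp
    then show ?thesis
      using X(1) by (rule filterlim_compose)
  qed
  have g_nonneg: "g k x \<ge> 0" and h_nonneg: "h x \<ge> 0" for k x
    using c_pos[of k] \<Gamma> by (simp_all add: g_def h_def)
  have mgf_g: "has_bochner_integral lborel (\<lambda>x. exp (r * x) * g k x)
      ((1 - exp (- ((1 - r) powr \<beta> * X k powr (- \<beta>)))) / ((1 - r) * (1 - exp (- (X k powr (- \<beta>))))))" (is "has_bochner_integral _ _ ?c")
    if "r < 1" for r k
  proof -
    let ?f = "\<lambda>x. if x > 0 then exp (- ((1 - r) / X k * x)) * tail x else 0"
    have "has_bochner_integral lborel ?f ((1 - exp (- (((1 - r) / X k) powr \<beta>))) / ((1 - r) / X k))"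
      by (rule has_bochner_integral_tail_Laplace) (use that X(2) in simp)
    then have "has_bochner_integral lborel (\<lambda>x. ?f (0 + X k * x)) ((1 - exp (- (((1 - r) / X k) powr \<beta>))) / ((1 - r) / X k) /\<^sub>R \<bar>X k\<bar>)"
      using X(2)[of k] by (subst (asm) lborel_has_bochner_integral_real_affine_iff[where c = "X k" and t = 0]) auto
    then have *: "has_bochner_integral lborel (\<lambda>x. X k powr \<beta> / c k * ?f (0 + X k * x))
        (X k powr \<beta> / c k * ((1 - exp (- (((1 - r) / X k) powr \<beta>))) / ((1 - r) / X k) /\<^sub>R \<bar>X k\<bar>))"
      by (intro has_bochner_integral_mult_right) auto
    have eq1: "(\<lambda>x. X k powr \<beta> / c k * ?f (0 + X k * x)) = (\<lambda>x. exp (r * x) * g k x)"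
    proof
      fix x
      have "exp (- ((1 - r) / X k * (X k * x))) = exp (r * x) * exp (- x)"
        using X(2)[of k] by (simp add: field_simps flip: exp_add)
      then show "X k powr \<beta> / c k * ?f (0 + X k * x) = exp (r * x) * g k x"
        using X(2)[of k] by (simp add: g_def zero_less_mult_iff)
    qed
    have eq2: "X k powr \<beta> / c k * ((1 - exp (- (((1 - r) / X k) powr \<beta>))) / ((1 - r) / X k) /\<^sub>R \<bar>X k\<bar>) = ?c"
      using X(2)[of k] that by (simp add: c_def powr_divide powr_minus divide_simps)
    from * show ?thesis
      unfolding eq1 eq2 .
  qed
  have mgf_h: "has_bochner_integral lborel (\<lambda>x. exp (r * x) * h x) ((1 - r) powr (\<beta> - 1))" if "r < 1" for r
  proof -
    let ?f = "\<lambda>t. if t > 0 then t powr ((1 - \<beta>) - 1) * exp (- ((1 - r) * t)) else 0"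
    have *: "has_bochner_integral lborel (\<lambda>t. 1 / Gamma (1 - \<beta>) * ?f t)
        (1 / Gamma (1 - \<beta>) * (Gamma (1 - \<beta>) * (1 - r) powr (- (1 - \<beta>))))"
      using \<beta> that by (intro has_bochner_integral_mult_right has_bochner_integral_Gamma) auto
    have eq1: "(\<lambda>t. 1 / Gamma (1 - \<beta>) * ?f t) = (\<lambda>x. exp (r * x) * h x)"
      by (auto simp: h_def fun_eq_iff algebra_simps simp flip: exp_add)
    have eq2: "1 / Gamma (1 - \<beta>) * (Gamma (1 - \<beta>) * (1 - r) powr (- (1 - \<beta>))) = (1 - r) powr (\<beta> - 1)"
      using \<Gamma> by simp
    from * show ?thesis
      unfolding eq1 eq2 .
  qed
  have g1: "has_bochner_integral lborel (g k) 1" for k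
    using mgf_g[of 0 k] X(2)[of k] by simp
  have h1: "has_bochner_integral lborel h 1"
    using mgf_h[of 0] by simp
  have [measurable]: "g k \<in> borel_measurable borel" "h \<in> borel_measurable borel" for k
    using g1[of k] h1 by (auto simp: has_bochner_integral_iff dest: borel_measurable_integrable)
  have weak: "weak_conv_m (\<lambda>k. lborel_density (g k)) (lborel_density h)"
  proof (rule weak_conv_m_if_mgf_tendsto[where b = 1])
    show "real_distribution (lborel_density (g k))" for k
      by (rule real_distribution_density[OF g1 g_nonneg])
    show "real_distribution (lborel_density h)"
      by (rule real_distribution_density[OF h1 h_nonneg])
    fix r :: real assume r: "\<bar>r\<bar> < 1"
    show "integrable (lborel_density (g k)) (\<lambda>x. exp (r * x))" for k
      using mgf_g[of r k] r g_nonneg by (subst integrable_density) (auto simp: has_bochner_integral_iff mult.commute)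
    show "integrable (lborel_density h) (\<lambda>x. exp (r * x))"
      using mgf_h[of r] r h_nonneg by (subst integrable_density) (auto simp: has_bochner_integral_iff mult.commute)
    have "(\<integral>x. exp (r * x) \<partial>lborel_density (g k)) =
        (1 - exp (- ((1 - r) powr \<beta> * X k powr (- \<beta>)))) / ((1 - r) * (1 - exp (- (X k powr (- \<beta>)))))" for k
      using mgf_g[of r k] r g_nonneg by (subst integral_density) (auto simp: has_bochner_integral_iff mult.commute)
    moreover have "(\<integral>x. exp (r * x) \<partial>lborel_density h) = (1 - r) powr (\<beta> - 1)"
      using mgf_h[of r] r h_nonneg by (subst integral_density) (auto simp: has_bochner_integral_iff mult.commute)
    moreover have "(\<lambda>k. (1 - exp (- ((1 - r) powr \<beta> * X k powr (- \<beta>)))) / ((1 - r) * (1 - exp (- (X k powr (- \<beta>))))))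
        \<longlonglongrightarrow> (1 - r) powr (\<beta> - 1)"
    proof (rule filterlim_compose[OF _ X0])
      have "(1 - r) powr \<beta> > 0"
        using r by simp
      then have "((\<lambda>u. (1 - exp (- ((1 - r) powr \<beta> * u))) / ((1 - r) * (1 - exp (- u)))) \<longlongrightarrow> (1 - r) powr \<beta> / (1 - r)) (at_right 0)"
        using r by real_asymp (simp add: divide_inverse)
      then show "((\<lambda>u. (1 - exp (- ((1 - r) powr \<beta> * u))) / ((1 - r) * (1 - exp (- u)))) \<longlongrightarrow> (1 - r) powr (\<beta> - 1)) (at_right 0)"
        using r by (simp add: powr_diff)
    qed
    ultimately show "(\<lambda>k. \<integral>x. exp (r * x) \<partial>lborel_density (g k)) \<longlonglongrightarrow>
        (\<integral>x. exp (r * x) \<partial>lborel_density h)"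
      by simp
  qed simp
  have Ioc: "(\<lambda>k. measure (lborel_density (g k)) {a<..b}) \<longlonglongrightarrow> measure (lborel_density h) {a<..b}"
    if "a < b" for a b
    by (rule weak_conv_m_density_Ioc[OF weak g1 g_nonneg h1 h_nonneg that])
  define T where "T k = X k powr \<beta> * tail (X k) / c k" for k
  have T_nonneg: "T k \<ge> 0" for k
    using c_pos[of k] by (simp add: T_def)
  have tail_mono: "tail y \<le> tail x" if "x \<le> y" for x y
    using that by (intro finite_measure_mono) auto
  \<comment> \<open>\<open>exp (- 1) * T k\<close> is the value of \<open>g k\<close> at 1. On (0,
    1] both factors exp(-x) and the tail are at least their values at 1, and beyond 1 at
    most.\<close>
  have T_upper: "exp (- 1) * T k \<le> g k x" if "0 < x" "x \<le> 1" for k x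
    using that c_pos[of k] X(2)[of k] unfolding T_def g_def
    by (auto intro!: mult_mono divide_right_mono mult_left_mono tail_mono mult_left_le)
  have T_lower: "g k x \<le> exp (- 1) * T k" if "1 \<le> x" for k x
    using that c_pos[of k] X(2)[of k] unfolding T_def g_def
    by (auto intro!: mult_mono divide_right_mono mult_left_mono tail_mono)
  have T: "T \<longlonglongrightarrow> 1 / Gamma (1 - \<beta>)"
  proof (rule order_tendstoI)
    fix y assume y: "1 / Gamma (1 - \<beta>) < y"
    \<comment> \<open>This expression is e times the limit density at 1 - \<delta>, its largest
      value on (1 - \<delta>, 1]; \<delta> is taken so small that it stays below y.\<close>
    have "((\<lambda>\<delta>. exp \<delta> * (1 - \<delta>) powr (- \<beta>) / Gamma (1 - \<beta>)) \<longlongrightarrow> 1 / Gamma (1 - \<beta>)) (at_right 0)"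
      using \<Gamma> by (auto intro!: tendsto_eq_intros)
    then obtain \<delta> where \<delta>: "exp \<delta> * (1 - \<delta>) powr (- \<beta>) / Gamma (1 - \<beta>) < y" "0 < \<delta>" "\<delta> < 1"
      using y by (blast dest: order_tendstoD elim: eventually_at_right_0_witness)
    have "measure (lborel_density h) {1 - \<delta><..1} \<le> exp (- (1 - \<delta>)) * ((1 - \<delta>) powr (- \<beta>) / Gamma (1 - \<beta>)) * (1 - (1 - \<delta>))"
    proof (rule measure_density_Ioc_bounds(2)[OF h1 h_nonneg _ h_nonneg])
      fix x assume "1 - \<delta> < x"
      then show "h x \<le> exp (- (1 - \<delta>)) * ((1 - \<delta>) powr (- \<beta>) / Gamma (1 - \<beta>))"
        using \<delta> \<Gamma> \<beta> unfolding h_def by (auto intro!: mult_mono divide_right_mono powr_mono2')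
    qed (use \<delta> in auto)
    also have "\<dots> = exp (- 1) * \<delta> * (exp \<delta> * (1 - \<delta>) powr (- \<beta>) / Gamma (1 - \<beta>))"
      by (simp add: exp_diff exp_minus field_simps)
    also have "\<dots> < exp (- 1) * \<delta> * y"
      using \<delta> by (intro mult_strict_left_mono) auto
    finally have "\<forall>\<^sub>F k in sequentially. measure (lborel_density (g k)) {1 - \<delta><..1} < exp (- 1) * \<delta> * y"
      using Ioc[of "1 - \<delta>" 1] \<delta> by (intro order_tendstoD) auto
    then show "\<forall>\<^sub>F k in sequentially. T k < y"
    proof eventually_elim
      case (elim k)
      have "exp (- 1) * T k * (1 - (1 - \<delta>)) \<le> measure (lborel_density (g k)) {1 - \<delta><..1}"
      proof (rule measure_density_Ioc_bounds(1)[OF g1 g_nonneg])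
        show "g k x \<le> X k powr \<beta> / c k" if "1 - \<delta> < x" for x
        proof -
          have "exp (- x) * (X k powr \<beta> * tail (X k * x) / c k) \<le> 1 * (X k powr \<beta> * 1 / c k)"
            using c_pos[of k] that \<delta> by (intro mult_mono divide_right_mono mult_left_mono) (auto simp: less_imp_le)
          then show ?thesis
            using that \<delta> by (simp add: g_def)
        qed
      qed (use \<delta> T_upper in auto)
      also note elim
      finally have "exp (- 1) * \<delta> * T k < exp (- 1) * \<delta> * y"
        by (simp add: mult_ac)
      then show ?case
        using \<delta> by (simp add: mult_less_cancel_left)
    qed
  next
    fix y assume y: "y < 1 / Gamma (1 - \<beta>)"
    \<comment> \<open>The mirror image on (1, 1 + \<delta>], where the limit density is at least its
      value at the right end.\<close>
    have "((\<lambda>\<delta>. exp (- \<delta>) * (1 + \<delta>) powr (- \<beta>) / Gamma (1 - \<beta>)) \<longlongrightarrow> 1 / Gamma (1 - \<beta>)) (at_right 0)"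
      using \<Gamma> by (auto intro!: tendsto_eq_intros)
    then obtain \<delta> where \<delta>: "y < exp (- \<delta>) * (1 + \<delta>) powr (- \<beta>) / Gamma (1 - \<beta>)" "0 < \<delta>" "\<delta> < 1"
      using y by (blast dest: order_tendstoD elim: eventually_at_right_0_witness)
    have "exp (- 1) * \<delta> * y < exp (- 1) * \<delta> * (exp (- \<delta>) * (1 + \<delta>) powr (- \<beta>) / Gamma (1 - \<beta>))"
      using \<delta> by (intro mult_strict_left_mono) auto
    also have "\<dots> = exp (- (1 + \<delta>)) * ((1 + \<delta>) powr (- \<beta>) / Gamma (1 - \<beta>)) * (1 + \<delta> - 1)"
      by (simp add: exp_add exp_diff exp_minus field_simps)
    also have "\<dots> \<le> measure (lborel_density h) {1<..1 + \<delta>}"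
    proof (rule measure_density_Ioc_bounds(1)[OF h1 h_nonneg])
      fix x assume x: "1 < x" "x \<le> 1 + \<delta>"
      then show "exp (- (1 + \<delta>)) * ((1 + \<delta>) powr (- \<beta>) / Gamma (1 - \<beta>)) \<le> h x"
        using \<delta> \<Gamma> \<beta> unfolding h_def by (auto intro!: mult_mono divide_right_mono powr_mono2')
      have "x powr (- \<beta>) \<le> 1"
        using x \<beta> by (simp add: powr_le_one_le powr_minus divide_simps ge_one_powr_ge_zero)
      then show "h x \<le> 1 * (1 / Gamma (1 - \<beta>))"
        using x \<Gamma> unfolding h_def by (auto intro!: mult_le_one divide_right_mono)
    qed (use \<delta> in auto)
    finally have "\<forall>\<^sub>F k in sequentially. exp (- 1) * \<delta> * y < measure (lborel_density (g k)) {1<..1 + \<delta>}"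
      using Ioc[of 1 "1 + \<delta>"] \<delta> by (intro order_tendstoD) auto
    then show "\<forall>\<^sub>F k in sequentially. y < T k"
    proof eventually_elim
      case (elim k)
      also have "measure (lborel_density (g k)) {1<..1 + \<delta>} \<le> exp (- 1) * T k * (1 + \<delta> - 1)"
        by (rule measure_density_Ioc_bounds(2)[OF g1 g_nonneg _ g_nonneg]) (use \<delta> T_lower in auto)
      finally have "exp (- 1) * \<delta> * y < exp (- 1) * \<delta> * T k"
        by (simp add: mult_ac)
      then show ?case
        using \<delta> by (simp add: mult_less_cancel_left)
    qed
  qed
  have c: "c \<longlonglongrightarrow> 1"
  proof -
    have "((\<lambda>u::real. (1 - exp (- u)) / u) \<longlongrightarrow> 1) (at_right 0)"
      by real_asymp
    then have "(\<lambda>k. (1 - exp (- (X k powr (- \<beta>)))) / X k powr (- \<beta>)) \<longlonglongrightarrow> 1"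
      using X0 by (rule filterlim_compose)
    then show ?thesis
      using X(2) by (simp add: c_def[abs_def] powr_minus divide_inverse mult.commute)
  qed
  have "(\<lambda>k. T k * c k) = (\<lambda>k. X k powr \<beta> * tail (X k))"
    using c_pos by (auto simp: T_def fun_eq_iff less_imp_neq[symmetric])
  then show ?thesis
    using tendsto_mult[OF T c] by simp
qed

lemma tail_tendsto: "((\<lambda>x. x powr \<beta> * tail x) \<longlongrightarrow> 1 / Gamma (1 - \<beta>)) at_top"
  by (rule tendsto_at_top_if_sequentially[where c = 0]) (rule tail_tendsto_sequentially)

end

section \<open>Asymptotics governed by the tail\<close>

text \<open>In the logarithmic variable rescaling is translation by \<open>\<rho>\<close>, and a
  tail of index \<open>\<kappa>\<close> is exponential. The layer-cake formula puts the tail under a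
  fixed integral, where \<open>exp (\<kappa> * \<rho>)\<close> times the translated tail converges
  pointwise and the bound valid for all w provides the majorant.\<close>

lemma (in prob_space) expectation_tail_tendsto:
  fixes K k L and c C \<kappa> :: real
  assumes [measurable]: "random_variable borel L"
    and bound: "\<And>w. prob {\<omega> \<in> space M. w \<le> L \<omega>} \<le> C * exp (- (\<kappa> * w))"
    and tail: "((\<lambda>w. exp (\<kappa> * w) * prob {\<omega> \<in> space M. w \<le> L \<omega>}) \<longlongrightarrow> c) at_top"
    and deriv: "\<And>w. (K has_real_derivative k w) (at w)" and cont: "continuous_on UNIV k"
    and lim: "(K \<longlongrightarrow> 0) at_bot" and int: "integrable lborel k"
    and int': "integrable lborel (\<lambda>w. k w * exp (- (\<kappa> * w)))"
  shows "((\<lambda>\<rho>. exp (\<kappa> * \<rho>) * expectation (\<lambda>\<omega>. K (L \<omega> - \<rho>))) \<longlongrightarrow> c * (\<integral>w. k w * exp (- (\<kappa> * w)) \<partial>lborel)) at_top"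
proof -
  let ?P = "\<lambda>w. prob {\<omega> \<in> space M. w \<le> L \<omega>}"
  have [measurable]: "k \<in> borel_measurable borel"
    using cont by (rule borel_measurable_continuous_onI)
  have [measurable]: "(\<lambda>x. ?P x) \<in> borel_measurable borel"
    by measurable
  have "((\<lambda>\<rho>. \<integral>w. k w * (exp (\<kappa> * \<rho>) * ?P (w + \<rho>)) \<partial>lborel) \<longlongrightarrow>
      (\<integral>w. k w * (exp (- (\<kappa> * w)) * c) \<partial>lborel)) at_top"
  proof (rule integral_dominated_convergence_at_top)
    show "integrable lborel (\<lambda>w. C * \<bar>k w * exp (- (\<kappa> * w))\<bar>)"
      using int' by (intro integrable_mult_right integrable_abs)
    show "\<forall>\<^sub>F \<rho> in at_top. AE w in lborel. norm (k w * (exp (\<kappa> * \<rho>) * ?P (w + \<rho>))) \<le> C * \<bar>k w * exp (- (\<kappa> * w))\<bar>"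
    proof (intro always_eventually allI AE_I2)
      fix \<rho> w
      have "norm (k w * (exp (\<kappa> * \<rho>) * ?P (w + \<rho>))) =
          \<bar>k w\<bar> * (exp (\<kappa> * \<rho>) * ?P (w + \<rho>))"
        by (simp add: abs_mult)
      also have "\<dots> \<le> \<bar>k w\<bar> * (exp (\<kappa> * \<rho>) * (C * exp (- (\<kappa> * (w + \<rho>)))))"
        by (intro mult_left_mono bound) auto
      also have "exp (\<kappa> * \<rho>) * (C * exp (- (\<kappa> * (w + \<rho>)))) = C * exp (- (\<kappa> * w))"
        by (simp add: distrib_left flip: exp_add)
      finally show "norm (k w * (exp (\<kappa> * \<rho>) * ?P (w + \<rho>))) \<le> C * \<bar>k w * exp (- (\<kappa> * w))\<bar>"
        by (simp add: abs_mult mult_ac)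
    qed
    show "AE w in lborel. ((\<lambda>\<rho>. k w * (exp (\<kappa> * \<rho>) * ?P (w + \<rho>))) \<longlongrightarrow> k w * (exp (- (\<kappa> * w)) * c)) at_top"
    proof (intro AE_I2 tendsto_mult_left)
      fix w :: real
      have "filterlim (\<lambda>\<rho>. w + \<rho>) at_top at_top"
        by (rule filterlim_tendsto_add_at_top[OF tendsto_const filterlim_ident])
      from filterlim_compose[OF tail this]
      have "((\<lambda>\<rho>. exp (- (\<kappa> * w)) * (exp (\<kappa> * (w + \<rho>)) * ?P (w + \<rho>))) \<longlongrightarrow> exp (- (\<kappa> * w)) * c) at_top"
        by (rule tendsto_mult_left)
      then show "((\<lambda>\<rho>. exp (\<kappa> * \<rho>) * ?P (w + \<rho>)) \<longlongrightarrow> exp (- (\<kappa> * w)) * c) at_top"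
        by (simp add: distrib_left exp_add exp_minus field_simps)
    qed
  qed auto
  moreover have "expectation (\<lambda>\<omega>. K (L \<omega> - \<rho>)) = (\<integral>w. k w * ?P (w + \<rho>) \<partial>lborel)" for \<rho>
    using layer_cake[of "\<lambda>\<omega>. L \<omega> - \<rho>", OF _ deriv cont lim int] by (simp add: le_diff_eq)
  moreover have "(\<integral>w. k w * (exp (\<kappa> * \<rho>) * P w) \<partial>lborel) = exp (\<kappa> * \<rho>) * (\<integral>w. k w * P w \<partial>lborel)" for P \<rho>
    by (subst mult.left_commute) simp
  moreover have "(\<integral>w. k w * (exp (- (\<kappa> * w)) * c) \<partial>lborel) = c * (\<integral>w. k w * exp (- (\<kappa> * w)) \<partial>lborel)"
    by (simp flip: mult.assoc)
  ultimately show ?thesis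
    by (simp only:)
qed

context stable_variable
begin

lemma tail_ln_eq:
  assumes "\<theta> > 0"
  shows "prob {\<omega> \<in> space M. w \<le> \<theta> * ln (S \<omega>)} = tail (exp (w / \<theta>))"
proof (rule finite_measure_eq_AE)
  show "AE \<omega> in M. \<omega> \<in> {\<omega> \<in> space M. w \<le> \<theta> * ln (S \<omega>)} \<longleftrightarrow> \<omega> \<in> {\<omega> \<in> space M. exp (w / \<theta>) \<le> S \<omega>}"
    using S_pos by eventually_elim (use assms in \<open>auto simp: ln_ge_iff[symmetric] field_simps\<close>)
qed auto

lemma tail_ln_le:
  assumes "\<theta> > 0"
  shows "prob {\<omega> \<in> space M. w \<le> \<theta> * ln (S \<omega>)} \<le> 1 / (1 - exp (- 1)) * exp (- (\<beta> / \<theta> * w))"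
  using tail_le[of "exp (w / \<theta>)"] assms by (simp add: tail_ln_eq powr_def mult.commute)

lemma tail_ln_tendsto:
  assumes "\<theta> > 0"
  shows "((\<lambda>w. exp (\<beta> / \<theta> * w) * prob {\<omega> \<in> space M. w \<le> \<theta> * ln (S \<omega>)}) \<longlongrightarrow> 1 / Gamma (1 - \<beta>)) at_top"
proof -
  have "filterlim (\<lambda>w. exp (w / \<theta>)) at_top at_top"
    using assms by real_asymp
  from filterlim_compose[OF tail_tendsto this] show ?thesis
    using assms by (simp add: tail_ln_eq powr_def mult.commute)
qed

text \<open>For a = n / 2 and r = |x - y| t^(-1 / (2 \<beta>)), the density p^S is (4 pi)^(-a) t^(-a
  / \<beta>) times this value.\<close>

abbreviation kernel_integral :: "real \<Rightarrow> real \<Rightarrow> real" where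
  "kernel_integral a r \<equiv> expectation (\<lambda>\<omega>. S \<omega> powr (- a) * exp (- (r\<^sup>2) / (4 * S \<omega>)))"

text \<open>For a = n / 2 and q = |x - y|^2 t^(-\<beta>), the density of the inverse-subordinated
  motion is (4 pi)^(-a) t^(-\<beta> a) times this value.\<close>

abbreviation inverse_kernel_integral :: "real \<Rightarrow> real \<Rightarrow> real" where
  "inverse_kernel_integral a q \<equiv> expectation (\<lambda>\<omega>. S \<omega> powr (\<beta> * a) * exp (- q * S \<omega> powr \<beta> / 4))"

lemma kernel_tendsto_at_top:
  assumes a: "a > 0"
  shows "((\<lambda>r. r powr (2 * a + 2 * \<beta>) * kernel_integral a r)
           \<longlongrightarrow> \<beta> * 4 powr (a + \<beta>) * Gamma (a + \<beta>) / Gamma (1 - \<beta>)) at_top"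
proof -
  \<comment> \<open>\<open>K (ln S - 2 * ln r)\<close> is r^(2 a) times the integrand, and
    \<open>k\<close> is the derivative of \<open>K\<close>. Since \<open>ln S\<close> has tail index
    \<beta>, the integral of \<open>k\<close> is wanted at \<kappa> = \<beta>; \<kappa> = 0 gives
    its plain integrability.\<close>
  define K where "K w = exp (- (a * w) - exp (- w) / 4)" for w :: real
  define k where "k w = (exp (- w) / 4 - a) * K w" for w
  have int: "has_bochner_integral lborel (\<lambda>w. k w * exp (- (\<kappa> * w)))
      (Gamma (a + \<kappa> + 1) * 4 powr (a + \<kappa> + 1) / 4 - a * (Gamma (a + \<kappa>) * 4 powr (a + \<kappa>)))" if "\<kappa> \<ge> 0" for \<kappa>
  proof -
    have *: "has_bochner_integral lborel (\<lambda>w. exp (- (b * w) - exp (- w) / 4)) (Gamma b * 4 powr b)" if "b > 0" for b :: real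
      using has_bochner_integral_Gamma_exp_affine[of "- 1" "- b" "1 / 4"] that by (simp add: powr_divide powr_minus)
    have "has_bochner_integral lborel
        (\<lambda>w. exp (- ((a + \<kappa> + 1) * w) - exp (- w) / 4) / 4 - a * exp (- ((a + \<kappa>) * w) - exp (- w) / 4))
        (Gamma (a + \<kappa> + 1) * 4 powr (a + \<kappa> + 1) / 4 - a * (Gamma (a + \<kappa>) * 4 powr (a + \<kappa>)))"
      using a that by (intro has_bochner_integral_diff has_bochner_integral_divide has_bochner_integral_mult_right *) auto
    moreover have "exp (- ((a + \<kappa> + 1) * w) - exp (- w) / 4) / 4 - a * exp (- ((a + \<kappa>) * w) - exp (- w) / 4)
        = k w * exp (- (\<kappa> * w))" for w
    proof -
      have "exp (- ((a + \<kappa> + 1) * w) - exp (- w) / 4) = exp (- w) * (K w * exp (- (\<kappa> * w)))"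
        "exp (- ((a + \<kappa>) * w) - exp (- w) / 4) = K w * exp (- (\<kappa> * w))"
        by (simp_all add: K_def algebra_simps flip: exp_add)
      then show ?thesis
        by (simp add: k_def algebra_simps)
    qed
    ultimately show ?thesis
      by simp
  qed
  have "((\<lambda>\<rho>. exp (\<beta> * \<rho>) * expectation (\<lambda>\<omega>. K (ln (S \<omega>) - \<rho>))) \<longlongrightarrow>
      1 / Gamma (1 - \<beta>) * (\<integral>w. k w * exp (- (\<beta> * w)) \<partial>lborel)) at_top"
  proof (rule expectation_tail_tendsto)
    show "(K has_real_derivative k w) (at w)" for w
      unfolding K_def k_def by (auto intro!: derivative_eq_intros simp: field_simps)
    show "continuous_on UNIV k"
      unfolding K_def k_def by (intro continuous_intros) auto
    show "(K \<longlongrightarrow> 0) at_bot"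
      unfolding K_def using a by real_asymp
    show "integrable lborel k" "integrable lborel (\<lambda>w. k w * exp (- (\<beta> * w)))"
      using int[of 0] int[of \<beta>] \<beta> by (simp_all add: has_bochner_integral_iff)
    show "prob {\<omega> \<in> space M. w \<le> ln (S \<omega>)} \<le> 1 / (1 - exp (- 1)) * exp (- (\<beta> * w))" for w
      using tail_ln_le[of 1 w] by simp
  qed (use tail_ln_tendsto[of 1] in auto)
  moreover have "filterlim (\<lambda>r::real. 2 * ln r) at_top at_top"
    by real_asymp
  ultimately have "((\<lambda>r. exp (\<beta> * (2 * ln r)) * expectation (\<lambda>\<omega>. K (ln (S \<omega>) - 2 * ln r))) \<longlongrightarrow>
      1 / Gamma (1 - \<beta>) * (\<integral>w. k w * exp (- (\<beta> * w)) \<partial>lborel)) at_top"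
    by (rule filterlim_compose)
  moreover have "\<forall>\<^sub>F r in at_top. exp (\<beta> * (2 * ln r)) * expectation (\<lambda>\<omega>. K (ln (S \<omega>) - 2 * ln r)) =
      r powr (2 * a + 2 * \<beta>) * kernel_integral a r"
    using eventually_gt_at_top[of 0]
  proof eventually_elim
    fix r :: real assume r: "r > 0"
    have "expectation (\<lambda>\<omega>. K (ln (S \<omega>) - 2 * ln r)) =
        expectation (\<lambda>\<omega>. r powr (2 * a) * (S \<omega> powr (- a) * exp (- (r\<^sup>2) / (4 * S \<omega>))))"
    proof (rule integral_cong_AE)
      show "AE \<omega> in M. K (ln (S \<omega>) - 2 * ln r) = r powr (2 * a) * (S \<omega> powr (- a) * exp (- (r\<^sup>2) / (4 * S \<omega>)))"
        using S_pos
      proof eventually_elim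
        case (elim \<omega>)
        have "exp (2 * ln r - ln (S \<omega>)) = r\<^sup>2 / S \<omega>"
          using elim r by (simp add: exp_diff exp_double)
        then have "K (ln (S \<omega>) - 2 * ln r) = exp (2 * a * ln r) * exp (- a * ln (S \<omega>)) * exp (- (r\<^sup>2) / (4 * S \<omega>))"
          by (simp add: K_def algebra_simps flip: exp_add)
        then show ?case
          using elim r by (simp add: powr_def)
      qed
    qed (auto simp: K_def)
    then have "expectation (\<lambda>\<omega>. K (ln (S \<omega>) - 2 * ln r)) =
        r powr (2 * a) * kernel_integral a r"
      by simp
    moreover have "r powr (2 * a + 2 * \<beta>) = exp (\<beta> * (2 * ln r)) * r powr (2 * a)"
      using r by (simp add: powr_def algebra_simps flip: exp_add)
    ultimately show "exp (\<beta> * (2 * ln r)) * expectation (\<lambda>\<omega>. K (ln (S \<omega>) - 2 * ln r)) =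
      r powr (2 * a + 2 * \<beta>) * kernel_integral a r"
      by (simp only: mult.assoc)
  qed
  ultimately have "((\<lambda>r. r powr (2 * a + 2 * \<beta>) * kernel_integral a r) \<longlongrightarrow>
      1 / Gamma (1 - \<beta>) * (\<integral>w. k w * exp (- (\<beta> * w)) \<partial>lborel)) at_top"
    by (rule Lim_transform_eventually)
  moreover have "(\<integral>w. k w * exp (- (\<beta> * w)) \<partial>lborel) = \<beta> * 4 powr (a + \<beta>) * Gamma (a + \<beta>)"
  proof -
    have "(\<integral>w. k w * exp (- (\<beta> * w)) \<partial>lborel) =
        Gamma (a + \<beta> + 1) * 4 powr (a + \<beta> + 1) / 4 - a * (Gamma (a + \<beta>) * 4 powr (a + \<beta>))"
      using int[of \<beta>] \<beta> by (simp only: has_bochner_integral_iff)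
    also have "\<dots> = \<beta> * 4 powr (a + \<beta>) * Gamma (a + \<beta>)"
    proof -
      \<comment> \<open>After the functional equation the two terms have the coefficients a +
        \<beta> and a; their difference is the factor \<beta> of the constant.\<close>
      have *: "Gamma (a + \<beta> + 1) = (a + \<beta>) * Gamma (a + \<beta>)" "4 powr (a + \<beta> + 1) = 4 powr (a + \<beta>) * 4"
        using Gamma_real_plus1[of "a + \<beta>"] powr_add[of 4 "a + \<beta>" 1] a \<beta> by auto
      show ?thesis
        unfolding * by (simp add: algebra_simps)
    qed
    finally show ?thesis .
  qed
  ultimately show ?thesis
    by simp
qed

text \<open>Dominated convergence with majorant S^(-a). The filter \<open>nhds 0\<close> includes r
  = 0, because (b) admits the diagonal x = y.\<close>

lemma kernel_tendsto_0:
  assumes a: "a > 0"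
  shows "((\<lambda>r. kernel_integral a r)
           \<longlongrightarrow> Gamma (1 + a / \<beta>) / Gamma (1 + a)) (nhds 0)"
proof -
  note moment = has_bochner_integral_neg_moment[OF a]
  let ?f = "\<lambda>r. kernel_integral a r"
  have "(?f \<longlongrightarrow> ?f 0) (at 0)"
    unfolding tendsto_at_iff_sequentially comp_def
  proof (intro allI impI)
    fix X :: "nat \<Rightarrow> real" assume X: "X \<longlonglongrightarrow> 0"
    show "(\<lambda>i. ?f (X i)) \<longlonglongrightarrow> ?f 0"
    proof (rule integral_dominated_convergence)
      show "integrable M (\<lambda>\<omega>. S \<omega> powr (- a))"
        using moment by (simp add: has_bochner_integral_iff)
      show "AE \<omega> in M. (\<lambda>i. S \<omega> powr (- a) * exp (- ((X i)\<^sup>2) / (4 * S \<omega>))) \<longlonglongrightarrow> S \<omega> powr (- a) * exp (- (0\<^sup>2) / (4 * S \<omega>))"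
        using S_pos by eventually_elim (intro tendsto_intros X, simp)
      show "AE \<omega> in M. norm (S \<omega> powr (- a) * exp (- ((X i)\<^sup>2) / (4 * S \<omega>))) \<le> S \<omega> powr (- a)" for i
        using S_pos by eventually_elim (auto simp: abs_mult intro!: mult_left_le)
    qed auto
  qed
  then show ?thesis
    using moment by (simp add: tendsto_nhds_iff has_bochner_integral_iff)
qed

text \<open>The limit is the moment of order \<beta> a at a = 1/2, finite because \<beta> / 2 <
  \<beta>. For a >= 1 that moment is infinite, which explains the different behaviour for n >=
  2.\<close>

lemma inverse_kernel_tendsto_0_half:
  "((\<lambda>q. expectation (\<lambda>\<omega>. S \<omega> powr (\<beta> / 2) * exp (- q * S \<omega> powr \<beta> / 4)))
     \<longlongrightarrow> sqrt pi / Gamma (1 - \<beta> / 2)) (at_right 0)"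
proof -
  have moment: "has_bochner_integral M (\<lambda>\<omega>. S \<omega> powr (\<beta> / 2)) (sqrt pi / Gamma (1 - \<beta> / 2))"
    using has_bochner_integral_pos_moment[of "\<beta> / 2"] \<beta> by (simp add: Gamma_one_half_real)
  let ?f = "\<lambda>q. expectation (\<lambda>\<omega>. S \<omega> powr (\<beta> / 2) * exp (- q * S \<omega> powr \<beta> / 4))"
  have "(?f \<longlongrightarrow> ?f 0) (at_right 0)"
    unfolding tendsto_at_iff_sequentially comp_def
  proof (intro allI impI)
    fix X :: "nat \<Rightarrow> real" assume X: "X \<longlonglongrightarrow> 0" "\<forall>i. X i \<in> {0<..} - {0}"
    show "(\<lambda>i. ?f (X i)) \<longlonglongrightarrow> ?f 0"
    proof (rule integral_dominated_convergence)
      show "integrable M (\<lambda>\<omega>. S \<omega> powr (\<beta> / 2))"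
        using moment by (simp add: has_bochner_integral_iff)
      show "AE \<omega> in M. (\<lambda>i. S \<omega> powr (\<beta> / 2) * exp (- X i * S \<omega> powr \<beta> / 4)) \<longlonglongrightarrow> S \<omega> powr (\<beta> / 2) * exp (- 0 * S \<omega> powr \<beta> / 4)"
        by (intro AE_I2 tendsto_intros X) auto
      show "AE \<omega> in M. norm (S \<omega> powr (\<beta> / 2) * exp (- X i * S \<omega> powr \<beta> / 4)) \<le> S \<omega> powr (\<beta> / 2)" for i
        using X(2) by (auto simp: abs_mult less_imp_le intro!: mult_left_le)
    qed auto
  qed
  then show ?thesis
    using moment by (simp add: has_bochner_integral_iff)
qed

text \<open>With e^w = q S^\<beta>, this is q^a times the integrand of
  \<open>inverse_kernel_integral a q\<close>.\<close>

definition inverse_profile :: "real \<Rightarrow> real \<Rightarrow> real" where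
  "inverse_profile a w = exp (a * w - exp w / 4)"

lemma inverse_kernel_eq:
  assumes q: "q > 0"
  shows "inverse_kernel_integral a q =
           q powr (- a) * expectation (\<lambda>\<omega>. inverse_profile a (\<beta> * ln (S \<omega>) - (- ln q)))"
proof -
  have "inverse_kernel_integral a q =
      expectation (\<lambda>\<omega>. q powr (- a) * inverse_profile a (\<beta> * ln (S \<omega>) - (- ln q)))"
  proof (rule integral_cong_AE)
    show "AE \<omega> in M. S \<omega> powr (\<beta> * a) * exp (- q * S \<omega> powr \<beta> / 4) =
        q powr (- a) * inverse_profile a (\<beta> * ln (S \<omega>) - (- ln q))"
      using S_pos
    proof eventually_elim
      case (elim \<omega>)
      have "exp (\<beta> * ln (S \<omega>) - (- ln q)) = q * S \<omega> powr \<beta>"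
        using elim q by (simp add: exp_add powr_def)
      then have "inverse_profile a (\<beta> * ln (S \<omega>) - (- ln q)) =
          exp (a * (\<beta> * ln (S \<omega>) - (- ln q)) + - q * S \<omega> powr \<beta> / 4)"
        unfolding inverse_profile_def by (simp only:) simp
      then have "q powr (- a) * inverse_profile a (\<beta> * ln (S \<omega>) - (- ln q)) =
          q powr (- a) * exp (a * (\<beta> * ln (S \<omega>) - (- ln q))) * exp (- q * S \<omega> powr \<beta> / 4)"
        by (simp only: exp_add mult.assoc)
      also have "q powr (- a) * exp (a * (\<beta> * ln (S \<omega>) - (- ln q))) = S \<omega> powr (\<beta> * a)"
        using elim q by (simp add: powr_def algebra_simps flip: exp_add)
      finally show ?case ..
    qed
  qed (auto simp: inverse_profile_def)
  then show ?thesis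
    by simp
qed

lemma has_real_derivative_inverse_profile:
  "(inverse_profile a has_real_derivative (a - exp w / 4) * inverse_profile a w) (at w)"
  unfolding inverse_profile_def by (auto intro!: derivative_eq_intros simp: field_simps)

text \<open>As \<open>\<beta> * ln S\<close> has tail index 1, the relevant value is \<kappa> = 1,
  which requires a > 1; \<kappa> = 0 gives plain integrability.\<close>

lemma has_bochner_integral_inverse_profile:
  assumes "a - \<kappa> > 0"
  shows "has_bochner_integral lborel (\<lambda>w. (a - exp w / 4) * inverse_profile a w * exp (- (\<kappa> * w)))
           (a * (Gamma (a - \<kappa>) * 4 powr (a - \<kappa>)) - Gamma (a - \<kappa> + 1) * 4 powr (a - \<kappa> + 1) / 4)"
proof -
  have *: "has_bochner_integral lborel (\<lambda>w. exp (b * w - exp w / 4)) (Gamma b * 4 powr b)" if "b > 0" for b :: real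
    using has_bochner_integral_Gamma_exp_affine[of 1 b "1 / 4"] that by (simp add: powr_divide powr_minus)
  have "has_bochner_integral lborel
      (\<lambda>w. a * exp ((a - \<kappa>) * w - exp w / 4) - exp ((a - \<kappa> + 1) * w - exp w / 4) / 4)
      (a * (Gamma (a - \<kappa>) * 4 powr (a - \<kappa>)) - Gamma (a - \<kappa> + 1) * 4 powr (a - \<kappa> + 1) / 4)"
    using assms by (intro has_bochner_integral_diff has_bochner_integral_divide has_bochner_integral_mult_right *) auto
  moreover have "a * exp ((a - \<kappa>) * w - exp w / 4) - exp ((a - \<kappa> + 1) * w - exp w / 4) / 4
      = (a - exp w / 4) * inverse_profile a w * exp (- (\<kappa> * w))" for w
  proof -
    have "exp ((a - \<kappa> + 1) * w - exp w / 4) = exp w * (inverse_profile a w * exp (- (\<kappa> * w)))"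
      "exp ((a - \<kappa>) * w - exp w / 4) = inverse_profile a w * exp (- (\<kappa> * w))"
      by (simp_all add: inverse_profile_def algebra_simps flip: exp_add)
    then show ?thesis
      by (simp add: algebra_simps)
  qed
  ultimately show ?thesis
    by simp
qed

lemma inverse_profile_at_bot: "a > 0 \<Longrightarrow> (inverse_profile a \<longlongrightarrow> 0) at_bot"
  unfolding inverse_profile_def by real_asymp

text \<open>The mean is dominated by values of S^\<beta> of order 1 / q, so only the tail of
  \<open>S\<close> enters; the translation is by \<open>- ln q\<close>, which tends to
  infinity.\<close>

lemma inverse_kernel_tendsto_0_gt_1:
  assumes a: "a > 1"
  shows "((\<lambda>q. q powr (a - 1) * inverse_kernel_integral a q)
           \<longlongrightarrow> 4 powr (a - 1) * Gamma (a - 1) / Gamma (1 - \<beta>)) (at_right 0)"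
proof -
  let ?k = "\<lambda>w. (a - exp w / 4) * inverse_profile a w"
  have "((\<lambda>\<rho>. exp (1 * \<rho>) * expectation (\<lambda>\<omega>. inverse_profile a (\<beta> * ln (S \<omega>) - \<rho>))) \<longlongrightarrow>
      1 / Gamma (1 - \<beta>) * (\<integral>w. ?k w * exp (- (1 * w)) \<partial>lborel)) at_top"
  proof (rule expectation_tail_tendsto[OF _ _ _ has_real_derivative_inverse_profile])
    show "continuous_on UNIV ?k"
      unfolding inverse_profile_def by (intro continuous_intros) auto
    show "integrable lborel ?k" "integrable lborel (\<lambda>w. ?k w * exp (- (1 * w)))"
      using has_bochner_integral_inverse_profile[of a 0] has_bochner_integral_inverse_profile[of a 1] a
      by (simp_all add: has_bochner_integral_iff)
    show "prob {\<omega> \<in> space M. w \<le> \<beta> * ln (S \<omega>)} \<le> 1 / (1 - exp (- 1)) * exp (- (1 * w))" for w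
      using tail_ln_le[of \<beta> w] \<beta> by simp
  qed (use tail_ln_tendsto[of \<beta>] inverse_profile_at_bot[of a] a \<beta> in auto)
  moreover have "filterlim (\<lambda>q::real. - ln q) at_top (at_right 0)"
    by real_asymp
  ultimately have "((\<lambda>q. exp (1 * - ln q) * expectation (\<lambda>\<omega>. inverse_profile a (\<beta> * ln (S \<omega>) - (- ln q)))) \<longlongrightarrow>
      1 / Gamma (1 - \<beta>) * (\<integral>w. ?k w * exp (- (1 * w)) \<partial>lborel)) (at_right 0)"
    by (rule filterlim_compose)
  moreover have "\<forall>\<^sub>F q in at_right 0. exp (1 * - ln q) * expectation (\<lambda>\<omega>. inverse_profile a (\<beta> * ln (S \<omega>) - (- ln q))) =
      q powr (a - 1) * inverse_kernel_integral a q"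
    using eventually_at_right_less[of 0]
  proof eventually_elim
    case (elim q)
    then have "exp (1 * - ln q) = q powr (a - 1) * q powr (- a)"
      by (simp add: powr_def algebra_simps flip: exp_add)
    then show ?case
      by (simp only: inverse_kernel_eq[OF elim] mult.assoc)
  qed
  ultimately have "((\<lambda>q. q powr (a - 1) * inverse_kernel_integral a q) \<longlongrightarrow>
      1 / Gamma (1 - \<beta>) * (\<integral>w. ?k w * exp (- (1 * w)) \<partial>lborel)) (at_right 0)"
    by (rule Lim_transform_eventually)
  moreover have "(\<integral>w. ?k w * exp (- (1 * w)) \<partial>lborel) = 4 powr (a - 1) * Gamma (a - 1)"
  proof -
    have "(\<integral>w. ?k w * exp (- (1 * w)) \<partial>lborel) =
        a * (Gamma (a - 1) * 4 powr (a - 1)) - Gamma (a - 1 + 1) * 4 powr (a - 1 + 1) / 4"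
      using has_bochner_integral_inverse_profile[of a 1] a by (simp only: has_bochner_integral_iff)
    also have "\<dots> = 4 powr (a - 1) * Gamma (a - 1)"
    proof -
      have *: "Gamma (a - 1 + 1) = (a - 1) * Gamma (a - 1)" "4 powr (a - 1 + 1) = 4 powr (a - 1) * 4"
        using Gamma_real_plus1[of "a - 1"] powr_add[of 4 "a - 1" 1] a by auto
      show ?thesis
        unfolding * by (simp add: field_simps)
    qed
    finally show ?thesis .
  qed
  ultimately show ?thesis
    by simp
qed

text \<open>
  For \<open>a = 1\<close> the limiting integral diverges logarithmically: on the scale \<open>w = \<rho> * v\<close>
  of the logarithm of \<open>S powr \<beta>\<close>, the integrand converges to the indicator of \<open>(0, 1)\<close>.
\<close>

lemma inverse_kernel_tendsto_0_eq_1: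
  "((\<lambda>q. expectation (\<lambda>\<omega>. S \<omega> powr \<beta> * exp (- q * S \<omega> powr \<beta> / 4)) / (- ln q))
     \<longlongrightarrow> 1 / Gamma (1 - \<beta>)) (at_right 0)"
proof -
  let ?P = "\<lambda>w. prob {\<omega> \<in> space M. w \<le> \<beta> * ln (S \<omega>)}"
  \<comment> \<open>The derivative of the profile is \<open>exp w * m w\<close>. Attaching the
    exponential to the tail gives \<open>H\<close>, which is bounded and tends to 1 / Gamma(1 -
    \<beta>), while \<open>m\<close> tends to 1 at minus infinity and to 0 at infinity.\<close>
  define m where "m w = (1 - exp w / 4) * exp (- exp w / 4)" for w :: real
  define H where "H w = exp w * ?P w" for w
  define C :: real where "C = 1 / (1 - exp (- 1))"
  have C: "C > 0"
    by (simp add: C_def)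
  have [measurable]: "m \<in> borel_measurable borel"
    unfolding m_def by measurable
  have [measurable]: "?P \<in> borel_measurable borel"
    by measurable
  have [measurable]: "H \<in> borel_measurable borel"
    unfolding H_def by measurable
  have H: "0 \<le> H w" "H w \<le> exp w" "H w \<le> C" for w
    using tail_ln_le[of \<beta> w] \<beta> by (simp_all add: H_def C_def exp_minus field_simps)
  \<comment> \<open>The constant 8 is 2 * 4: with z = e^w / 4 the second bound follows from z (1 +
    z) <= 2 e^z.\<close>
  have m1: "\<bar>m w\<bar> \<le> 1" and m2: "\<bar>m w\<bar> \<le> 8 * exp (- w)" for w
  proof -
    define z where "z = exp w / 4"
    have z: "z > 0" "exp w = 4 * z"
      by (simp_all add: z_def)
    have "1 + z + z\<^sup>2 / 2 \<le> exp z"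
      using exp_lower_Taylor_quadratic[of z] z by simp
    then have "1 + z \<le> exp z" "z * (1 + z) \<le> 2 * exp z"
      using z by (auto simp: power2_eq_square algebra_simps intro: order_trans[rotated])
    moreover have "\<bar>m w\<bar> \<le> (1 + z) * exp (- z)"
      using z by (simp add: m_def abs_mult)
    moreover have "(1 + z) * exp (- z) \<le> 1 \<and> (1 + z) * exp (- z) \<le> 8 * exp (- w)"
      if "1 + z \<le> exp z" "z * (1 + z) \<le> 2 * exp z"
      using that z by (simp add: exp_minus field_simps)
    ultimately show "\<bar>m w\<bar> \<le> 1" "\<bar>m w\<bar> \<le> 8 * exp (- w)"
      by linarith+
  qed
  have "((\<lambda>\<rho>. \<integral>v. m (\<rho> * (v - 1)) * H (\<rho> * v) \<partial>lborel) \<longlongrightarrow>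
      (\<integral>v. indicator {0<..<1::real} v * (1 / Gamma (1 - \<beta>)) \<partial>lborel)) at_top"
  proof (rule integral_dominated_convergence_at_top)
    show "integrable lborel (\<lambda>v. (1 + 8 * exp 1 * C) * exp (- \<bar>v\<bar>))"
      using integrable_exp_neg_abs by simp
    show "\<forall>\<^sub>F \<rho> in at_top. AE v in lborel. norm (m (\<rho> * (v - 1)) * H (\<rho> * v)) \<le> (1 + 8 * exp 1 * C) * exp (- \<bar>v\<bar>)"
      using eventually_ge_at_top[of 1]
    proof eventually_elim
      case (elim \<rho>)
      show ?case
      proof (intro AE_I2)
        fix v :: real
        \<comment> \<open>Below 0 the decay comes from \<open>H\<close>, above 1 from
          \<open>m\<close>, and in between boundedness of both suffices; \<rho> >= 1 allows \<rho>
          to be dropped from the exponents.\<close>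
        consider "v < 0" | "0 \<le> v" "v \<le> 1" | "1 < v"
          by linarith
        then have "\<bar>m (\<rho> * (v - 1))\<bar> * H (\<rho> * v) \<le> 1 * exp (- \<bar>v\<bar>) \<or> \<bar>m (\<rho> * (v - 1))\<bar> * H (\<rho> * v) \<le> (8 * exp 1 * C) * exp (- \<bar>v\<bar>)"
        proof cases
          case 1
          then have "\<rho> * v \<le> - \<bar>v\<bar>"
            using elim mult_right_mono_neg[of 1 \<rho> v] by simp
          then have "H (\<rho> * v) \<le> exp (- \<bar>v\<bar>)"
            using H(2)[of "\<rho> * v"] by (meson exp_le_cancel_iff order_trans)
          then have "\<bar>m (\<rho> * (v - 1))\<bar> * H (\<rho> * v) \<le> 1 * exp (- \<bar>v\<bar>)"
            using m1 H(1) by (intro mult_mono) auto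
          then show ?thesis ..
        next
          case 2
          have "\<bar>m (\<rho> * (v - 1))\<bar> * H (\<rho> * v) \<le> 1 * C"
            using m1 H(1,3) by (intro mult_mono) auto
          also have "\<dots> \<le> 8 * exp (1 - \<bar>v\<bar>) * C"
            using 2 C by (intro mult_right_mono) (auto intro: order_trans[of _ "exp (1 - \<bar>v\<bar>)"])
          finally show ?thesis
            by (simp add: exp_diff exp_minus field_simps)
        next
          case 3
          then have "1 * (v - 1) \<le> \<rho> * (v - 1)"
            using elim by (intro mult_right_mono) auto
          then have "- (\<rho> * (v - 1)) \<le> - (1 * (v - 1))"
            by (rule le_imp_neg_le)
          also have "\<dots> = 1 - \<bar>v\<bar>"
            using 3 by simp
          finally have "- (\<rho> * (v - 1)) \<le> 1 - \<bar>v\<bar>" .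
          then have "8 * exp (- (\<rho> * (v - 1))) \<le> 8 * exp (1 - \<bar>v\<bar>)"
            by simp
          then have "\<bar>m (\<rho> * (v - 1))\<bar> \<le> 8 * exp (1 - \<bar>v\<bar>)"
            using m2 order_trans by blast
          then have "\<bar>m (\<rho> * (v - 1))\<bar> * H (\<rho> * v) \<le> 8 * exp (1 - \<bar>v\<bar>) * C"
            using H(1,3) by (intro mult_mono) auto
          then show ?thesis
            by (simp add: exp_diff exp_minus field_simps)
        qed
        moreover have "0 \<le> 8 * exp 1 * C * exp (- \<bar>v\<bar>)" "0 \<le> exp (- \<bar>v\<bar>)"
          using C by simp_all
        ultimately show "norm (m (\<rho> * (v - 1)) * H (\<rho> * v)) \<le> (1 + 8 * exp 1 * C) * exp (- \<bar>v\<bar>)"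
          using H(1)[of "\<rho> * v"] unfolding distrib_right real_norm_def abs_mult by linarith
      qed
    qed
    have "AE v in lborel. v \<noteq> 0 \<and> v \<noteq> (1::real)"
      by (intro AE_conjI AE_lborel_singleton)
    then show "AE v in lborel. ((\<lambda>\<rho>. m (\<rho> * (v - 1)) * H (\<rho> * v)) \<longlongrightarrow> indicator {0<..<1::real} v * (1 / Gamma (1 - \<beta>))) at_top"
    proof eventually_elim
      fix v :: real assume "v \<noteq> 0 \<and> v \<noteq> 1"
      then consider "v < 0" | "0 < v" "v < 1" | "1 < v"
        by linarith
      then show "((\<lambda>\<rho>. m (\<rho> * (v - 1)) * H (\<rho> * v)) \<longlongrightarrow> indicator {0<..<1::real} v * (1 / Gamma (1 - \<beta>))) at_top"
      proof cases
        case 1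
        have "((\<lambda>\<rho>. m (\<rho> * (v - 1)) * H (\<rho> * v)) \<longlongrightarrow> 0) at_top"
        proof (rule Lim_null_comparison)
          have "norm (m (\<rho> * (v - 1)) * H (\<rho> * v)) \<le> 1 * exp (\<rho> * v)" for \<rho>
            using m1 H(1,2) by (simp only: real_norm_def abs_mult) (intro mult_mono, auto)
          then show "\<forall>\<^sub>F \<rho> in at_top. norm (m (\<rho> * (v - 1)) * H (\<rho> * v)) \<le> 1 * exp (\<rho> * v)"
            by simp
          show "((\<lambda>\<rho>. 1 * exp (\<rho> * v)) \<longlongrightarrow> 0) at_top"
            using 1 by real_asymp
        qed
        then show ?thesis
          using 1 by simp
      next
        case 2
        have "((\<lambda>\<rho>. m (\<rho> * (v - 1))) \<longlongrightarrow> 1) at_top"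
        proof -
          define c where "c = v - 1"
          have "c < 0"
            using 2 by (simp add: c_def)
          then have "((\<lambda>\<rho>. m (\<rho> * c)) \<longlongrightarrow> 1) at_top"
            unfolding m_def by real_asymp
          then show ?thesis
            by (simp add: c_def)
        qed
        moreover have "filterlim (\<lambda>\<rho>. \<rho> * v) at_top at_top"
          using 2 by real_asymp
        then have "((\<lambda>\<rho>. H (\<rho> * v)) \<longlongrightarrow> 1 / Gamma (1 - \<beta>)) at_top"
          using tail_ln_tendsto[of \<beta>] \<beta> unfolding H_def by (auto intro: filterlim_compose)
        ultimately have "((\<lambda>\<rho>. m (\<rho> * (v - 1)) * H (\<rho> * v)) \<longlongrightarrow> 1 * (1 / Gamma (1 - \<beta>))) at_top"
          by (rule tendsto_mult)
        then show ?thesis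
          using 2 by simp
      next
        case 3
        have "((\<lambda>\<rho>. m (\<rho> * (v - 1)) * H (\<rho> * v)) \<longlongrightarrow> 0) at_top"
        proof (rule Lim_null_comparison)
          have "norm (m (\<rho> * (v - 1)) * H (\<rho> * v)) \<le> 8 * exp (- (\<rho> * (v - 1))) * C" for \<rho>
            using m2 H(1,3) by (simp only: real_norm_def abs_mult) (intro mult_mono, auto)
          then show "\<forall>\<^sub>F \<rho> in at_top. norm (m (\<rho> * (v - 1)) * H (\<rho> * v)) \<le> 8 * exp (- (\<rho> * (v - 1))) * C"
            by simp
          show "((\<lambda>\<rho>. 8 * exp (- (\<rho> * (v - 1))) * C) \<longlongrightarrow> 0) at_top"
          proof -
            define c where "c = v - 1"
            have "c > 0"
              using 3 by (simp add: c_def)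
            then have "((\<lambda>\<rho>. 8 * exp (- (\<rho> * c)) * C) \<longlongrightarrow> 0) at_top"
              using C by real_asymp
            then show ?thesis
              by (simp add: c_def)
          qed
        qed
        then show ?thesis
          using 3 by simp
      qed
    qed
  qed measurable
  then have lim: "((\<lambda>\<rho>. \<integral>v. m (\<rho> * (v - 1)) * H (\<rho> * v) \<partial>lborel) \<longlongrightarrow> 1 / Gamma (1 - \<beta>)) at_top"
    by simp
  have eq: "exp \<rho> * expectation (\<lambda>\<omega>. inverse_profile 1 (\<beta> * ln (S \<omega>) - \<rho>)) / \<rho> =
      (\<integral>v. m (\<rho> * (v - 1)) * H (\<rho> * v) \<partial>lborel)" if "\<rho> > 0" for \<rho>
  proof -
    let ?k = "\<lambda>w. (1 - exp w / 4) * inverse_profile 1 w"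
    have "expectation (\<lambda>\<omega>. inverse_profile 1 (\<beta> * ln (S \<omega>) - \<rho>)) =
        (\<integral>w. ?k w * prob {\<omega> \<in> space M. w \<le> \<beta> * ln (S \<omega>) - \<rho>} \<partial>lborel)"
    proof (rule layer_cake[OF _ has_real_derivative_inverse_profile])
      show "continuous_on UNIV ?k"
        unfolding inverse_profile_def by (intro continuous_intros) auto
      show "integrable lborel ?k"
        using has_bochner_integral_inverse_profile[of 1 0] by (simp add: has_bochner_integral_iff)
    qed (use inverse_profile_at_bot[of 1] in auto)
    also have "\<dots> = (\<integral>w. ?k w * ?P (w + \<rho>) \<partial>lborel)"
      by (simp add: le_diff_eq)
    \<comment> \<open>The substitution w = \<rho> (v - 1) brings out the factor \<rho>, which is the
      logarithm in the asymptotics.\<close>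
    also have "\<dots> = \<bar>\<rho>\<bar> *\<^sub>R (\<integral>v. ?k (- \<rho> + \<rho> * v) * ?P (- \<rho> + \<rho> * v + \<rho>) \<partial>lborel)"
      using that by (subst lborel_integral_real_affine[where c = \<rho> and t = "- \<rho>"]) auto
    finally have "exp \<rho> * expectation (\<lambda>\<omega>. inverse_profile 1 (\<beta> * ln (S \<omega>) - \<rho>)) / \<rho> =
        (\<integral>v. exp \<rho> * (?k (- \<rho> + \<rho> * v) * ?P (- \<rho> + \<rho> * v + \<rho>)) \<partial>lborel)"
      using that by simp
    also have "\<dots> = (\<integral>v. m (\<rho> * (v - 1)) * H (\<rho> * v) \<partial>lborel)"
    proof (intro Bochner_Integration.integral_cong refl)
      fix v
      have *: "inverse_profile 1 w = exp w * exp (- exp w / 4)" for w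
        by (simp add: inverse_profile_def flip: exp_add)
      define u where "u = \<rho> * (v - 1)"
      have eq: "- \<rho> + \<rho> * v = u" "u + \<rho> = \<rho> * v" and e: "exp (\<rho> * v) = exp \<rho> * exp u"
        by (simp_all add: u_def algebra_simps flip: exp_add)
      show "exp \<rho> * (?k (- \<rho> + \<rho> * v) * ?P (- \<rho> + \<rho> * v + \<rho>)) = m (\<rho> * (v - 1)) * H (\<rho> * v)"
        unfolding u_def[symmetric] * m_def H_def eq e by (simp only: mult_ac)
    qed
    finally show ?thesis .
  qed
  have "filterlim (\<lambda>q::real. - ln q) at_top (at_right 0)"
    by real_asymp
  from filterlim_compose[OF lim this]
  have "((\<lambda>q. \<integral>v. m (- ln q * (v - 1)) * H (- ln q * v) \<partial>lborel) \<longlongrightarrow> 1 / Gamma (1 - \<beta>)) (at_right 0)" .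
  moreover have "\<forall>\<^sub>F q::real in at_right 0. q \<in> {0<..<1}"
    by (rule eventually_at_right_real) simp
  then have "\<forall>\<^sub>F q in at_right 0. (\<integral>v. m (- ln q * (v - 1)) * H (- ln q * v) \<partial>lborel) =
      expectation (\<lambda>\<omega>. S \<omega> powr \<beta> * exp (- q * S \<omega> powr \<beta> / 4)) / (- ln q)"
  proof eventually_elim
    case (elim q)
    then have "ln q < 0"
      by simp
    then show ?case
      using elim eq[of "- ln q"] inverse_kernel_eq[of q 1] by (simp add: exp_minus powr_minus)
  qed
  ultimately show ?thesis
    by (rule Lim_transform_eventually)
qed

end

section \<open>Asymptotics governed by large negative moments\<close>

text \<open>A bound that is quadratic near 0 and linear at infinity, used as a majorant in Laplace's
  method for both signs of u. For u = -z < 0 it is equivalent to (2 - z) e^z <= 2 + z.\<close>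

lemma exp_minus_linear_ge:
  fixes u :: real
  shows "u\<^sup>2 / (2 + \<bar>u\<bar>) \<le> exp u - 1 - u"
proof (cases "u \<ge> 0")
  case True
  have "u\<^sup>2 / (2 + \<bar>u\<bar>) \<le> u\<^sup>2 / 2"
    by (intro divide_left_mono) auto
  then show ?thesis
    using exp_lower_Taylor_quadratic[OF True] by linarith
next
  case False
  define z where "z = - u"
  have z: "z > 0"
    using False by (simp add: z_def)
  have "2 + 0 - exp 0 * (2 - 0) \<le> 2 + z - exp z * (2 - z)"
  proof (rule DERIV_nonneg_imp_nondecreasing[of 0 z "\<lambda>z. 2 + z - exp z * (2 - z)"])
    fix x :: real
    have "((\<lambda>z. 2 + z - exp z * (2 - z)) has_real_derivative 1 - exp x * (1 - x)) (at x)"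
      by (auto intro!: derivative_eq_intros simp: algebra_simps)
    moreover have "exp x * (1 - x) \<le> exp x * exp (- x)"
      using exp_ge_add_one_self[of "- x"] by (intro mult_left_mono) auto
    then have "0 \<le> 1 - exp x * (1 - x)"
      by (simp flip: exp_add)
    ultimately show "\<exists>y. ((\<lambda>z. 2 + z - exp z * (2 - z)) has_real_derivative y) (at x) \<and> 0 \<le> y"
      by blast
  qed (use z in simp)
  then have "exp (- z) * (exp z * (2 - z)) \<le> exp (- z) * (2 + z)"
    by (intro mult_left_mono) auto
  then have "(exp (- z) * exp z) * (2 - z) \<le> exp (- z) * (2 + z)"
    by (simp only: mult.assoc)
  then have *: "2 - z \<le> exp (- z) * (2 + z)"
    by (simp flip: exp_add)
  have "u = - z" "\<bar>u\<bar> = z"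
    using z by (auto simp: z_def)
  moreover have "z\<^sup>2 / (2 + z) \<le> exp (- z) - 1 + z"
  proof (subst pos_divide_le_eq)
    show "z\<^sup>2 \<le> (exp (- z) - 1 + z) * (2 + z)"
      using * by (simp add: algebra_simps power2_eq_square)
  qed (use z in simp)
  ultimately show ?thesis
    by simp
qed

lemma has_bochner_integral_exp_neg_square_half:
  "has_bochner_integral lborel (\<lambda>x. exp (- x\<^sup>2 / 2)) (sqrt (2 * pi))"
proof -
  have "has_bochner_integral lborel (\<lambda>x. sqrt (2 * pi) * std_normal_density x) (sqrt (2 * pi) * 1)"
    by (intro has_bochner_integral_mult_right) (simp add: has_bochner_integral_iff)
  then show ?thesis
    by (simp add: std_normal_density_def)
qed

text \<open>
  Laplace's method, in the variable \<open>w = ln x + v / sqrt x\<close> centred at the maximum of the integrand.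
\<close>

lemma Stirling_real: "((\<lambda>x::real. Gamma x * sqrt x * exp x / x powr x) \<longlongrightarrow> sqrt (2 * pi)) at_top"
proof -
  have "((\<lambda>x::real. \<integral>v. exp (- (x * (exp (v / sqrt x) - 1 - v / sqrt x))) \<partial>lborel) \<longlongrightarrow> (\<integral>v. exp (- v\<^sup>2 / 2) \<partial>lborel)) at_top"
  proof (rule integral_dominated_convergence_at_top)
    show "integrable lborel (\<lambda>v::real. exp 2 * exp (- \<bar>v\<bar>))"
      using integrable_exp_neg_abs by simp
    show "AE v in lborel. ((\<lambda>x. exp (- (x * (exp (v / sqrt x) - 1 - v / sqrt x)))) \<longlongrightarrow> exp (- v\<^sup>2 / 2)) at_top"
    proof (intro AE_I2 tendsto_exp)
      fix v :: real
      show "((\<lambda>x. - (x * (exp (v / sqrt x) - 1 - v / sqrt x))) \<longlongrightarrow> - v\<^sup>2 / 2) at_top"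
        by (cases v "0::real" rule: linorder_cases) (real_asymp simp: power2_eq_square)+
    qed
    show "\<forall>\<^sub>F x in at_top. AE v in lborel. norm (exp (- (x * (exp (v / sqrt x) - 1 - v / sqrt x)))) \<le> exp 2 * exp (- \<bar>v\<bar>)"
      using eventually_ge_at_top[of 1]
    proof eventually_elim
      case (elim x)
      show ?case
      proof (intro AE_I2)
        fix v :: real
        \<comment> \<open>This is v^2 - 4 <= v^2. Since x >= 1, replacing |v| by |v| / sqrt x in the
          denominator only enlarges the quotient and brings it to the form of the convexity
          bound.\<close>
        have "\<bar>v\<bar> - 2 \<le> v\<^sup>2 / (2 + \<bar>v\<bar>)"
          by (simp add: field_simps power2_eq_square abs_mult_self_eq)
        also have "\<dots> \<le> v\<^sup>2 / (2 + \<bar>v\<bar> / sqrt x)"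
          using elim by (intro divide_left_mono add_left_mono mult_pos_pos) (auto simp: divide_le_eq mult_left_le add_pos_nonneg mult_le_cancel_left1)
        also have "\<dots> = x * ((v / sqrt x)\<^sup>2 / (2 + \<bar>v / sqrt x\<bar>))"
          using elim by (simp add: power_divide abs_divide)
        also have "\<dots> \<le> x * (exp (v / sqrt x) - 1 - v / sqrt x)"
          using elim by (intro mult_left_mono exp_minus_linear_ge) auto
        finally show "norm (exp (- (x * (exp (v / sqrt x) - 1 - v / sqrt x)))) \<le> exp 2 * exp (- \<bar>v\<bar>)"
          by (simp flip: exp_add)
      qed
    qed
  qed auto
  moreover have "\<forall>\<^sub>F x::real in at_top. (\<integral>v. exp (- (x * (exp (v / sqrt x) - 1 - v / sqrt x))) \<partial>lborel) = Gamma x * sqrt x * exp x / x powr x"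
    using eventually_gt_at_top[of 0]
  proof eventually_elim
    case (elim x)
    define I where "I = (\<integral>v. exp (- (x * (exp (v / sqrt x) - 1 - v / sqrt x))) \<partial>lborel)"
    have "Gamma x = (\<integral>w. exp (x * w - exp w) \<partial>lborel)"
      using has_bochner_integral_Gamma_exp[OF elim] by (simp add: has_bochner_integral_iff)
    also have "\<dots> = \<bar>1 / sqrt x\<bar> *\<^sub>R (\<integral>v. exp (x * (ln x + 1 / sqrt x * v) - exp (ln x + 1 / sqrt x * v)) \<partial>lborel)"
      using elim by (intro lborel_integral_real_affine) auto
    also have "(\<integral>v. exp (x * (ln x + 1 / sqrt x * v) - exp (ln x + 1 / sqrt x * v)) \<partial>lborel) =
        (\<integral>v. x powr x * exp (- x) * exp (- (x * (exp (v / sqrt x) - 1 - v / sqrt x))) \<partial>lborel)"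
    proof (intro Bochner_Integration.integral_cong refl)
      fix v
      have "exp (ln x + 1 / sqrt x * v) = x * exp (v / sqrt x)"
        using elim by (simp add: exp_add)
      then show "exp (x * (ln x + 1 / sqrt x * v) - exp (ln x + 1 / sqrt x * v)) =
          x powr x * exp (- x) * exp (- (x * (exp (v / sqrt x) - 1 - v / sqrt x)))"
        using elim by (simp add: powr_def algebra_simps flip: exp_add)
    qed
    also have "\<dots> = x powr x * exp (- x) * I"
      unfolding I_def by simp
    finally show ?case
      unfolding I_def[symmetric] using elim by (simp add: exp_minus field_simps)
  qed
  ultimately show ?thesis
    using has_bochner_integral_exp_neg_square_half
    by (auto simp: has_bochner_integral_iff intro: Lim_transform_eventually)
qed

section \<open>Gaussian integrals and second-order expansions\<close>

lemma has_bochner_integral_exp_normal_density: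
  assumes "\<sigma> > 0"
  shows "has_bochner_integral lborel (\<lambda>x. normal_density 0 \<sigma> x * exp (r * x)) (exp (\<sigma>\<^sup>2 * r\<^sup>2 / 2))"
proof -
  have "has_bochner_integral lborel (\<lambda>x. exp (\<sigma>\<^sup>2 * r\<^sup>2 / 2) * normal_density (\<sigma>\<^sup>2 * r) \<sigma> x) (exp (\<sigma>\<^sup>2 * r\<^sup>2 / 2) * 1)"
    using assms by (intro has_bochner_integral_mult_right) (simp add: has_bochner_integral_iff)
  moreover have "exp (\<sigma>\<^sup>2 * r\<^sup>2 / 2) * normal_density (\<sigma>\<^sup>2 * r) \<sigma> x = normal_density 0 \<sigma> x * exp (r * x)" for x
  proof -
    have "\<sigma>\<^sup>2 * r\<^sup>2 / 2 + - (x - \<sigma>\<^sup>2 * r)\<^sup>2 / (2 * \<sigma>\<^sup>2) = - (x - 0)\<^sup>2 / (2 * \<sigma>\<^sup>2) + r * x"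
      using assms by (simp add: field_simps power2_eq_square)
    from arg_cong[OF this, of exp] show ?thesis
      unfolding normal_density_def exp_add by (simp add: mult_ac)
  qed
  ultimately show ?thesis
    by simp
qed

text \<open>The product of the two Gaussians is s / \<sigma> times the centred normal density with 1
  / s^2 = 1 / \<sigma>^2 + 1. At \<sigma>^2 = 1 - \<beta> the value is 1 / sqrt(2 -
  \<beta>).\<close>

lemma has_bochner_integral_exp_square_normal_density:
  assumes "\<sigma> > 0"
  shows "has_bochner_integral lborel (\<lambda>x. normal_density 0 \<sigma> x * exp (- x\<^sup>2 / 2)) (1 / sqrt (1 + \<sigma>\<^sup>2))"
proof -
  define s where "s = \<sigma> / sqrt (1 + \<sigma>\<^sup>2)"
  have [simp]: "1 + \<sigma>\<^sup>2 \<noteq> 0"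
    by (smt (verit) zero_le_power2)
  have s: "s > 0" "s\<^sup>2 = \<sigma>\<^sup>2 / (1 + \<sigma>\<^sup>2)"
    using assms by (auto simp: s_def power_divide add_pos_nonneg)
  have "has_bochner_integral lborel (\<lambda>x. 1 / sqrt (1 + \<sigma>\<^sup>2) * normal_density 0 s x) (1 / sqrt (1 + \<sigma>\<^sup>2) * 1)"
    using s by (intro has_bochner_integral_mult_right) (simp add: has_bochner_integral_iff)
  moreover have "1 / sqrt (1 + \<sigma>\<^sup>2) * normal_density 0 s x = normal_density 0 \<sigma> x * exp (- x\<^sup>2 / 2)" for x
  proof -
    have "- x\<^sup>2 / (2 * s\<^sup>2) = - x\<^sup>2 / (2 * \<sigma>\<^sup>2) + - x\<^sup>2 / 2"
    proof -
      have "1 / (2 * s\<^sup>2) = 1 / (2 * \<sigma>\<^sup>2) + 1 / 2"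
        unfolding s(2) using assms by (simp add: divide_simps)
      then have "- x\<^sup>2 * (1 / (2 * s\<^sup>2)) = - x\<^sup>2 * (1 / (2 * \<sigma>\<^sup>2) + 1 / 2)"
        by (simp only:)
      then show ?thesis
        by (simp only: distrib_left times_divide_eq_right mult_1_right)
    qed
    moreover have "1 / sqrt (1 + \<sigma>\<^sup>2) * (1 / sqrt (2 * pi * s\<^sup>2)) = 1 / sqrt (2 * pi * \<sigma>\<^sup>2)"
      unfolding s(2) using assms by (simp add: real_sqrt_mult real_sqrt_divide field_simps)
    ultimately show ?thesis
      unfolding normal_density_def by (simp only: diff_zero exp_add mult.assoc[symmetric])
  qed
  ultimately show ?thesis
    by simp
qed

text \<open>Since Y varies with k, the expansion is needed along a moving argument: the quotient
  (e^u - 1 - u) / u^2 is extended continuously by 1/2 at u = 0, which also covers Y k = 0.\<close>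

lemma tendsto_exp_second_order:
  fixes Y p :: "nat \<Rightarrow> real"
  assumes Y: "Y \<longlonglongrightarrow> y" and p: "filterlim p at_top sequentially"
  shows "(\<lambda>k. p k * (exp (- (Y k / sqrt (p k))) - 1 + Y k / sqrt (p k))) \<longlonglongrightarrow> y\<^sup>2 / 2"
proof -
  define \<phi> where "\<phi> u = (if u = 0 then 1 / 2 else (exp u - 1 - u) / u\<^sup>2)" for u :: real
  have "((\<lambda>u::real. (exp u - 1 - u) / u\<^sup>2) \<longlongrightarrow> 1 / 2) (at 0)"
    by real_asymp
  then have "(\<phi> \<longlongrightarrow> 1 / 2) (at 0)"
    by (rule Lim_transform_eventually) (auto simp: \<phi>_def eventually_at_filter)
  then have "isCont \<phi> 0"
    by (simp add: isCont_def \<phi>_def)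
  moreover have "(\<lambda>k. - (Y k * (1 / sqrt (p k)))) \<longlonglongrightarrow> - (y * 0)"
  proof (intro tendsto_intros Y)
    have "((\<lambda>x::real. 1 / sqrt x) \<longlongrightarrow> 0) at_top"
      by real_asymp
    then show "(\<lambda>k. 1 / sqrt (p k)) \<longlonglongrightarrow> 0"
      using p by (rule filterlim_compose)
  qed
  ultimately have "(\<lambda>k. \<phi> (- (Y k * (1 / sqrt (p k))))) \<longlonglongrightarrow> \<phi> 0"
    using isCont_tendsto_compose by fastforce
  then have "(\<lambda>k. (Y k)\<^sup>2 * \<phi> (- (Y k * (1 / sqrt (p k))))) \<longlonglongrightarrow> y\<^sup>2 * \<phi> 0"
    by (intro tendsto_intros Y)
  then have "(\<lambda>k. (Y k)\<^sup>2 * \<phi> (- (Y k * (1 / sqrt (p k))))) \<longlonglongrightarrow> y\<^sup>2 / 2"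
    by (simp add: \<phi>_def)
  moreover have "\<forall>\<^sub>F k in sequentially. p k > 0"
    using p by (simp add: filterlim_at_top_dense)
  then have "\<forall>\<^sub>F k in sequentially. (Y k)\<^sup>2 * \<phi> (- (Y k * (1 / sqrt (p k)))) =
      p k * (exp (- (Y k / sqrt (p k))) - 1 + Y k / sqrt (p k))"
  proof eventually_elim
    case (elim k)
    then show ?case
      by (auto simp: \<phi>_def power_divide)
  qed
  ultimately show ?thesis
    by (rule Lim_transform_eventually)
qed

text \<open>Second-order Taylor expansion of x ln x - x at p: slope ln p, second derivative 1 / p,
  and an increment r sqrt p whose size makes the quadratic term constant.\<close>

lemma central_limit_entropy:
  "((\<lambda>p::real. (p + r * sqrt p) * ln (p + r * sqrt p) - (p + r * sqrt p) - (p * ln p - p) - r * sqrt p * ln p)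
     \<longlongrightarrow> r\<^sup>2 / 2) at_top"
proof (cases "r = 0")
  case False
  then show ?thesis
    by (cases "r > 0") (real_asymp simp: power2_eq_square)+
qed simp

context stable_variable
begin

text \<open>
  By Stirling's formula \<open>centre p\<close> is the leading term of the derivative of \<open>ln R\<close> at \<open>p\<close>, that is, of
  the mean of \<open>- \<beta> * ln S\<close> under the law tilted by \<open>S powr (- (\<beta> * p))\<close>.
\<close>

definition R :: "real \<Rightarrow> real" where
  "R p = Gamma (1 + p) / Gamma (1 + p * \<beta>)"

definition centre :: "real \<Rightarrow> real" where
  "centre p = (1 - \<beta>) * ln p - \<beta> * ln \<beta>"

text \<open>The scale \<open>sqrt p\<close> is that of the fluctuations: \<open>ln (R p)\<close> is
  the cumulant function of -\<beta> ln S, and its second derivative, the variance under the tilt, is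
  about (1 - \<beta>) / p.\<close>

definition tilted_law :: "real \<Rightarrow> real measure" where
  "tilted_law p = distr (density M (\<lambda>\<omega>. ennreal (S \<omega> powr (- (\<beta> * p)) / R p))) borel
     (\<lambda>\<omega>. sqrt p * (- \<beta> * ln (S \<omega>) - centre p))"

lemma R_pos: "p > 0 \<Longrightarrow> R p > 0"
  using \<beta> by (simp add: R_def Gamma_real_pos add_pos_pos)

lemma has_bochner_integral_R:
  "p > 0 \<Longrightarrow> has_bochner_integral M (\<lambda>\<omega>. S \<omega> powr (- (\<beta> * p))) (R p)"
  using has_bochner_integral_neg_moment[of "\<beta> * p"] \<beta> by (simp add: R_def mult.commute)

text \<open>Stirling's formula for both Gamma values: the exponential parts combine into the stated
  exponent, and sqrt p / sqrt(p \<beta>) leaves 1 / sqrt \<beta>.\<close>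

lemma R_asymptotic:
  "((\<lambda>p. R p / exp ((1 - \<beta>) * (p * ln p - p) - p * \<beta> * ln \<beta>)) \<longlongrightarrow> 1 / sqrt \<beta>) at_top"
proof -
  define G where "G x = Gamma x * sqrt x * exp x / x powr x" for x :: real
  have G: "(G \<longlongrightarrow> sqrt (2 * pi)) at_top"
    unfolding G_def by (rule Stirling_real)
  have "filterlim (\<lambda>p. p * \<beta>) at_top at_top"
    using \<beta> by real_asymp
  with G have "((\<lambda>p. G (p * \<beta>)) \<longlongrightarrow> sqrt (2 * pi)) at_top"
    by (rule filterlim_compose)
  then have "((\<lambda>p. 1 / sqrt \<beta> * (G p / G (p * \<beta>))) \<longlongrightarrow> 1 / sqrt \<beta> * (sqrt (2 * pi) / sqrt (2 * pi))) at_top"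
    by (intro tendsto_intros G) auto
  moreover have "\<forall>\<^sub>F p in at_top. 1 / sqrt \<beta> * (G p / G (p * \<beta>)) =
      R p / exp ((1 - \<beta>) * (p * ln p - p) - p * \<beta> * ln \<beta>)"
    using eventually_gt_at_top[of 0]
  proof eventually_elim
    case (elim p)
    have Gam: "Gamma (1 + x) = G x * sqrt x * exp (x * ln x - x)" if "x > 0" for x
    proof -
      have "Gamma (1 + x) = (sqrt x * sqrt x) * Gamma x"
        using Gamma_real_plus1[OF that] that by (simp add: add.commute)
      then show ?thesis
        using that by (simp add: G_def powr_def exp_diff)
    qed
    have "G (p * \<beta>) > 0"
      using elim \<beta> by (simp add: G_def Gamma_real_pos)
    have e: "exp (p * ln p - p) = exp (p * \<beta> * ln (p * \<beta>) - p * \<beta>) * exp ((1 - \<beta>) * (p * ln p - p) - p * \<beta> * ln \<beta>)"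
      using elim \<beta> by (simp add: ln_mult algebra_simps flip: exp_add)
    have "R p = (G p * sqrt p * exp (p * ln p - p)) / (G (p * \<beta>) * sqrt (p * \<beta>) * exp (p * \<beta> * ln (p * \<beta>) - p * \<beta>))"
      unfolding R_def using elim \<beta> by (simp add: Gam)
    then show ?case
      unfolding e using elim \<beta> \<open>G (p * \<beta>) > 0\<close> by (simp add: real_sqrt_mult)
  qed
  ultimately show ?thesis
    by (auto intro: Lim_transform_eventually)
qed

text \<open>The left side is the moment generating function of the tilted law at \<open>r\<close>.
  In the ratio the prefactor 1 / sqrt \<beta> cancels, \<open>centre\<close> removes the first-order
  term, and 1 - \<beta> times the entropy expansion remains.\<close>

lemma R_ratio_tendsto:
  "((\<lambda>p. R (p + r * sqrt p) / R p * exp (- r * sqrt p * centre p)) \<longlongrightarrow> exp ((1 - \<beta>) * r\<^sup>2 / 2)) at_top"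
proof -
  define l where "l p = (1 - \<beta>) * (p * ln p - p) - p * \<beta> * ln \<beta>" for p
  define A where "A p = R p / exp (l p)" for p
  have A: "(A \<longlongrightarrow> 1 / sqrt \<beta>) at_top"
    unfolding A_def l_def by (rule R_asymptotic)
  have "filterlim (\<lambda>p. p + r * sqrt p) at_top at_top"
    by (cases r "0::real" rule: linorder_cases) real_asymp+
  with A have A': "((\<lambda>p. A (p + r * sqrt p)) \<longlongrightarrow> 1 / sqrt \<beta>) at_top"
    by (rule filterlim_compose)
  have "((\<lambda>p. A (p + r * sqrt p) / A p * exp ((1 - \<beta>) * ((p + r * sqrt p) * ln (p + r * sqrt p) - (p + r * sqrt p) - (p * ln p - p) - r * sqrt p * ln p)))
      \<longlongrightarrow> (1 / sqrt \<beta>) / (1 / sqrt \<beta>) * exp ((1 - \<beta>) * (r\<^sup>2 / 2))) at_top"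
    by (intro tendsto_intros A A' central_limit_entropy) (use \<beta> in auto)
  moreover have "A (p + r * sqrt p) / A p * exp ((1 - \<beta>) * ((p + r * sqrt p) * ln (p + r * sqrt p) - (p + r * sqrt p) - (p * ln p - p) - r * sqrt p * ln p)) =
      R (p + r * sqrt p) / R p * exp (- r * sqrt p * centre p)" for p
  proof -
    have "(1 - \<beta>) * ((p + r * sqrt p) * ln (p + r * sqrt p) - (p + r * sqrt p) - (p * ln p - p) - r * sqrt p * ln p)
        = l (p + r * sqrt p) - l p + (- r * sqrt p * centre p)"
      by (simp add: l_def centre_def algebra_simps)
    then have "exp ((1 - \<beta>) * ((p + r * sqrt p) * ln (p + r * sqrt p) - (p + r * sqrt p) - (p * ln p - p) - r * sqrt p * ln p))
        = exp (l (p + r * sqrt p)) / exp (l p) * exp (- r * sqrt p * centre p)"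
      by (simp only: exp_add exp_diff)
    then show ?thesis
      by (simp add: A_def)
  qed
  ultimately show ?thesis
    using \<beta> by simp
qed

lemma
  assumes p: "p > 0"
  shows prob_space_tilt: "prob_space (density M (\<lambda>\<omega>. ennreal (S \<omega> powr (- (\<beta> * p)) / R p)))"
    and real_distribution_tilted_law: "real_distribution (tilted_law p)"
proof -
  show tilt: "prob_space (density M (\<lambda>\<omega>. ennreal (S \<omega> powr (- (\<beta> * p)) / R p)))"
  proof (rule prob_spaceI)
    have "has_bochner_integral M (\<lambda>\<omega>. S \<omega> powr (- (\<beta> * p)) / R p) (R p / R p)"
      by (intro has_bochner_integral_divide has_bochner_integral_R p)
    then have "integrable M (\<lambda>\<omega>. S \<omega> powr (- (\<beta> * p)) / R p)"
        "expectation (\<lambda>\<omega>. S \<omega> powr (- (\<beta> * p)) / R p) = 1"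
      using R_pos[OF p] by (auto simp only: has_bochner_integral_iff) simp
    then have "(\<integral>\<^sup>+\<omega>. ennreal (S \<omega> powr (- (\<beta> * p)) / R p) \<partial>M) = 1"
      using R_pos[OF p] by (subst nn_integral_eq_integral) auto
    then show "emeasure (density M (\<lambda>\<omega>. ennreal (S \<omega> powr (- (\<beta> * p)) / R p))) (space (density M (\<lambda>\<omega>. ennreal (S \<omega> powr (- (\<beta> * p)) / R p)))) = 1"
      by (simp add: emeasure_density cong: nn_integral_cong)
  qed
  show "real_distribution (tilted_law p)"
    unfolding tilted_law_def by (rule prob_space.real_distribution_distr[OF tilt]) simp
qed

lemma integral_tilted_law:
  fixes f :: "real \<Rightarrow> real"
  assumes p: "p > 0" and [measurable]: "f \<in> borel_measurable borel"
  shows "integrable (tilted_law p) f \<longleftrightarrow>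
      integrable M (\<lambda>\<omega>. S \<omega> powr (- (\<beta> * p)) / R p * f (sqrt p * (- \<beta> * ln (S \<omega>) - centre p)))"
    and "(\<integral>x. f x \<partial>tilted_law p) =
      expectation (\<lambda>\<omega>. S \<omega> powr (- (\<beta> * p)) / R p * f (sqrt p * (- \<beta> * ln (S \<omega>) - centre p)))"
  using R_pos[OF p] unfolding tilted_law_def
  by (simp_all add: integrable_distr_eq integral_distr integrable_density integral_density)

text \<open>Multiplying the weight by exp(-r sqrt p \<beta> ln S) moves the order of the negative
  moment from \<beta> p to \<beta> (p + r sqrt p); p > 1 and |r| < 1 keep it positive.\<close>

lemma mgf_tilted_law:
  assumes p: "p > 1" and r: "\<bar>r\<bar> < 1"
  shows "has_bochner_integral (tilted_law p) (\<lambda>x. exp (r * x)) (R (p + r * sqrt p) / R p * exp (- r * sqrt p * centre p))"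
proof -
  have "\<bar>r * sqrt p\<bar> < 1 * p"
    unfolding abs_mult using p r by (intro mult_less_le_imp_less) (auto intro!: real_le_lsqrt simp: power2_eq_square)
  then have pos: "p + r * sqrt p > 0"
    by linarith
  have "has_bochner_integral M (\<lambda>\<omega>. S \<omega> powr (- (\<beta> * (p + r * sqrt p))) * (exp (- r * sqrt p * centre p) / R p))
      (R (p + r * sqrt p) * (exp (- r * sqrt p * centre p) / R p))"
    by (intro has_bochner_integral_mult_left has_bochner_integral_R pos)
  then have "has_bochner_integral M (\<lambda>\<omega>. S \<omega> powr (- (\<beta> * p)) / R p * exp (r * (sqrt p * (- \<beta> * ln (S \<omega>) - centre p))))
      (R (p + r * sqrt p) * (exp (- r * sqrt p * centre p) / R p))"
  proof (rule has_bochner_integral_AE_eq)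
    show "AE \<omega> in M. S \<omega> powr (- (\<beta> * (p + r * sqrt p))) * (exp (- r * sqrt p * centre p) / R p) =
        S \<omega> powr (- (\<beta> * p)) / R p * exp (r * (sqrt p * (- \<beta> * ln (S \<omega>) - centre p)))"
      using S_pos
    proof eventually_elim
      case (elim \<omega>)
      then have "S \<omega> powr (- (\<beta> * (p + r * sqrt p))) * exp (- r * sqrt p * centre p) =
          S \<omega> powr (- (\<beta> * p)) * exp (r * (sqrt p * (- \<beta> * ln (S \<omega>) - centre p)))"
        by (simp add: powr_def algebra_simps flip: exp_add)
      then show ?case
        by simp
    qed
  qed measurable
  then show ?thesis
    using p integral_tilted_law[of p "\<lambda>x. exp (r * x)"] by (simp add: has_bochner_integral_iff)
qed

lemma weak_conv_m_tilted_law: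
  assumes X: "filterlim X at_top sequentially" "\<And>k. X k > 1"
  shows "weak_conv_m (\<lambda>k. tilted_law (X k)) (density lborel (\<lambda>x. ennreal (normal_density 0 (sqrt (1 - \<beta>)) x)))"
proof (rule weak_conv_m_if_mgf_tendsto[where b = 1])
  let ?N = "density lborel (\<lambda>x. ennreal (normal_density 0 (sqrt (1 - \<beta>)) x))"
  show "real_distribution (tilted_law (X k))" for k
    using X(2)[of k] by (intro real_distribution_tilted_law) simp
  show "real_distribution ?N"
    using \<beta> by (intro real_distribution_density) (auto simp: has_bochner_integral_iff)
  fix r :: real assume r: "\<bar>r\<bar> < 1"
  note mgf = mgf_tilted_law[OF X(2) r]
  note mgf_normal = has_bochner_integral_exp_normal_density[of "sqrt (1 - \<beta>)" r]
  show "integrable (tilted_law (X k)) (\<lambda>x. exp (r * x))" for k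
    using mgf by (simp add: has_bochner_integral_iff)
  show "integrable ?N (\<lambda>x. exp (r * x))"
    using mgf_normal \<beta> by (subst integrable_density) (auto simp: has_bochner_integral_iff)
  have "(\<integral>x. exp (r * x) \<partial>?N) = exp ((1 - \<beta>) * r\<^sup>2 / 2)"
    using mgf_normal \<beta> by (subst integral_density) (auto simp: has_bochner_integral_iff)
  then show "(\<lambda>k. \<integral>x. exp (r * x) \<partial>tilted_law (X k)) \<longlonglongrightarrow> (\<integral>x. exp (r * x) \<partial>?N)"
    using filterlim_compose[OF R_ratio_tendsto X(1), of r] mgf by (simp add: has_bochner_integral_iff)
qed simp

text \<open>The integrand of (d) after division by the tilting weight and by its value at the
  centre, in the variable z with -\<beta> ln S = centre p + z / sqrt p. The part multiplied by p
  vanishes to second order at z = 0; this is the effect of q = 4 p exp(centre p).\<close>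

definition tilted_integrand :: "real \<Rightarrow> real \<Rightarrow> real \<Rightarrow> real" where
  "tilted_integrand a p z = exp (- (a * z / sqrt p) - p * (exp (- (z / sqrt p)) - 1 + z / sqrt p))"

lemma inverse_kernel_tilted:
  assumes p: "p > 0"
  shows "inverse_kernel_integral a (4 * p * exp (centre p)) =
    R p * exp (- (a + p) * centre p - p) *
      (\<integral>z. tilted_integrand a p z \<partial>tilted_law p)"
proof -
  define c where "c = centre p"
  have "(\<integral>z. tilted_integrand a p z \<partial>tilted_law p) =
      expectation (\<lambda>\<omega>. S \<omega> powr (- (\<beta> * p)) / R p * exp (- (a * (- \<beta> * ln (S \<omega>) - c))
        - p * (exp (- (- \<beta> * ln (S \<omega>) - c)) - 1 + (- \<beta> * ln (S \<omega>) - c))))"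
    unfolding c_def tilted_integrand_def using p by (subst integral_tilted_law(2)) auto
  also have "\<dots> = expectation (\<lambda>\<omega>. exp ((a + p) * c + p) / R p * (S \<omega> powr (\<beta> * a) * exp (- (4 * p * exp c) * S \<omega> powr \<beta> / 4)))"
  proof (rule integral_cong_AE)
    show "AE \<omega> in M. S \<omega> powr (- (\<beta> * p)) / R p * exp (- (a * (- \<beta> * ln (S \<omega>) - c))
        - p * (exp (- (- \<beta> * ln (S \<omega>) - c)) - 1 + (- \<beta> * ln (S \<omega>) - c))) =
        exp ((a + p) * c + p) / R p * (S \<omega> powr (\<beta> * a) * exp (- (4 * p * exp c) * S \<omega> powr \<beta> / 4))"
      using S_pos
    proof eventually_elim
      case (elim \<omega>)
      define y where "y = \<beta> * ln (S \<omega>)"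
      have S: "S \<omega> powr (- (\<beta> * p)) = exp (- (p * y))" "S \<omega> powr (\<beta> * a) = exp (a * y)" "S \<omega> powr \<beta> = exp y"
        using elim by (simp_all add: y_def powr_def mult_ac)
      have "exp (- (p * y)) * exp (- (a * (- y - c)) - p * (exp (y + c) - 1 + (- y - c))) =
          exp ((a + p) * c + p) * (exp (a * y) * exp (- (p * exp (y + c))))"
        by (simp add: algebra_simps flip: exp_add)
      then show ?case
        unfolding S using elim by (simp add: y_def[symmetric] exp_add add.commute mult_ac)
    qed
  qed auto
  also have "\<dots> = exp ((a + p) * c + p) / R p * inverse_kernel_integral a (4 * p * exp c)"
    by (rule integral_mult_right_zero)
  finally show ?thesis
    unfolding c_def[symmetric] using R_pos[OF p] by (simp add: exp_diff exp_add exp_minus field_simps)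
qed

text \<open>The integrand varies with k along with the law, so weak convergence against a fixed test
  function does not apply directly; Skorokhod's representation gives pointwise convergent copies and
  leaves a dominated convergence.\<close>

lemma tilted_expectation_tendsto_sequentially:
  assumes "a > 0" and X: "filterlim X at_top sequentially" "\<And>k. X k > 1"
  shows "(\<lambda>k. \<integral>z. tilted_integrand a (X k) z \<partial>tilted_law (X k))
    \<longlonglongrightarrow> 1 / sqrt (2 - \<beta>)"
proof -
  let ?N = "density lborel (\<lambda>x. ennreal (normal_density 0 (sqrt (1 - \<beta>)) x))"
  have [measurable]: "tilted_integrand a p \<in> borel_measurable borel" for p
    unfolding tilted_integrand_def by measurable
  have tilted: "real_distribution (tilted_law (X k))" for k
    using X(2)[of k] by (intro real_distribution_tilted_law) simp
  have normal: "real_distribution ?N"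
    using \<beta> by (intro real_distribution_density) (auto simp: has_bochner_integral_iff)
  obtain \<Omega> :: "real measure" and Y Y'
    where "prob_space \<Omega>" and Y [measurable]: "\<And>k. Y k \<in> measurable \<Omega> borel" "Y' \<in> measurable \<Omega> lborel"
      and distr: "\<And>k. distr \<Omega> borel (Y k) = tilted_law (X k)" "distr \<Omega> borel Y' = ?N"
      and lim: "\<And>x. x \<in> space \<Omega> \<Longrightarrow> (\<lambda>k. Y k x) \<longlonglongrightarrow> Y' x"
    using Skorohod[OF tilted normal weak_conv_m_tilted_law[OF X]] by blast
  interpret \<Omega>: prob_space \<Omega>
    by fact
  have Y' [measurable]: "Y' \<in> borel_measurable \<Omega>"
    using Y(2) by simp
  \<comment> \<open>For v >= 0 neither term of the exponent is positive. For v < 0 the linear term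
    is, and completing the square in -a v - v^2 / 2 leaves a^2 / 2, independent of p >= 1.\<close>
  have tilted_integrand_le: "tilted_integrand a p z \<le> exp (a\<^sup>2 / 2)" if "p \<ge> 1" for p z
  proof -
    define v where "v = z / sqrt p"
    have "- (a * v) - p * (exp (- v) - 1 + v) \<le> a\<^sup>2 / 2"
    proof (cases "v \<ge> 0")
      case True
      have "0 \<le> exp (- v) - 1 + v"
        using exp_ge_add_one_self[of "- v"] by linarith
      then have "0 \<le> p * (exp (- v) - 1 + v)" "0 \<le> a * v" "0 \<le> a\<^sup>2 / 2"
        using that True \<open>a > 0\<close> by simp_all
      then show ?thesis
        by linarith
    next
      case False
      have "v\<^sup>2 / 2 \<le> exp (- v) - 1 + v"
        using exp_lower_Taylor_quadratic[of "- v"] False by simp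
      also have "\<dots> = 1 * (exp (- v) - 1 + v)"
        by simp
      also have "\<dots> \<le> p * (exp (- v) - 1 + v)"
        using that exp_ge_add_one_self[of "- v"] by (intro mult_right_mono) auto
      finally have "- (a * v) - p * (exp (- v) - 1 + v) \<le> - (a * v) - v\<^sup>2 / 2"
        by linarith
      also have "\<dots> = a\<^sup>2 / 2 - (a + v)\<^sup>2 / 2"
        by (simp add: power2_eq_square field_simps)
      finally show ?thesis
        using zero_le_power2[of "a + v"] by linarith
    qed
    then show ?thesis
      by (simp add: tilted_integrand_def v_def)
  qed
  have "(\<lambda>k. \<integral>x. tilted_integrand a (X k) (Y k x) \<partial>\<Omega>) \<longlonglongrightarrow> (\<integral>x. exp (- (Y' x)\<^sup>2 / 2) \<partial>\<Omega>)"
  proof (rule integral_dominated_convergence[where w = "\<lambda>_. exp (a\<^sup>2 / 2)"])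
    show "AE x in \<Omega>. norm (tilted_integrand a (X k) (Y k x)) \<le> exp (a\<^sup>2 / 2)" for k
      using tilted_integrand_le[of "X k"] X(2)[of k] by (auto simp: tilted_integrand_def)
    show "AE x in \<Omega>. (\<lambda>k. tilted_integrand a (X k) (Y k x)) \<longlonglongrightarrow> exp (- (Y' x)\<^sup>2 / 2)"
    proof (intro AE_I2)
      fix x assume x: "x \<in> space \<Omega>"
      have "((\<lambda>p::real. 1 / sqrt p) \<longlongrightarrow> 0) at_top"
        by real_asymp
      from filterlim_compose[OF this X(1)] have "(\<lambda>k. - (a * Y k x * (1 / sqrt (X k))) - X k * (exp (- (Y k x / sqrt (X k))) - 1 + Y k x / sqrt (X k)))
          \<longlonglongrightarrow> - (a * Y' x * 0) - (Y' x)\<^sup>2 / 2"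
        by (intro tendsto_intros tendsto_exp_second_order lim x X(1))
      then have "(\<lambda>k. exp (- (a * Y k x * (1 / sqrt (X k))) - X k * (exp (- (Y k x / sqrt (X k))) - 1 + Y k x / sqrt (X k))))
          \<longlonglongrightarrow> exp (- (a * Y' x * 0) - (Y' x)\<^sup>2 / 2)"
        by (rule tendsto_exp)
      then show "(\<lambda>k. tilted_integrand a (X k) (Y k x)) \<longlonglongrightarrow> exp (- (Y' x)\<^sup>2 / 2)"
        by (simp add: tilted_integrand_def)
    qed
  qed auto
  moreover have "(\<integral>x. tilted_integrand a (X k) (Y k x) \<partial>\<Omega>) = (\<integral>z. tilted_integrand a (X k) z \<partial>tilted_law (X k))" for k
    unfolding distr(1)[symmetric] by (subst integral_distr) auto
  moreover have "(\<integral>x. exp (- (Y' x)\<^sup>2 / 2) \<partial>\<Omega>) = 1 / sqrt (2 - \<beta>)"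
  proof -
    have "(\<integral>x. exp (- (Y' x)\<^sup>2 / 2) \<partial>\<Omega>) = (\<integral>z. exp (- z\<^sup>2 / 2) \<partial>?N)"
      unfolding distr(2)[symmetric] by (subst integral_distr) auto
    also have "\<dots> = 1 / sqrt (2 - \<beta>)"
      using has_bochner_integral_exp_square_normal_density[of "sqrt (1 - \<beta>)"] \<beta>
      by (subst integral_density) (auto simp: has_bochner_integral_iff)
    finally show ?thesis .
  qed
  ultimately show ?thesis
    by (simp add: tilted_integrand_def)
qed

text \<open>The product p * centre p cancels the terms p ln p and p \<beta> ln \<beta> of the
  Stirling exponent; exp(-a * centre p - (2 - \<beta>) p) survives.\<close>

lemma inverse_kernel_centre_tendsto:
  assumes "a > 0"
  shows "((\<lambda>p. inverse_kernel_integral a (4 * p * exp (centre p))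
            * exp (a * centre p) * exp ((2 - \<beta>) * p)) \<longlongrightarrow> 1 / sqrt (\<beta> * (2 - \<beta>))) at_top"
proof -
  define T where "T p = (\<integral>z. tilted_integrand a p z \<partial>tilted_law p)" for p
  have T: "(T \<longlongrightarrow> 1 / sqrt (2 - \<beta>)) at_top"
    unfolding T_def
    by (rule tendsto_at_top_if_sequentially[where c = 1]) (rule tilted_expectation_tendsto_sequentially[OF assms])
  have "((\<lambda>p. R p / exp ((1 - \<beta>) * (p * ln p - p) - p * \<beta> * ln \<beta>) * T p) \<longlongrightarrow> 1 / sqrt \<beta> * (1 / sqrt (2 - \<beta>))) at_top"
    by (intro tendsto_mult R_asymptotic T)
  moreover have "\<forall>\<^sub>F p in at_top. R p / exp ((1 - \<beta>) * (p * ln p - p) - p * \<beta> * ln \<beta>) * T p =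
      inverse_kernel_integral a (4 * p * exp (centre p))
            * exp (a * centre p) * exp ((2 - \<beta>) * p)"
    using eventually_gt_at_top[of 0]
  proof eventually_elim
    case (elim p)
    have "exp (- ((1 - \<beta>) * (p * ln p - p) - p * \<beta> * ln \<beta>)) = exp (- (a + p) * centre p - p) * (exp (a * centre p) * exp ((2 - \<beta>) * p))"
      by (simp add: centre_def algebra_simps flip: exp_add)
    then have "R p / exp ((1 - \<beta>) * (p * ln p - p) - p * \<beta> * ln \<beta>) * T p =
        R p * (exp (- (a + p) * centre p - p) * (exp (a * centre p) * exp ((2 - \<beta>) * p))) * T p"
      by (simp only: exp_minus divide_inverse)
    then show ?case
      unfolding inverse_kernel_tilted[OF elim] T_def by (simp only: mult_ac)
  qed
  ultimately show ?thesis
    by (auto simp: real_sqrt_mult intro: Lim_transform_eventually)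
qed

end

section \<open>Scaling of the subordinator and its inverse\<close>

text \<open>Open left half-lines are chosen because, for the inverse, {Y < a} is the event that
  translates into countably many conditions on \<open>S\<close>.\<close>

lemma real_distribution_eqI_lessThan:
  assumes "real_distribution M1" "real_distribution M2"
    and eq: "\<And>a. measure M1 {..<a} = measure M2 {..<a}"
  shows "M1 = M2"
proof -
  interpret M1: real_distribution M1
    by fact
  interpret M2: real_distribution M2
    by fact
  show ?thesis
  proof (rule measure_eqI_generator_eq[where E = "range lessThan" and \<Omega> = UNIV and A = "\<lambda>i. {..<real i}"])
    show "Int_stable (range (lessThan :: real \<Rightarrow> real set))"
    proof (rule Int_stableI, safe)
      fix a b :: real
      have "{..<a} \<inter> {..<b} = {..<min a b}"
        by auto
      then show "{..<a} \<inter> {..<b} \<in> range lessThan"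
        by simp
    qed
    show "emeasure M1 X = emeasure M2 X" if "X \<in> range lessThan" for X
      using that eq by (auto simp: M1.emeasure_eq_measure M2.emeasure_eq_measure)
    show "sets M1 = sigma_sets UNIV (range lessThan)" "sets M2 = sigma_sets UNIV (range lessThan)"
      by (simp_all add: M1.events_eq_borel M2.events_eq_borel borel_Iio)
    show "(\<Union>i. {..<real i}) = UNIV"
      by (auto intro: reals_Archimedean2)
  qed (auto simp: M1.emeasure_eq_measure)
qed

context stable_subordinator
begin

text \<open>A non-integrable function has integral 0 by convention, whereas the prescribed Laplace
  transform is positive.\<close>

lemma integrable_exp:
  assumes "r > 0" "t \<ge> 0"
  shows "integrable M (\<lambda>\<omega>. exp (- r * S t \<omega>))"
proof (rule ccontr)
  assume "\<not> ?thesis"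
  then have "expectation (\<lambda>\<omega>. exp (- r * S t \<omega>)) = 0"
    by (rule not_integrable_integral_eq)
  then show False
    using laplace_transform[OF assms] by simp
qed

text \<open>P(S t <= 0) is at most E exp(-r S t) = exp(-t r^\<beta>) for every r > 0, and this tends
  to 0 as r grows.\<close>

lemma S_time_pos:
  assumes "t > 0"
  shows "AE \<omega> in M. S t \<omega> > 0"
proof -
  have [measurable]: "S t \<in> borel_measurable M"
    using random_variable_X[of t] assms by simp
  have "prob {\<omega> \<in> space M. S t \<omega> \<le> 0} \<le> exp (- t * r powr \<beta>)" if "r > 0" for r
  proof -
    have "prob {\<omega> \<in> space M. S t \<omega> \<le> 0} = (\<integral>\<omega>. indicator {\<omega> \<in> space M. S t \<omega> \<le> 0} \<omega> \<partial>M)"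
      by simp
    also have "\<dots> \<le> (\<integral>\<omega>. exp (- r * S t \<omega>) \<partial>M)"
      using that assms integrable_exp[of r t]
      by (intro integral_mono integrable_real_indicator)
        (auto simp: indicator_def mult_nonneg_nonpos less_top[symmetric])
    finally show ?thesis
      using laplace_transform[OF that, of t] assms by simp
  qed
  then have "\<forall>\<^sub>F r in at_top. prob {\<omega> \<in> space M. S t \<omega> \<le> 0} \<le> exp (- t * r powr \<beta>)"
    by (auto intro: eventually_mono[OF eventually_gt_at_top[of 0]])
  moreover have "((\<lambda>r. exp (- t * r powr \<beta>)) \<longlongrightarrow> 0) at_top"
    using assms stability_index by real_asymp
  ultimately have "prob {\<omega> \<in> space M. S t \<omega> \<le> 0} \<le> 0"
    using tendsto_lowerbound trivial_limit_at_top_linorder by blast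
  then have "prob {\<omega> \<in> space M. \<not> S t \<omega> > 0} = 0"
    using measure_nonneg[of M "{\<omega> \<in> space M. S t \<omega> \<le> 0}"] by (simp add: not_less)
  then show ?thesis
    by (subst AE_iff_measurable[OF _ refl]) (auto simp: emeasure_eq_measure)
qed

sublocale stable_variable M "S 1" \<beta>
proof unfold_locales
  show "random_variable borel (S 1)"
    using random_variable_X[of 1] by simp
qed (use stability_index S_time_pos[of 1] laplace_transform[of _ 1] in auto)

lemma distr_S_scaling:
  assumes "t > 0"
  shows "distr M borel (S t) = distr M borel (\<lambda>\<omega>. t powr (1 / \<beta>) * S 1 \<omega>)"
proof (rule Laplace_transform_uniqueness)
  have [measurable]: "S t \<in> borel_measurable M"
    using random_variable_X[of t] assms by simp
  show "real_distribution (distr M borel (S t))" "real_distribution (distr M borel (\<lambda>\<omega>. t powr (1 / \<beta>) * S 1 \<omega>))"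
    by (auto intro!: real_distribution_distr)
  show "AE x in distr M borel (S t). x \<ge> 0"
    using S_time_pos[OF assms] by (subst AE_distr_iff) (auto elim: eventually_mono)
  show "AE x in distr M borel (\<lambda>\<omega>. t powr (1 / \<beta>) * S 1 \<omega>). x \<ge> 0"
    using S_pos by (subst AE_distr_iff) (auto elim: eventually_mono)
  fix r :: real assume r: "r > 0"
  have "(\<integral>x. exp (- r * x) \<partial>distr M borel (\<lambda>\<omega>. t powr (1 / \<beta>) * S 1 \<omega>)) =
      expectation (\<lambda>\<omega>. exp (- (r * t powr (1 / \<beta>)) * S 1 \<omega>))"
    by (simp add: integral_distr mult.assoc)
  also have "\<dots> = exp (- 1 * (r * t powr (1 / \<beta>)) powr \<beta>)"
    using r assms by (intro laplace_transform) auto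
  also have "(r * t powr (1 / \<beta>)) powr \<beta> = t * r powr \<beta>"
    using r assms stability_index by (simp add: powr_mult powr_powr)
  also have "exp (- 1 * (t * r powr \<beta>)) = (\<integral>x. exp (- r * x) \<partial>distr M borel (S t))"
    using laplace_transform[OF r, of t] assms by (simp add: integral_distr)
  finally show "(\<integral>x. exp (- r * x) \<partial>distr M borel (S t)) =
      (\<integral>x. exp (- r * x) \<partial>distr M borel (\<lambda>\<omega>. t powr (1 / \<beta>) * S 1 \<omega>))" ..
qed

lemma prob_S_gt:
  assumes "s > 0"
  shows "prob {\<omega> \<in> space M. S s \<omega> > t} = prob {\<omega> \<in> space M. s powr (1 / \<beta>) * S 1 \<omega> > t}"
proof -
  have [measurable]: "S s \<in> borel_measurable M"
    using random_variable_X[of s] assms by simp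
  have "prob {\<omega> \<in> space M. X \<omega> > t} = measure (distr M borel X) {t<..}" if "X \<in> borel_measurable M" for X
    using that by (auto simp: measure_distr intro!: arg_cong[where f = prob])
  then show ?thesis
    using distr_S_scaling[OF assms] by simp
qed

lemma prob_scaled_tendsto:
  assumes q: "incseq q" "\<And>k. q k > 0" and "t > 0"
  shows "(\<lambda>k::nat. prob {\<omega> \<in> space M. q k powr (1 / \<beta>) * S 1 \<omega> > t}) \<longlonglongrightarrow>
    prob {\<omega> \<in> space M. \<exists>k. q k powr (1 / \<beta>) * S 1 \<omega> > t}"
proof -
  have "(\<lambda>k. prob {\<omega> \<in> space M. q k powr (1 / \<beta>) * S 1 \<omega> > t}) \<longlonglongrightarrow>
      prob (\<Union>k. {\<omega> \<in> space M. q k powr (1 / \<beta>) * S 1 \<omega> > t})"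
  proof (rule finite_Lim_measure_incseq)
    show "incseq (\<lambda>k. {\<omega> \<in> space M. q k powr (1 / \<beta>) * S 1 \<omega> > t})"
    proof (rule incseq_SucI, safe)
      fix k \<omega> assume *: "t < q k powr (1 / \<beta>) * S 1 \<omega>"
      \<comment> \<open>Exceeding the positive level t forces a positive
        \<open>S 1 \<omega>\<close>, so the events increase for every \<omega>, not just almost
        surely.\<close>
      then have "S 1 \<omega> > 0"
        using \<open>t > 0\<close> by (smt (verit) mult_nonneg_nonpos powr_ge_zero)
      moreover have "q k powr (1 / \<beta>) \<le> q (Suc k) powr (1 / \<beta>)"
        using q stability_index by (intro powr_mono2) (auto simp: incseq_SucD less_imp_le)
      ultimately show "t < q (Suc k) powr (1 / \<beta>) * S 1 \<omega>"
        using * by (smt (verit) mult_right_mono)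
    qed
  qed auto
  moreover have "(\<Union>k. {\<omega> \<in> space M. q k powr (1 / \<beta>) * S 1 \<omega> > t}) = {\<omega> \<in> space M. \<exists>k. q k powr (1 / \<beta>) * S 1 \<omega> > t}"
    by auto
  ultimately show ?thesis
    by simp
qed

text \<open>Paths are monotone only almost surely, so these events need not be nested; the unions
  over j <= k are, and differ from them by null sets.\<close>

lemma prob_S_tendsto:
  assumes q: "incseq q" "\<And>k. q k > 0"
  shows "(\<lambda>k::nat. prob {\<omega> \<in> space M. S (q k) \<omega> > t}) \<longlonglongrightarrow> prob {\<omega> \<in> space M. \<exists>k. S (q k) \<omega> > t}"
proof -
  have [measurable]: "S (q k) \<in> borel_measurable M" for k
    using random_variable_X[of "q k"] q(2)[of k] by simp
  let ?U = "\<lambda>k. {\<omega> \<in> space M. \<exists>j\<le>k. S (q j) \<omega> > t}"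
  have "(\<lambda>k. prob (?U k)) \<longlonglongrightarrow> prob (\<Union>k. ?U k)"
    by (rule finite_Lim_measure_incseq) (auto simp: incseq_def intro: order_trans)
  moreover have "(\<Union>k. ?U k) = {\<omega> \<in> space M. \<exists>k. S (q k) \<omega> > t}"
    by auto
  moreover have "prob (?U k) = prob {\<omega> \<in> space M. S (q k) \<omega> > t}" for k
  proof (rule finite_measure_eq_AE)
    show "AE \<omega> in M. \<omega> \<in> ?U k \<longleftrightarrow> \<omega> \<in> {\<omega> \<in> space M. S (q k) \<omega> > t}"
      using nondecreasing_paths
    proof eventually_elim
      case (elim \<omega>)
      then have "S (q j) \<omega> \<le> S (q k) \<omega>" if "j \<le> k" for j
        using that q by (simp add: incseqD less_imp_le)
      then show ?case
        by force
    qed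
  qed auto
  ultimately show ?thesis
    by simp
qed

text \<open>Scaling identifies the marginals at single times only. Along increasing times the
  probability of ever exceeding t is a limit of marginal ones, hence the same for \<open>S\<close>
  as for k^(1 / \<beta>) S 1, where it is 1.\<close>

lemma unbounded_paths: "AE \<omega> in M. \<exists>s\<ge>0. S s \<omega> > t" if "t > 0"
proof -
  let ?q = "\<lambda>k. real (Suc k)"
  have q: "incseq ?q" "\<And>k. ?q k > 0"
    by (auto simp: incseq_def)
  have [measurable]: "S (?q k) \<in> borel_measurable M" for k
    by (intro random_variable_X) simp
  have "prob {\<omega> \<in> space M. \<exists>k. S (?q k) \<omega> > t} = prob {\<omega> \<in> space M. \<exists>k. ?q k powr (1 / \<beta>) * S 1 \<omega> > t}"
    using prob_S_tendsto[OF q, where t = t] prob_scaled_tendsto[OF q \<open>t > 0\<close>]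
    unfolding prob_S_gt[OF q(2)] by (rule LIMSEQ_unique)
  also have "\<dots> = prob (space M)"
  proof (rule finite_measure_eq_AE)
    show "AE \<omega> in M. \<omega> \<in> {\<omega> \<in> space M. \<exists>k. ?q k powr (1 / \<beta>) * S 1 \<omega> > t} \<longleftrightarrow> \<omega> \<in> space M"
      using S_pos
    proof eventually_elim
      case (elim \<omega>)
      have "filterlim (\<lambda>x. x powr (1 / \<beta>) * S 1 \<omega>) at_top at_top"
        using elim stability_index by real_asymp
      moreover have "filterlim ?q at_top sequentially"
        by (rule filterlim_compose[OF filterlim_real_sequentially filterlim_Suc])
      ultimately have "filterlim (\<lambda>k. ?q k powr (1 / \<beta>) * S 1 \<omega>) at_top sequentially"
        by (rule filterlim_compose)
      then have "\<forall>\<^sub>F k in sequentially. ?q k powr (1 / \<beta>) * S 1 \<omega> > t"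
        by (simp add: filterlim_at_top_dense)
      then show ?case
        using eventually_happens by force
    qed
  qed auto
  finally have "prob {\<omega> \<in> space M. \<exists>k. S (?q k) \<omega> > t} = 1"
    by (simp add: prob_space)
  moreover have "{\<omega> \<in> space M. \<exists>k. S (?q k) \<omega> > t} \<in> events"
    by measurable
  ultimately have "AE \<omega> in M. \<omega> \<in> {\<omega> \<in> space M. \<exists>k. S (?q k) \<omega> > t}"
    by (simp only: prob_eq_1)
  then have "AE \<omega> in M. \<exists>k. S (?q k) \<omega> > t"
    by (auto elim: eventually_mono)
  then show ?thesis
    by eventually_elim (metis of_nat_0_le_iff)
qed

text \<open>By monotonicity, exceeding t before time a can be tested along a sequence of times
  increasing to a, so countably many conditions suffice. The offset 2 keeps every time strictly
  positive, as scaling requires.\<close>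

lemma generalized_inverse_less_iff:
  assumes "t > 0" "a > 0"
  shows "AE \<omega> in M. generalized_inverse S t \<omega> < a \<longleftrightarrow> (\<exists>k::nat. S (a * (1 - 1 / real (k + 2))) \<omega> > t)"
  using nondecreasing_paths unbounded_paths[OF \<open>t > 0\<close>]
proof eventually_elim
  case (elim \<omega>)
  let ?A = "{s. 0 \<le> s \<and> S s \<omega> > t}"
  have A: "?A \<noteq> {}" "bdd_below ?A"
    using elim by (auto intro: bdd_belowI[of _ 0])
  show ?case
  proof
    assume "generalized_inverse S t \<omega> < a"
    then obtain s where s: "0 \<le> s" "S s \<omega> > t" "s < a"
      using A by (auto simp: generalized_inverse_def cInf_less_iff)
    have "((\<lambda>k. a * (1 - 1 / real (k + 2))) \<longlongrightarrow> a * (1 - 0)) sequentially"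
      by real_asymp
    then have "\<forall>\<^sub>F k in sequentially. s < a * (1 - 1 / real (k + 2))"
      using s by (intro order_tendstoD) auto
    then obtain k where "s < a * (1 - 1 / real (k + 2))"
      using eventually_happens by force
    then have "S s \<omega> \<le> S (a * (1 - 1 / real (k + 2))) \<omega>"
      using elim(1) s by simp
    then show "\<exists>k. S (a * (1 - 1 / real (k + 2))) \<omega> > t"
      using s by (intro exI[of _ k]) simp
  next
    assume "\<exists>k. S (a * (1 - 1 / real (k + 2))) \<omega> > t"
    then obtain k where k: "S (a * (1 - 1 / real (k + 2))) \<omega> > t"
      by blast
    moreover have "0 \<le> a * (1 - 1 / real (k + 2))"
      using assms by simp
    ultimately have "generalized_inverse S t \<omega> \<le> a * (1 - 1 / real (k + 2))"
      unfolding generalized_inverse_def by (intro cInf_lower A) auto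
    also have "\<dots> < a"
      using assms by (simp add: field_simps)
    finally show "generalized_inverse S t \<omega> < a" .
  qed
qed

lemma generalized_inverse_nonneg:
  assumes "t > 0"
  shows "AE \<omega> in M. generalized_inverse S t \<omega> \<ge> 0"
  using unbounded_paths[OF assms]
proof eventually_elim
  case (elim \<omega>)
  then show ?case
    unfolding generalized_inverse_def by (intro cInf_greatest) auto
qed

text \<open>P(Y < a) is the limit of P(S s > t) along times s increasing to a. By scaling each of
  these is P((t / S 1)^\<beta> < s), and the strict inequality passes exactly to the increasing
  union.\<close>

lemma law_generalized_inverse:
  assumes t: "t > 0"
  shows "law M (generalized_inverse S t) = distr M borel (\<lambda>\<omega>. (t / S 1 \<omega>) powr \<beta>)"
proof -
  interpret C: prob_space "completion M"
    by (rule prob_space_completion)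
  let ?Y = "generalized_inverse S t"
  let ?q = "\<lambda>a k. a * (1 - 1 / real (k + 2))"
  let ?U = "\<lambda>a. {\<omega> \<in> space M. \<exists>k. S (?q a k) \<omega> > t}"
  have U [measurable]: "?U a \<in> sets M" if "a > 0" for a
  proof -
    have [measurable]: "S (?q a k) \<in> borel_measurable M" for k
      using that by (intro random_variable_X) simp
    show ?thesis
      by measurable
  qed
  have eq: "AE \<omega> in completion M. \<omega> \<in> ?U a \<longleftrightarrow> \<omega> \<in> {\<omega> \<in> space M. ?Y \<omega> < a}" if "a > 0" for a
    using generalized_inverse_less_iff[OF t that] by (intro AE_completion) (auto elim: eventually_mono)
  have eq0: "AE \<omega> in completion M. \<omega> \<in> {} \<longleftrightarrow> \<omega> \<in> {\<omega> \<in> space M. ?Y \<omega> < a}" if "a \<le> 0" for a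
    using generalized_inverse_nonneg[OF t] that by (intro AE_completion) (auto elim: eventually_mono)
  \<comment> \<open>The event agrees almost surely with a measurable one, hence belongs to the
    completion; for a <= 0 the measurable one is empty.\<close>
  have sets: "{\<omega> \<in> space M. ?Y \<omega> < a} \<in> sets (completion M)" for a
  proof (cases "a > 0")
    case True
    show ?thesis
      by (rule completion.in_sets_AE[OF eq[OF True]]) (use U[OF True] in auto)
  next
    case False
    show ?thesis
      by (rule completion.in_sets_AE[OF eq0]) (use False in auto)
  qed
  then have Y: "?Y \<in> borel_measurable (completion M)"
    by (subst borel_measurable_iff_less) simp
  show "law M ?Y = distr M borel (\<lambda>\<omega>. (t / S 1 \<omega>) powr \<beta>)"
    unfolding law_def
  proof (rule real_distribution_eqI_lessThan)
    show "real_distribution (distr (completion M) borel ?Y)"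
      using Y by (rule C.real_distribution_distr)
    show "real_distribution (distr M borel (\<lambda>\<omega>. (t / S 1 \<omega>) powr \<beta>))"
      by (rule real_distribution_distr) measurable
    fix a :: real
    have *: "measure (distr (completion M) borel ?Y) {..<a} = C.prob {\<omega> \<in> space M. ?Y \<omega> < a}"
      using Y by (subst measure_distr) (auto intro!: arg_cong[where f = C.prob])
    have **: "measure (distr M borel (\<lambda>\<omega>. (t / S 1 \<omega>) powr \<beta>)) {..<a} = prob {\<omega> \<in> space M. (t / S 1 \<omega>) powr \<beta> < a}"
      by (subst measure_distr) (auto intro!: arg_cong[where f = prob])
    show "measure (distr (completion M) borel ?Y) {..<a} = measure (distr M borel (\<lambda>\<omega>. (t / S 1 \<omega>) powr \<beta>)) {..<a}"
    proof (cases "a > 0")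
      case False
      then have empty: "{\<omega> \<in> space M. (t / S 1 \<omega>) powr \<beta> < a} = {}"
        by (auto simp: not_less intro: order_trans[OF _ powr_ge_zero])
      have "C.prob {\<omega> \<in> space M. ?Y \<omega> < a} = C.prob {}"
        by (rule C.finite_measure_eq_AE[symmetric, OF eq0]) (use False sets in auto)
      then show ?thesis
        unfolding * ** empty by simp
    next
      case True
      have q: "incseq (?q a)" "\<And>k. ?q a k > 0"
        using True by (auto simp: incseq_def frac_le)
      have "C.prob {\<omega> \<in> space M. ?Y \<omega> < a} = C.prob (?U a)"
        by (rule C.finite_measure_eq_AE[symmetric, OF eq[OF True]]) (use U[OF True] sets in auto)
      also have "\<dots> = prob (?U a)"
        using U[OF True] by simp
      also have "\<dots> = prob {\<omega> \<in> space M. \<exists>k. ?q a k powr (1 / \<beta>) * S 1 \<omega> > t}"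
        using prob_S_tendsto[OF q, where t = t] prob_scaled_tendsto[OF q t]
        unfolding prob_S_gt[OF q(2)] by (rule LIMSEQ_unique)
      also have "\<dots> = prob {\<omega> \<in> space M. (t / S 1 \<omega>) powr \<beta> < a}"
      proof (rule finite_measure_eq_AE)
        show "AE \<omega> in M. \<omega> \<in> {\<omega> \<in> space M. \<exists>k. ?q a k powr (1 / \<beta>) * S 1 \<omega> > t} \<longleftrightarrow>
            \<omega> \<in> {\<omega> \<in> space M. (t / S 1 \<omega>) powr \<beta> < a}"
          using S_pos AE_space
        proof eventually_elim
          case (elim \<omega>)
          have iff: "s powr (1 / \<beta>) * S 1 \<omega> > t \<longleftrightarrow> (t / S 1 \<omega>) powr \<beta> < s" if "s > 0" for s
          proof -
            have "s powr (1 / \<beta>) * S 1 \<omega> > t \<longleftrightarrow> t / S 1 \<omega> < s powr (1 / \<beta>)"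
              using elim by (simp add: divide_less_eq)
            also have "\<dots> \<longleftrightarrow> (t / S 1 \<omega>) powr \<beta> < (s powr (1 / \<beta>)) powr \<beta>"
            proof
              assume "t / S 1 \<omega> < s powr (1 / \<beta>)"
              then show "(t / S 1 \<omega>) powr \<beta> < (s powr (1 / \<beta>)) powr \<beta>"
                using elim t stability_index by (intro powr_less_mono2) auto
            next
              assume less: "(t / S 1 \<omega>) powr \<beta> < (s powr (1 / \<beta>)) powr \<beta>"
              show "t / S 1 \<omega> < s powr (1 / \<beta>)"
              proof (rule ccontr)
                assume "\<not> t / S 1 \<omega> < s powr (1 / \<beta>)"
                then have "(s powr (1 / \<beta>)) powr \<beta> \<le> (t / S 1 \<omega>) powr \<beta>"
                  using stability_index by (intro powr_mono2) auto
                with less show False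
                  by simp
              qed
            qed
            finally show ?thesis
              using that stability_index by (simp add: powr_powr)
          qed
          have "(\<exists>k. v < ?q a k) \<longleftrightarrow> v < a" for v
          proof
            assume "v < a"
            have "((\<lambda>k. ?q a k) \<longlongrightarrow> a * (1 - 0)) sequentially"
              by real_asymp
            then have "\<forall>\<^sub>F k in sequentially. v < ?q a k"
              using \<open>v < a\<close> by (intro order_tendstoD) auto
            then show "\<exists>k. v < ?q a k"
              using eventually_happens by force
          next
            assume "\<exists>k. v < ?q a k"
            then obtain k where "v < ?q a k"
              by blast
            also have "\<dots> < a"
              using True by (simp add: field_simps)
            finally show "v < a" .
          qed
          then show ?case
            using elim iff[OF q(2)] by simp
        qed
      qed auto
      finally show ?thesis
        unfolding * ** .
    qed
  qed
qed

section \<open>Both kernels as expectations over \<open>S 1\<close>\<close>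

lemma subordinated_kernel_eq_expectation:
  fixes x y :: "real ^ 'n"
  assumes "law M (T t) = distr M borel Z" and [measurable]: "Z \<in> borel_measurable M" and Z: "AE \<omega> in M. Z \<omega> > 0"
  shows "subordinated_kernel M T t x y = expectation (\<lambda>\<omega>. gauss_kernel (Z \<omega>) x y)"
proof -
  have [measurable]: "(\<lambda>s. gauss_kernel s x y) \<in> borel_measurable borel"
    unfolding gauss_kernel_def by measurable
  have "subordinated_kernel M T t x y = expectation (\<lambda>\<omega>. indicator {0<..} (Z \<omega>) *\<^sub>R gauss_kernel (Z \<omega>) x y)"
    unfolding subordinated_kernel_def set_lebesgue_integral_def assms(1) by (subst integral_distr) auto
  also have "\<dots> = expectation (\<lambda>\<omega>. gauss_kernel (Z \<omega>) x y)"
    by (rule integral_cong_AE) (use Z in \<open>auto elim: eventually_mono\<close>)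
  finally show ?thesis .
qed

lemma subordinated_kernel_S:
  fixes x y :: "real ^ 'n"
  assumes t: "t > 0" and a: "a = real CARD('n) / 2" and r: "r = norm (x - y) * t powr (- 1 / (2 * \<beta>))"
  shows "subordinated_kernel M S t x y = (4 * pi) powr (- a) * t powr (- (a / \<beta>)) *
    expectation (\<lambda>\<omega>. S 1 \<omega> powr (- a) * exp (- (r\<^sup>2) / (4 * S 1 \<omega>)))"
proof -
  have S_t: "S t \<in> borel_measurable M"
    using random_variable_X[of t] t by simp
  have "subordinated_kernel M S t x y = expectation (\<lambda>\<omega>. gauss_kernel (t powr (1 / \<beta>) * S 1 \<omega>) x y)"
  proof (rule subordinated_kernel_eq_expectation)
    show "law M (S t) = distr M borel (\<lambda>\<omega>. t powr (1 / \<beta>) * S 1 \<omega>)"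
      unfolding law_def distr_completion[OF S_t] by (rule distr_S_scaling[OF t])
    show "AE \<omega> in M. t powr (1 / \<beta>) * S 1 \<omega> > 0"
      using S_pos by eventually_elim (use t in simp)
  qed measurable
  also have "\<dots> = expectation (\<lambda>\<omega>. (4 * pi) powr (- a) * t powr (- (a / \<beta>)) * (S 1 \<omega> powr (- a) * exp (- (r\<^sup>2) / (4 * S 1 \<omega>))))"
  proof (rule integral_cong_AE)
    show "AE \<omega> in M. gauss_kernel (t powr (1 / \<beta>) * S 1 \<omega>) x y =
        (4 * pi) powr (- a) * t powr (- (a / \<beta>)) * (S 1 \<omega> powr (- a) * exp (- (r\<^sup>2) / (4 * S 1 \<omega>)))"
      using S_pos
    proof eventually_elim
      case (elim \<omega>)
      have "1 / (4 * pi * (t powr (1 / \<beta>) * S 1 \<omega>)) powr a = (4 * pi) powr (- a) * t powr (- (a / \<beta>)) * S 1 \<omega> powr (- a)"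
        using elim t by (simp add: powr_mult powr_powr powr_minus divide_inverse mult_ac)
      moreover have "r\<^sup>2 = (norm (x - y))\<^sup>2 / t powr (1 / \<beta>)"
      proof -
        have "(t powr (- 1 / (2 * \<beta>)))\<^sup>2 = t powr (- (1 / \<beta>))"
        proof -
          have "- 1 / (2 * \<beta>) + - 1 / (2 * \<beta>) = - (1 / \<beta>)"
            using stability_index by (simp add: field_simps)
          then show ?thesis
            by (simp only: power2_eq_square powr_add[symmetric])
        qed
        then show ?thesis
          by (simp only: r power_mult_distrib powr_minus divide_inverse mult_1_left)
      qed
      then have "- (norm (x - y))\<^sup>2 / (4 * (t powr (1 / \<beta>) * S 1 \<omega>)) = - (r\<^sup>2) / (4 * S 1 \<omega>)"
        by (simp add: field_simps)
      ultimately show ?case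
        unfolding gauss_kernel_def a[symmetric] by (simp only: mult.assoc)
    qed
  qed (auto simp: gauss_kernel_def)
  also have "\<dots> = (4 * pi) powr (- a) * t powr (- (a / \<beta>)) * expectation (\<lambda>\<omega>. S 1 \<omega> powr (- a) * exp (- (r\<^sup>2) / (4 * S 1 \<omega>)))"
    by (rule integral_mult_right_zero)
  finally show ?thesis .
qed

lemma subordinated_kernel_inverse:
  fixes x y :: "real ^ 'n"
  assumes t: "t > 0" and a: "a = real CARD('n) / 2" and q: "q = (norm (x - y))\<^sup>2 * t powr (- \<beta>)"
  shows "subordinated_kernel M (generalized_inverse S) t x y = (4 * pi) powr (- a) * t powr (- (\<beta> * a)) *
    expectation (\<lambda>\<omega>. S 1 \<omega> powr (\<beta> * a) * exp (- q * S 1 \<omega> powr \<beta> / 4))"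
proof -
  have "subordinated_kernel M (generalized_inverse S) t x y = expectation (\<lambda>\<omega>. gauss_kernel ((t / S 1 \<omega>) powr \<beta>) x y)"
  proof (rule subordinated_kernel_eq_expectation)
    show "law M (generalized_inverse S t) = distr M borel (\<lambda>\<omega>. (t / S 1 \<omega>) powr \<beta>)"
      by (rule law_generalized_inverse[OF t])
    show "AE \<omega> in M. (t / S 1 \<omega>) powr \<beta> > 0"
      using S_pos by eventually_elim (use t in simp)
  qed measurable
  also have "\<dots> = expectation (\<lambda>\<omega>. (4 * pi) powr (- a) * t powr (- (\<beta> * a)) * (S 1 \<omega> powr (\<beta> * a) * exp (- q * S 1 \<omega> powr \<beta> / 4)))"
  proof (rule integral_cong_AE)
    show "AE \<omega> in M. gauss_kernel ((t / S 1 \<omega>) powr \<beta>) x y =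
        (4 * pi) powr (- a) * t powr (- (\<beta> * a)) * (S 1 \<omega> powr (\<beta> * a) * exp (- q * S 1 \<omega> powr \<beta> / 4))"
      using S_pos
    proof eventually_elim
      case (elim \<omega>)
      have "1 / (4 * pi * (t / S 1 \<omega>) powr \<beta>) powr a = (4 * pi) powr (- a) * t powr (- (\<beta> * a)) * S 1 \<omega> powr (\<beta> * a)"
        using elim t by (simp add: powr_mult powr_divide powr_powr powr_minus field_simps)
      moreover have "- (norm (x - y))\<^sup>2 / (4 * (t / S 1 \<omega>) powr \<beta>) = - q * S 1 \<omega> powr \<beta> / 4"
        using elim t unfolding q by (simp add: powr_divide powr_minus field_simps)
      ultimately show ?case
        unfolding gauss_kernel_def a[symmetric] by (simp only: mult.assoc)
    qed
  qed (auto simp: gauss_kernel_def)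
  also have "\<dots> = (4 * pi) powr (- a) * t powr (- (\<beta> * a)) * expectation (\<lambda>\<omega>. S 1 \<omega> powr (\<beta> * a) * exp (- q * S 1 \<omega> powr \<beta> / 4))"
    by (rule integral_mult_right_zero)
  finally show ?thesis .
qed

end

text \<open>On \<open>D\<close> the quotient depends on the point only through \<open>A\<close>,
  which leaves a limit in one variable. \<open>B\<close> contains the values of \<open>A\<close> on
  \<open>D\<close>, so that \<open>nhds 0\<close> may become one-sided, as (d) requires.\<close>

lemma asymp_equiv_when_tends:
  assumes lim: "(Q \<longlongrightarrow> 1) (inf F (principal B))"
    and eq: "\<And>z. z \<in> D \<Longrightarrow> A z \<in> B \<and> f z / g z = Q (A z)"
  shows "f \<sim>[when_tends A F D] g"
proof (rule asymp_equivI')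
  have "filterlim A (inf F (principal B)) (when_tends A F D)"
    unfolding when_tends_def using eq
    by (auto simp: filterlim_inf filterlim_principal eventually_inf_principal
        intro: filterlim_mono[OF filterlim_filtercomap order_refl inf_le1])
  with lim have "((\<lambda>z. Q (A z)) \<longlongrightarrow> 1) (when_tends A F D)"
    by (rule filterlim_compose)
  moreover have "\<forall>\<^sub>F z in when_tends A F D. Q (A z) = f z / g z"
    unfolding when_tends_def using eq by (auto simp: eventually_inf_principal)
  ultimately show "((\<lambda>z. f z / g z) \<longlongrightarrow> 1) (when_tends A F D)"
    by (rule Lim_transform_eventually)
qed

context stable_variable
begin

text \<open>The relation q = 4 p exp(centre p) reads q = 4 p^(2 - \<beta>) \<beta>^(-\<beta>); it is
  solved for p, and the powers of q are collected.\<close>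

lemma inverse_kernel_tendsto_at_top:
  assumes "a > 0"
  shows "((\<lambda>q. inverse_kernel_integral a q
            * q powr (a * (1 - \<beta>) / (2 - \<beta>))
            * exp ((2 - \<beta>) * 2 powr (- 2 / (2 - \<beta>)) * \<beta> powr (\<beta> / (2 - \<beta>)) * q powr (1 / (2 - \<beta>))))
          \<longlongrightarrow> 1 / sqrt (\<beta> * (2 - \<beta>)) * 4 powr (a * (1 - \<beta>) / (2 - \<beta>)) * \<beta> powr (a * \<beta> / (2 - \<beta>))) at_top"
proof -
  define p where "p q = (q * \<beta> powr \<beta> / 4) powr (1 / (2 - \<beta>))" for q
  \<comment> \<open>The factor that makes \<open>exp (a * centre (p q)) * c\<close> a pure power of
    q.\<close>
  define c where "c = 4 powr (a * (1 - \<beta>) / (2 - \<beta>)) * \<beta> powr (a * \<beta> / (2 - \<beta>))"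
  define J where "J q = inverse_kernel_integral a q" for q
  have "\<beta> powr \<beta> > 0"
    using \<beta> by simp
  then have "filterlim p at_top at_top"
    unfolding p_def using \<beta> by real_asymp
  from filterlim_compose[OF inverse_kernel_centre_tendsto[OF assms] this]
  have "((\<lambda>q. J (4 * p q * exp (centre (p q))) * exp (a * centre (p q)) * exp ((2 - \<beta>) * p q) * c) \<longlongrightarrow> 1 / sqrt (\<beta> * (2 - \<beta>)) * c) at_top"
    unfolding J_def by (rule tendsto_mult_right)
  moreover have "\<forall>\<^sub>F q in at_top. J (4 * p q * exp (centre (p q))) * exp (a * centre (p q)) * exp ((2 - \<beta>) * p q) * c =
      J q * q powr (a * (1 - \<beta>) / (2 - \<beta>))
            * exp ((2 - \<beta>) * 2 powr (- 2 / (2 - \<beta>)) * \<beta> powr (\<beta> / (2 - \<beta>)) * q powr (1 / (2 - \<beta>)))"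
    using eventually_gt_at_top[of 0]
  proof eventually_elim
    case (elim q)
    define d where "d = 1 / (2 - \<beta>)"
    have d: "(2 - \<beta>) * d = 1"
      using \<beta> by (simp add: d_def)
    have p: "p q > 0" "p q = exp (d * (ln q + \<beta> * ln \<beta> - ln 4))"
      using elim \<beta> by (simp_all add: p_def d_def powr_def ln_mult ln_div)
    then have ln_p: "ln (p q) = d * (ln q + \<beta> * ln \<beta> - ln 4)"
      by simp
    have "4 * p q * exp (centre (p q)) = exp (ln 4 + ln (p q) + centre (p q))"
      using p(1) by (simp add: exp_add)
    also have "ln 4 + ln (p q) + centre (p q) = ln 4 + ((2 - \<beta>) * d) * (ln q + \<beta> * ln \<beta> - ln 4) - \<beta> * ln \<beta>"
      unfolding centre_def ln_p by (simp add: algebra_simps)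
    also have "\<dots> = ln q"
      unfolding d by simp
    finally have 1: "4 * p q * exp (centre (p q)) = q"
      using elim by simp
    have c: "c = exp (d * (a * (1 - \<beta>)) * ln 4 + d * (a * \<beta>) * ln \<beta>)"
      using \<beta> by (simp add: c_def d_def powr_def exp_add)
    have "a * centre (p q) + (d * (a * (1 - \<beta>)) * ln 4 + d * (a * \<beta>) * ln \<beta>) =
        d * (a * (1 - \<beta>)) * ln q + (d * (a * \<beta>) * (1 + (1 - \<beta>)) - a * \<beta>) * ln \<beta>"
      unfolding centre_def ln_p by (simp add: algebra_simps)
    also have "d * (a * \<beta>) * (1 + (1 - \<beta>)) - a * \<beta> = ((2 - \<beta>) * d) * (a * \<beta>) - a * \<beta>"
      by (simp add: algebra_simps)
    also have "\<dots> = 0"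
      unfolding d by simp
    finally have 2: "exp (a * centre (p q)) * c = q powr (a * (1 - \<beta>) / (2 - \<beta>))"
      unfolding c using elim by (simp add: d_def powr_def flip: exp_add)
    \<comment> \<open>Multiplied by 2 - \<beta>, this is the exponent of (d), constant
      included.\<close>
    have 3: "p q = 2 powr (- 2 / (2 - \<beta>)) * \<beta> powr (\<beta> / (2 - \<beta>)) * q powr (1 / (2 - \<beta>))"
    proof -
      have e: "- 2 / (2 - \<beta>) = - 2 * d" "\<beta> / (2 - \<beta>) = \<beta> * d" "1 / (2 - \<beta>) = d"
        by (simp_all add: d_def)
      have ln4: "ln 4 = 2 * ln (2 :: real)"
        using ln_realpow[of 2 2] by simp
      show ?thesis
        unfolding p(2) e ln4 using elim \<beta> by (simp add: powr_def algebra_simps flip: exp_add)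
    qed
    show ?case
      unfolding 1 2[symmetric] by (simp only: 3 mult_ac)
  qed
  ultimately show ?thesis
    unfolding J_def c_def by (auto simp: mult.assoc intro: Lim_transform_eventually)
qed

end

section \<open>The asymptotics of the transition densities\<close>

text \<open>The moment of \<open>S 1\<close> in (b) involves Gamma(n / 2); this formula converts it
  to the Gamma((n + 1) / 2) and Gamma(n) of the stated constant.\<close>

lemma Gamma_legendre_duplication_real:
  fixes x :: real
  assumes "x > 0"
  shows "Gamma x * Gamma (x + 1 / 2) = 2 powr (1 - 2 * x) * sqrt pi * Gamma (2 * x)"
proof -
  have "complex_of_real x \<notin> \<int>\<^sub>\<le>\<^sub>0" "complex_of_real (x + 1 / 2) \<notin> \<int>\<^sub>\<le>\<^sub>0"
    using assms by (auto simp del: of_real_add simp: of_real_in_nonpos_Ints_iff dest: nonpos_Ints_nonpos)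
  then have "Gamma (complex_of_real x) * Gamma (complex_of_real (x + 1 / 2)) =
      exp (complex_of_real ((1 - 2 * x) * ln 2)) * of_real (sqrt pi) * Gamma (complex_of_real (2 * x))"
    using Gamma_legendre_duplication[of "complex_of_real x"] by simp
  then have "complex_of_real (Gamma x * Gamma (x + 1 / 2)) = complex_of_real (exp ((1 - 2 * x) * ln 2) * sqrt pi * Gamma (2 * x))"
    unfolding Gamma_complex_of_real exp_of_real by (simp only: of_real_mult)
  then have "Gamma x * Gamma (x + 1 / 2) = exp ((1 - 2 * x) * ln 2) * sqrt pi * Gamma (2 * x)"
    by (simp only: of_real_eq_iff)
  then show ?thesis
    by (simp add: powr_def)
qed

theorem corollary2p4:
  fixes M :: "'w measure" and S :: "real \<Rightarrow> 'w \<Rightarrow> real" and \<beta> :: real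
    and pS pSinv :: "real \<times> (real ^ 'n) \<times> (real ^ 'n) \<Rightarrow> real"
    and n K1 K2 :: real
  assumes "stable_subordinator M S \<beta>"
  defines "n \<equiv> real CARD('n)"
    and "pS \<equiv> (\<lambda>(t, x, y). subordinated_kernel M S t x y)"
    and "pSinv \<equiv> (\<lambda>(t, x, y). subordinated_kernel M (generalized_inverse S) t x y)"
    and "K1 \<equiv> 1 / sqrt (\<beta> * (2 - \<beta>)) * pi powr (- n / 2) * 2 powr (- n / (2 - \<beta>))
                * \<beta> powr (n * \<beta> / (2 * (2 - \<beta>)))"
    and "K2 \<equiv> (2 - \<beta>) * 2 powr (- 2 / (2 - \<beta>)) * \<beta> powr (\<beta> / (2 - \<beta>))"
  shows
    "(pS \<sim>[when_tends (\<lambda>(t, x, y). norm (x - y) * t powr (- 1 / (2 * \<beta>))) at_top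
             {(t, x, y). t > 0 \<and> x \<noteq> y}]
        (\<lambda>(t, x, y). \<beta> * 4 powr \<beta> * Gamma (n / 2 + \<beta>) / (pi powr (n / 2) * Gamma (1 - \<beta>))
                        * norm (x - y) powr (- n - 2 * \<beta>) * t)) \<and>
     (pS \<sim>[when_tends (\<lambda>(t, x, y). norm (x - y) * t powr (- 1 / (2 * \<beta>))) (nhds 0)
             {(t, x, y). t > 0}]
        (\<lambda>(t, x, y). Gamma ((n + 1) / 2) * Gamma (n / (2 * \<beta>))
                          / (2 * \<beta> * pi powr ((n + 1) / 2) * Gamma n)
                        * t powr (- n / (2 * \<beta>)))) \<and>
     (pSinv \<sim>[when_tends (\<lambda>(t, x, y). norm (x - y) powr (- 2 / \<beta>) * t) at_top
                {(t, x, y). t > 0 \<and> x \<noteq> y}]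
        (\<lambda>(t, x, y).
           if CARD('n) = 1 then 1 / (2 * Gamma (1 - \<beta> / 2)) * t powr (- \<beta> / 2)
           else if CARD('n) = 2 then
             \<beta> / (4 * pi * Gamma (1 - \<beta>)) * t powr (- \<beta>) * ln (norm (x - y) powr (- 2 / \<beta>) * t)
           else Gamma (n / 2 - 1) / (4 * pi powr (n / 2) * Gamma (1 - \<beta>))
                  * norm (x - y) powr (2 - n) * t powr (- \<beta>))) \<and>
     (pSinv \<sim>[when_tends (\<lambda>(t, x, y). norm (x - y) powr (- 2 / \<beta>) * t) (nhds 0)
                {(t, x, y). t > 0 \<and> x \<noteq> y}]
        (\<lambda>(t, x, y). K1 * norm (x - y) powr (- n * (1 - \<beta>) / (2 - \<beta>))
                        * t powr (- n * \<beta> / (2 * (2 - \<beta>)))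
                        * exp (- K2 * norm (x - y) powr (2 / (2 - \<beta>)) * t powr (- \<beta> / (2 - \<beta>)))))"
proof -
  interpret stable_subordinator M S \<beta>
    by fact
  define a where "a = n / 2"
  have a: "a > 0" "a = real CARD('n) / 2" "n = 2 * a"
    by (simp_all add: a_def n_def)
  define \<Phi> where "\<Phi> r = expectation (\<lambda>\<omega>. S 1 \<omega> powr (- a) * exp (- (r\<^sup>2) / (4 * S 1 \<omega>)))" for r
  define \<Psi> where "\<Psi> q = expectation (\<lambda>\<omega>. S 1 \<omega> powr (\<beta> * a) * exp (- q * S 1 \<omega> powr \<beta> / 4))" for q
  have pS: "pS (t, x, y) = (4 * pi) powr (- a) * t powr (- (a / \<beta>)) * \<Phi> (norm (x - y) * t powr (- 1 / (2 * \<beta>)))" if "t > 0" for t x y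
    unfolding pS_def \<Phi>_def using subordinated_kernel_S[OF that a(2) refl] by simp
  have pSinv: "pSinv (t, x, y) = (4 * pi) powr (- a) * t powr (- (\<beta> * a)) * \<Psi> ((norm (x - y))\<^sup>2 * t powr (- \<beta>))" if "t > 0" for t x y
    unfolding pSinv_def \<Psi>_def using subordinated_kernel_inverse[OF that a(2) refl] by simp
  \<comment> \<open>The argument of \<Psi> is the power -\<beta> of the quantity controlled in (c)
    and (d), so these limits become q -> 0 and q -> infinity.\<close>
  have q: "(norm (x - y))\<^sup>2 * t powr (- \<beta>) = (norm (x - y) powr (- 2 / \<beta>) * t) powr (- \<beta>)" if "t > 0" "x \<noteq> y" for t and x y :: "real ^ 'n"
    using that \<beta> by (simp add: powr_mult powr_powr flip: powr_numeral)
  have \<Gamma>: "Gamma (1 - \<beta>) \<noteq> 0" "Gamma (1 - \<beta> / 2) \<noteq> 0" "Gamma (a + \<beta>) \<noteq> 0"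
    by (rule less_imp_neq[symmetric], rule Gamma_real_pos, use \<beta> a in simp)+
  have q_at_top: "filterlim (\<lambda>A. A powr (- \<beta>)) (at_right 0) at_top" and q_at_right_0: "filterlim (\<lambda>A. A powr (- \<beta>)) at_top (at_right 0)"
    using \<beta> by real_asymp+
  show ?thesis
  proof (intro conjI)
    let ?A = "\<lambda>(t, x :: real ^ 'n, y). norm (x - y) * t powr (- 1 / (2 * \<beta>))"
    let ?K = "\<beta> * 4 powr \<beta> * Gamma (n / 2 + \<beta>) / (pi powr (n / 2) * Gamma (1 - \<beta>))"
    show "pS \<sim>[when_tends ?A at_top {(t, x, y). t > 0 \<and> x \<noteq> y}]
        (\<lambda>(t, x, y). ?K * norm (x - y) powr (- n - 2 * \<beta>) * t)"
    proof (rule asymp_equiv_when_tends)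
      show "((\<lambda>r. (4 * pi) powr (- a) / ?K * (r powr (2 * a + 2 * \<beta>) * \<Phi> r)) \<longlongrightarrow> 1) (inf at_top (principal {0<..}))"
      proof (rule filterlim_mono[OF _ order_refl inf_le1])
        have "((\<lambda>r. (4 * pi) powr (- a) / ?K * (r powr (2 * a + 2 * \<beta>) * \<Phi> r)) \<longlongrightarrow>
            (4 * pi) powr (- a) / ?K * (\<beta> * 4 powr (a + \<beta>) * Gamma (a + \<beta>) / Gamma (1 - \<beta>))) at_top"
          unfolding \<Phi>_def by (intro tendsto_mult_left kernel_tendsto_at_top a)
        moreover have "(4 * pi) powr (- a) / ?K * (\<beta> * 4 powr (a + \<beta>) * Gamma (a + \<beta>) / Gamma (1 - \<beta>)) = 1"
          unfolding a_def[symmetric] using \<Gamma> \<beta> by (simp add: powr_mult powr_add powr_minus field_simps)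
        ultimately show "((\<lambda>r. (4 * pi) powr (- a) / ?K * (r powr (2 * a + 2 * \<beta>) * \<Phi> r)) \<longlongrightarrow> 1) at_top"
          by (simp only:)
      qed
      fix z :: "real \<times> (real ^ 'n) \<times> (real ^ 'n)" assume "z \<in> {(t, x, y). t > 0 \<and> x \<noteq> y}"
      then obtain t x y where z: "z = (t, x, y)" "t > 0" "x \<noteq> y"
        by auto
      define r where "r = norm (x - y) * t powr (- 1 / (2 * \<beta>))"
      \<comment> \<open>The power of t produced here is the prefactor t^(-a / \<beta>) of p^S
        divided by the factor t of the claimed asymptotics.\<close>
      have "r powr (2 * a + 2 * \<beta>) = norm (x - y) powr (2 * a + 2 * \<beta>) * t powr (- (a / \<beta>) - 1)"
      proof -
        have "- 1 / (2 * \<beta>) * (2 * a + 2 * \<beta>) = - (a / \<beta>) - 1"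
          using \<beta> by (simp add: field_simps)
        then show ?thesis
          using z by (simp only: r_def powr_mult norm_ge_zero powr_ge_zero powr_powr)
      qed
      moreover have "norm (x - y) powr (- n - 2 * \<beta>) = 1 / norm (x - y) powr (2 * a + 2 * \<beta>)"
        using a powr_minus_divide[of "norm (x - y)" "2 * a + 2 * \<beta>"] by simp
      moreover have "t powr (- (a / \<beta>) - 1) = t powr (- (a / \<beta>)) / t"
        using z by (simp add: powr_diff)
      ultimately show "(?A z) \<in> {0<..} \<and>
          pS z / (case z of (t, x, y) \<Rightarrow> ?K * norm (x - y) powr (- n - 2 * \<beta>) * t) =
          (4 * pi) powr (- a) / ?K * ((?A z) powr (2 * a + 2 * \<beta>) *
            \<Phi> (?A z))"
        using z by (simp add: pS r_def[symmetric]) (simp add: r_def mult_ac)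
    qed
  next
    let ?A = "\<lambda>(t, x :: real ^ 'n, y). norm (x - y) * t powr (- 1 / (2 * \<beta>))"
    let ?K = "Gamma ((n + 1) / 2) * Gamma (n / (2 * \<beta>)) / (2 * \<beta> * pi powr ((n + 1) / 2) * Gamma n)"
    \<comment> \<open>After duplication the factor Gamma(2 a) cancels Gamma(n), and the power of 2
      combines with the powers of pi into (4 pi)^(-a).\<close>
    have K: "?K = (4 * pi) powr (- a) * (Gamma (1 + a / \<beta>) / Gamma (1 + a))"
    proof -
      have nonzero: "Gamma (2 * a) \<noteq> 0" "Gamma a \<noteq> 0"
        by (rule less_imp_neq[symmetric], rule Gamma_real_pos, use a(1) in simp)+
      have G: "Gamma (a + 1 / 2) = 2 powr (1 - 2 * a) * sqrt pi * Gamma (2 * a) / Gamma a"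
        using Gamma_legendre_duplication_real[OF a(1)] nonzero by (simp add: field_simps)
      have e: "(n + 1) / 2 = a + 1 / 2" "n / (2 * \<beta>) = a / \<beta>"
        using a by (simp_all add: add_divide_distrib)
      have G1: "Gamma (1 + a / \<beta>) = a / \<beta> * Gamma (a / \<beta>)" "Gamma (1 + a) = a * Gamma a"
        using Gamma_real_plus1[of "a / \<beta>"] Gamma_real_plus1[of a] a(1) \<beta> by (simp_all add: add.commute)
      have P: "pi powr (a + 1 / 2) = pi powr a * sqrt pi"
        by (simp add: powr_add powr_half_sqrt)
      have P4: "(4 * pi) powr (- a) = 2 powr (1 - 2 * a) / (2 * pi powr a)"
        using powr_powr[of 2 2 a] by (simp add: powr_mult powr_diff powr_minus field_simps)
      show ?thesis
        unfolding e G G1 P P4 unfolding a(3) using nonzero a(1) \<beta> by simp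
    qed
    have K0: "?K \<noteq> 0"
    proof -
      have "Gamma (1 + a / \<beta>) > 0" "Gamma (1 + a) > 0"
        by (rule Gamma_real_pos, use a(1) \<beta> in \<open>simp add: add_pos_pos\<close>)+
      then show ?thesis
        unfolding K by (intro less_imp_neq[symmetric] mult_pos_pos divide_pos_pos) auto
    qed
    show "pS \<sim>[when_tends ?A (nhds 0) {(t, x, y). t > 0}]
        (\<lambda>(t, x, y). ?K * t powr (- n / (2 * \<beta>)))"
    proof (rule asymp_equiv_when_tends)
      show "((\<lambda>r. (4 * pi) powr (- a) * \<Phi> r / ?K) \<longlongrightarrow> 1) (inf (nhds 0) (principal UNIV))"
      proof -
        have "((\<lambda>r. (4 * pi) powr (- a) * \<Phi> r / ?K) \<longlongrightarrow> (4 * pi) powr (- a) * (Gamma (1 + a / \<beta>) / Gamma (1 + a)) / ?K) (nhds 0)"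
          unfolding \<Phi>_def by (intro tendsto_divide tendsto_mult_left tendsto_const kernel_tendsto_0 a K0)
        then show ?thesis
          unfolding K[symmetric] using K0 by simp
      qed
      fix z :: "real \<times> (real ^ 'n) \<times> (real ^ 'n)" assume "z \<in> {(t, x, y). t > 0}"
      then obtain t x y where z: "z = (t, x, y)" "t > 0"
        by auto
      have "- n / (2 * \<beta>) = - (a / \<beta>)"
        using a by simp
      then show "(?A z) \<in> UNIV \<and>
          pS z / (case z of (t, x, y) \<Rightarrow> ?K * t powr (- n / (2 * \<beta>))) =
          (4 * pi) powr (- a) * \<Phi> (?A z) / ?K"
        using z by (simp only: pS prod.case) simp
    qed
  next
    let ?A = "\<lambda>(t, x, y). norm (x - y) powr (- 2 / \<beta>) * t :: real"
    let ?D = "{(t, x, y). t > 0 \<and> x \<noteq> y} :: (real \<times> (real ^ 'n) \<times> (real ^ 'n)) set"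
    consider "CARD('n) = 1" | "CARD('n) = 2" | "CARD('n) \<ge> 3"
      using zero_less_card_finite[where 'a = 'n] by linarith
    then show "pSinv \<sim>[when_tends ?A at_top ?D]
        (\<lambda>(t, x, y).
           if CARD('n) = 1 then 1 / (2 * Gamma (1 - \<beta> / 2)) * t powr (- \<beta> / 2)
           else if CARD('n) = 2 then
             \<beta> / (4 * pi * Gamma (1 - \<beta>)) * t powr (- \<beta>) * ln (norm (x - y) powr (- 2 / \<beta>) * t)
           else Gamma (n / 2 - 1) / (4 * pi powr (n / 2) * Gamma (1 - \<beta>))
                  * norm (x - y) powr (2 - n) * t powr (- \<beta>))" (is "_ \<sim>[_] ?g")
    proof cases
      case 1
      then have half: "a = 1 / 2"
        by (simp add: a)
      show ?thesis
      proof (rule asymp_equiv_when_tends)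
        have "((\<lambda>A. \<Psi> (A powr (- \<beta>)) / sqrt pi * Gamma (1 - \<beta> / 2)) \<longlongrightarrow> sqrt pi / Gamma (1 - \<beta> / 2) / sqrt pi * Gamma (1 - \<beta> / 2)) at_top"
          using filterlim_compose[OF inverse_kernel_tendsto_0_half q_at_top]
          unfolding \<Psi>_def half by (intro tendsto_intros) auto
        then show "((\<lambda>A. \<Psi> (A powr (- \<beta>)) / sqrt pi * Gamma (1 - \<beta> / 2)) \<longlongrightarrow> 1) (inf at_top (principal UNIV))"
          using \<Gamma> by simp
        fix z assume "z \<in> ?D"
        then obtain t x y where z: "z = (t, x, y)" "t > 0" "x \<noteq> y"
          by auto
        have "(4 * pi) powr (- a) = 1 / (2 * sqrt pi)"
          by (simp add: half powr_minus_divide powr_half_sqrt real_sqrt_mult)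
        moreover have "pSinv z = (4 * pi) powr (- a) * t powr (- (\<beta> * a)) * \<Psi> (?A z powr (- \<beta>))"
          using z by (simp only: pSinv q[OF z(2,3)] prod.case)
        moreover have "?g z = 1 / (2 * Gamma (1 - \<beta> / 2)) * t powr (- (\<beta> * a))"
          using z 1 by (simp add: half)
        ultimately show "?A z \<in> UNIV \<and> pSinv z / ?g z = \<Psi> (?A z powr (- \<beta>)) / sqrt pi * Gamma (1 - \<beta> / 2)"
          using z by simp
      qed
    next
      case 2
      then have one: "a = 1"
        by (simp add: a)
      show ?thesis
      proof (rule asymp_equiv_when_tends)
        have "((\<lambda>A. \<Psi> (A powr (- \<beta>)) / (- ln (A powr (- \<beta>))) * Gamma (1 - \<beta>)) \<longlongrightarrow> 1 / Gamma (1 - \<beta>) * Gamma (1 - \<beta>)) at_top"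
          using filterlim_compose[OF inverse_kernel_tendsto_0_eq_1 q_at_top]
          unfolding \<Psi>_def one by (intro tendsto_mult_right) simp
        then show "((\<lambda>A. \<Psi> (A powr (- \<beta>)) / (- ln (A powr (- \<beta>))) * Gamma (1 - \<beta>)) \<longlongrightarrow> 1) (inf at_top (principal UNIV))"
          using \<Gamma> by simp
        fix z assume "z \<in> ?D"
        then obtain t x y where z: "z = (t, x, y)" "t > 0" "x \<noteq> y"
          by auto
        define A where "A = norm (x - y) powr (- 2 / \<beta>) * t"
        have "A > 0"
          using z by (simp add: A_def)
        \<comment> \<open>The factor \<beta> of the constant for n = 2 comes from here: -ln q is
          \<beta> times the logarithm in the statement.\<close>
        then have "- ln (A powr (- \<beta>)) = \<beta> * ln A"
          by (simp add: ln_powr)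
        moreover have "pSinv z = (4 * pi) powr (- a) * t powr (- (\<beta> * a)) * \<Psi> (A powr (- \<beta>))"
          using z by (simp only: pSinv q[OF z(2,3)] A_def)
        then have "pSinv z = 1 / (4 * pi) * t powr (- \<beta>) * \<Psi> (A powr (- \<beta>))"
          by (simp add: one powr_minus_divide)
        moreover have "?g z = \<beta> / (4 * pi * Gamma (1 - \<beta>)) * t powr (- \<beta>) * ln A"
          using z 2 by (simp add: A_def)
        moreover have "?A z = A"
          using z by (simp add: A_def)
        ultimately show "?A z \<in> UNIV \<and> pSinv z / ?g z = \<Psi> (?A z powr (- \<beta>)) / (- ln (?A z powr (- \<beta>))) * Gamma (1 - \<beta>)"
          using z \<Gamma> by simp
      qed
    next
      case 3
      then have "a > 1"
        by (simp add: a)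
      let ?K = "Gamma (n / 2 - 1) / (4 * pi powr (n / 2) * Gamma (1 - \<beta>))"
      show ?thesis
      proof (rule asymp_equiv_when_tends)
        have "((\<lambda>A. (4 * pi) powr (- a) / ?K * ((A powr (- \<beta>)) powr (a - 1) * \<Psi> (A powr (- \<beta>)))) \<longlongrightarrow>
            (4 * pi) powr (- a) / ?K * (4 powr (a - 1) * Gamma (a - 1) / Gamma (1 - \<beta>))) at_top"
          using filterlim_compose[OF inverse_kernel_tendsto_0_gt_1[OF \<open>a > 1\<close>] q_at_top]
          unfolding \<Psi>_def by (intro tendsto_mult_left)
        moreover have "(4 * pi) powr (- a) / ?K * (4 powr (a - 1) * Gamma (a - 1) / Gamma (1 - \<beta>)) = 1"
        proof -
          have "Gamma (a - 1) \<noteq> 0"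
            by (rule less_imp_neq[symmetric], rule Gamma_real_pos) (use \<open>a > 1\<close> in simp)
          then show ?thesis
            unfolding a_def[symmetric] using \<Gamma> by (simp add: powr_mult powr_diff powr_minus field_simps)
        qed
        ultimately show "((\<lambda>A. (4 * pi) powr (- a) / ?K * ((A powr (- \<beta>)) powr (a - 1) * \<Psi> (A powr (- \<beta>)))) \<longlongrightarrow> 1) (inf at_top (principal UNIV))"
          by simp
        fix z assume "z \<in> ?D"
        then obtain t x y where z: "z = (t, x, y)" "t > 0" "x \<noteq> y"
          by auto
        define p where "p = (norm (x - y))\<^sup>2 * t powr (- \<beta>)"
        have "p powr (a - 1) = norm (x - y) powr (n - 2) * t powr (- (\<beta> * (a - 1)))"
          using z a by (simp add: p_def powr_mult powr_powr algebra_simps flip: powr_numeral)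
        moreover have "t powr (- (\<beta> * (a - 1))) = t powr \<beta> * t powr (- (\<beta> * a))"
          by (simp add: algebra_simps flip: powr_add)
        moreover have "norm (x - y) powr (2 - n) = 1 / norm (x - y) powr (n - 2)" "t powr (- \<beta>) = 1 / t powr \<beta>"
          using powr_minus_divide[of _ "n - 2"] by (simp_all add: powr_minus_divide)
        moreover have "?g z = ?K * norm (x - y) powr (2 - n) * t powr (- \<beta>)"
          using z 3 by simp
        moreover have "pSinv z = (4 * pi) powr (- a) * t powr (- (\<beta> * a)) * \<Psi> p"
          using z by (simp only: pSinv p_def)
        moreover have "?A z powr (- \<beta>) = p"
          using z by (simp only: q[OF z(2,3)] p_def prod.case)
        ultimately show "?A z \<in> UNIV \<and> pSinv z / ?g z = (4 * pi) powr (- a) / ?K * ((?A z powr (- \<beta>)) powr (a - 1) * \<Psi> (?A z powr (- \<beta>)))"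
          using z by simp
      qed
    qed
  next
    let ?A = "\<lambda>(t, x, y). norm (x - y) powr (- 2 / \<beta>) * t :: real"
    let ?D = "{(t, x, y). t > 0 \<and> x \<noteq> y} :: (real \<times> (real ^ 'n) \<times> (real ^ 'n)) set"
    let ?g = "\<lambda>(t, x, y). K1 * norm (x - y) powr (- n * (1 - \<beta>) / (2 - \<beta>))
                        * t powr (- n * \<beta> / (2 * (2 - \<beta>)))
                        * exp (- K2 * norm (x - y) powr (2 / (2 - \<beta>)) * t powr (- \<beta> / (2 - \<beta>)))"
    let ?Q = "\<lambda>q. (4 * pi) powr (- a) / K1 * (\<Psi> q * q powr (a * (1 - \<beta>) / (2 - \<beta>)) * exp (K2 * q powr (1 / (2 - \<beta>))))"
    \<comment> \<open>The limit supplied by the saddle-point analysis. Multiplying by (4 pi)^(-a)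
      gives \<open>K1\<close>, since 4^(a (1 - \<beta>) / (2 - \<beta>) - a) = 2^(-n / (2 -
      \<beta>)).\<close>
    define L where "L = 1 / sqrt (\<beta> * (2 - \<beta>)) * 4 powr (a * (1 - \<beta>) / (2 - \<beta>)) * \<beta> powr (a * \<beta> / (2 - \<beta>))"
    have K1: "K1 = L * (4 * pi) powr (- a)"
    proof -
      have e1: "2 powr (- n / (2 - \<beta>)) = (4 :: real) powr (a * (1 - \<beta>) / (2 - \<beta>) + - a)"
      proof -
        have "a * (1 - \<beta>) / (2 - \<beta>) + - a = - (a / (2 - \<beta>))"
          using \<beta> by (simp add: field_simps)
        moreover have "- n / (2 - \<beta>) = 2 * - (a / (2 - \<beta>))"
          by (simp add: a(3))
        moreover have "(2 :: real) powr (2 * - (a / (2 - \<beta>))) = 4 powr - (a / (2 - \<beta>))"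
          unfolding powr_powr[symmetric] by simp
        ultimately show ?thesis
          by (simp only:)
      qed
      have e2: "pi powr (- n / 2) = pi powr (- a)"
        by (simp add: a(3))
      have e3: "n * \<beta> / (2 * (2 - \<beta>)) = a * \<beta> / (2 - \<beta>)"
        unfolding a(3) mult.assoc by (rule mult_divide_mult_cancel_left) simp
      show ?thesis
        unfolding K1_def L_def e1 e2 e3 powr_add by (simp add: powr_mult)
    qed
    have "K1 > 0"
      using \<beta> by (simp add: K1_def)
    have "(4 * pi) powr (- a) / K1 * L = L * (4 * pi) powr (- a) / K1"
      by simp
    also have "\<dots> = 1"
      unfolding K1[symmetric] using \<open>K1 > 0\<close> by simp
    finally have "(4 * pi) powr (- a) / K1 * L = 1" .
    moreover have "(?Q \<longlongrightarrow> (4 * pi) powr (- a) / K1 * L) at_top"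
      unfolding L_def K2_def \<Psi>_def by (intro tendsto_mult_left inverse_kernel_tendsto_at_top a)
    ultimately have Q: "(?Q \<longlongrightarrow> 1) at_top"
      by (simp only:)
    show "pSinv \<sim>[when_tends ?A (nhds 0) ?D] ?g"
    proof (rule asymp_equiv_when_tends)
      have "((\<lambda>A. ?Q (A powr (- \<beta>))) \<longlongrightarrow> 1) (at_right 0)"
        using Q q_at_right_0 by (rule filterlim_compose)
      then show "((\<lambda>A. ?Q (A powr (- \<beta>))) \<longlongrightarrow> 1) (inf (nhds 0) (principal {0<..}))"
        by (simp add: at_within_def)
      fix z assume "z \<in> ?D"
      then obtain t x y where z: "z = (t, x, y)" "t > 0" "x \<noteq> y"
        by auto
      define p where "p = (norm (x - y))\<^sup>2 * t powr (- \<beta>)"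
      have p: "p powr e = norm (x - y) powr (2 * e) * t powr (- (\<beta> * e))" for e
        using z by (simp add: p_def powr_mult powr_powr flip: powr_numeral)
      have 1: "norm (x - y) powr (- n * (1 - \<beta>) / (2 - \<beta>)) * t powr (- n * \<beta> / (2 * (2 - \<beta>))) =
          t powr (- (\<beta> * a)) / p powr (a * (1 - \<beta>) / (2 - \<beta>))"
      proof -
        define e where "e = a * (1 - \<beta>) / (2 - \<beta>)"
        have e1: "- n * (1 - \<beta>) / (2 - \<beta>) = - (2 * e)"
          by (simp add: e_def a(3))
        have e2: "- n * \<beta> / (2 * (2 - \<beta>)) = - (\<beta> * a) + \<beta> * e"
          using \<beta> by (simp add: e_def a(3) field_simps)
        show ?thesis
          unfolding e_def[symmetric] p e1 e2 powr_add by (simp add: powr_minus divide_inverse mult_ac)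
      qed
      have 2: "norm (x - y) powr (2 / (2 - \<beta>)) * t powr (- \<beta> / (2 - \<beta>)) = p powr (1 / (2 - \<beta>))"
        unfolding p by simp
      have "p > 0"
        using z by (simp add: p_def)
      have g: "?g z = K1 * (norm (x - y) powr (- n * (1 - \<beta>) / (2 - \<beta>)) * t powr (- n * \<beta> / (2 * (2 - \<beta>)))) *
          exp (- (K2 * (norm (x - y) powr (2 / (2 - \<beta>)) * t powr (- \<beta> / (2 - \<beta>)))))"
        using z by (simp add: mult.assoc)
      moreover have "pSinv z = (4 * pi) powr (- a) * t powr (- (\<beta> * a)) * \<Psi> p"
        using z by (simp only: pSinv p_def)
      moreover have "?A z powr (- \<beta>) = p"
        using z by (simp only: q[OF z(2,3)] p_def prod.case)
      moreover have "?A z > 0"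
        using z by simp
      ultimately show "?A z \<in> {0<..} \<and> pSinv z / ?g z = ?Q (?A z powr (- \<beta>))"
        unfolding 1 2 using z \<open>p > 0\<close> by (simp only: exp_minus greaterThan_iff) (simp add: divide_inverse)
    qed
  qed
qed

end
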